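(* For every $s\in(0,1)$ there exists a minimizer of $\hat{\mathscr{W}}_{s,\frac1s}$ in $C$, i.e. there is $E\in C$ such that $\hat{\mathscr{W}}_{s,\frac1s}(\partial E)\le\hat{\mathscr{W}}_{s,\frac1s}(\partial F)$ for all $F\in C$.
   Context: For a measurable set $E\subset\mathbb{R}^2$, $s\in(0,1)$ and $x\in\partial E$, the nonlocal mean curvature is $$H^s_{\partial E}(x)=\lim_{\varepsilon\to0^+}\int_{\mathbb{R}^2\setminus B_\varepsilon(x)}\frac{\chi_{E^c}(y)-\chi_E(y)}{|x-y|^{2+s}}\,dy,$$ whenever the limit exists. For $p\ge1$, $$\hat{\mathscr{W}}_{s,p}(\partial E)=\int_{\partial E}|H^s_{\partial E}(x)|^p\,d\sigma^1(x),$$ where $\sigma^1$ is one-dimensional (Hausdorff) measure, for measurable $E$ such that $H^s_{\partial E}(x)$ exists for a.e. $x\in\partial E$; for all other measurable sets $\hat{\mathscr{W}}_{s,p}(\partial E):=+\infty$. $C$ is the class of all sets $E\subset\mathbb{R}^2$ that are convex and bounded, have nonempty interior, and whose boundary $\partial E$ is $C^1$. *)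

theory Defs
  imports "HOL-Analysis.Analysis"
begin

subsection \<open>One-dimensional Hausdorff measure\<close>

text \<open>
  The covering sets are required to be bounded because \<^const>\<open>diameter\<close> carries no
  information on unbounded sets.
\<close>

definition hausdorff1_pre :: "real \<Rightarrow> 'a::metric_space set \<Rightarrow> ennreal" where
  "hausdorff1_pre \<delta> A =
     (INF U\<in>{U :: nat \<Rightarrow> 'a set. A \<subseteq> (\<Union>i. U i) \<and> (\<forall>i. bounded (U i) \<and> diameter (U i) \<le> \<delta>)}.
        \<Sum>i. ennreal (diameter (U i)))"

definition hausdorff1_outer :: "'a::metric_space set \<Rightarrow> ennreal" where
  "hausdorff1_outer A = (SUP \<delta>\<in>{0<..}. hausdorff1_pre \<delta> A)"

text \<open>The measure lives on all Caratheodory-measurable sets, so it is complete.\<close>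

definition hausdorff1 :: "'a::metric_space measure" where
  "hausdorff1 = measure_of UNIV (lambda_system UNIV (Pow UNIV) hausdorff1_outer) hausdorff1_outer"

text \<open>
  \<^const>\<open>measure_of\<close> yields the zero measure unless it is applied to an actual measure space;
  the following facts rule this out.
\<close>

lemma hausdorff1_pre_empty:
  assumes "0 < \<delta>"
  shows "hausdorff1_pre \<delta> ({} :: 'a::metric_space set) = 0"
proof -
  have "hausdorff1_pre \<delta> ({} :: 'a set) \<le> (\<Sum>i::nat. ennreal (diameter ({} :: 'a set)))"
    unfolding hausdorff1_pre_def
    by (rule INF_lower) (use assms in auto)
  then show ?thesis by simp
qed

lemma hausdorff1_pre_mono: "A \<subseteq> B \<Longrightarrow> hausdorff1_pre \<delta> A \<le> hausdorff1_pre \<delta> B"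
  unfolding hausdorff1_pre_def by (rule INF_superset_mono) auto

lemma hausdorff1_pre_countable_Union:
  fixes A :: "nat \<Rightarrow> 'a::metric_space set"
  shows "hausdorff1_pre \<delta> (\<Union>i. A i) \<le> (\<Sum>n. hausdorff1_pre \<delta> (A n))"
proof (rule ennreal_le_epsilon)
  fix e :: real
  assume e: "0 < e" and fin: "(\<Sum>n. hausdorff1_pre \<delta> (A n)) < top"
  let ?K = "\<lambda>X U. X \<subseteq> (\<Union>i::nat. U i) \<and> (\<forall>i. bounded (U i) \<and> diameter (U i) \<le> \<delta>)"
  have *: "hausdorff1_pre \<delta> (A n) < hausdorff1_pre \<delta> (A n) + e * (1/2)^Suc n" for n
    using e fin by (auto simp add: less_top dest!: ennreal_suminf_lessD)
  have "\<exists>U. ?K (A n) U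
        \<and> (\<Sum>i. ennreal (diameter (U i))) \<le> hausdorff1_pre \<delta> (A n) + e * (1/2)^Suc n" for n
    using *[of n] unfolding hausdorff1_pre_def INF_less_iff by (auto intro: less_imp_le)
  then obtain B where B: "\<And>n. ?K (A n) (B n)"
    and Ble: "\<And>n. (\<Sum>i. ennreal (diameter (B n i)))
                    \<le> hausdorff1_pre \<delta> (A n) + e * (1/2)^Suc n"
    by metis
  define C where "C = case_prod B o prod_decode"
  have "(\<Union>i. A i) \<subseteq> (\<Union>i. C i)"
    using B by (auto simp add: C_def subset_eq) (metis prod.case prod_encode_inverse)
  moreover have "bounded (C i) \<and> diameter (C i) \<le> \<delta>" for i
    using B by (auto simp: C_def split_def)
  ultimately have "hausdorff1_pre \<delta> (\<Union>i. A i) \<le> (\<Sum>i. ennreal (diameter (C i)))"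
    unfolding hausdorff1_pre_def by (intro INF_lower) auto
  also have "\<dots> = (\<Sum>n. \<Sum>i. ennreal (diameter (B n i)))"
    unfolding C_def comp_def
    using suminf_ennreal_2dimen[of _ "\<lambda>p. ennreal (diameter (case_prod B p))"] by auto
  also have "\<dots> \<le> (\<Sum>n. hausdorff1_pre \<delta> (A n) + e * (1/2) ^ Suc n)"
    by (intro suminf_le allI Ble) auto
  also have "\<dots> = (\<Sum>n. hausdorff1_pre \<delta> (A n)) + (\<Sum>n. ennreal e * ennreal ((1/2) ^ Suc n))"
    using e by (subst suminf_add[symmetric])
               (auto simp del: ennreal_suminf_cmult simp add: ennreal_mult[symmetric])
  also have "\<dots> = (\<Sum>n. hausdorff1_pre \<delta> (A n)) + e"
    unfolding ennreal_suminf_cmult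
    by (subst suminf_ennreal_eq[OF zero_le_power power_half_series]) auto
  finally show "hausdorff1_pre \<delta> (\<Union>i. A i) \<le> (\<Sum>n. hausdorff1_pre \<delta> (A n)) + e" .
qed

lemma outer_measure_space_hausdorff1:
  "outer_measure_space (Pow UNIV) (hausdorff1_outer :: 'a::metric_space set \<Rightarrow> ennreal)"
  unfolding outer_measure_space_def
proof (intro conjI)
  show "positive (Pow UNIV) (hausdorff1_outer :: 'a set \<Rightarrow> ennreal)"
    by (auto simp: positive_def hausdorff1_outer_def hausdorff1_pre_empty intro!: SUP_eq_const)
  show "increasing (Pow UNIV) (hausdorff1_outer :: 'a set \<Rightarrow> ennreal)"
    by (auto simp: increasing_def hausdorff1_outer_def intro!: SUP_mono' hausdorff1_pre_mono)
  show "countably_subadditive (Pow UNIV) (hausdorff1_outer :: 'a set \<Rightarrow> ennreal)"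
    unfolding countably_subadditive_def
  proof (intro allI impI)
    fix A :: "nat \<Rightarrow> 'a set"
    show "hausdorff1_outer (\<Union>i. A i) \<le> (\<Sum>i. hausdorff1_outer (A i))"
      unfolding hausdorff1_outer_def[of "\<Union>i. A i"]
    proof (rule SUP_least)
      fix \<delta> :: real
      assume "\<delta> \<in> {0<..}"
      then have "hausdorff1_pre \<delta> (A i) \<le> hausdorff1_outer (A i)" for i
        unfolding hausdorff1_outer_def by (rule SUP_upper)
      then have "(\<Sum>n. hausdorff1_pre \<delta> (A n)) \<le> (\<Sum>i. hausdorff1_outer (A i))"
        by (intro suminf_le) auto
      with hausdorff1_pre_countable_Union[of \<delta> A]
      show "hausdorff1_pre \<delta> (\<Union>i. A i) \<le> (\<Sum>i. hausdorff1_outer (A i))"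
        by (rule order_trans)
    qed
  qed
qed

lemma measure_space_hausdorff1:
  "measure_space UNIV (lambda_system UNIV (Pow UNIV) hausdorff1_outer)
     (hausdorff1_outer :: 'a::metric_space set \<Rightarrow> ennreal)"
  by (rule sigma_algebra.caratheodory_lemma[OF sigma_algebra_Pow outer_measure_space_hausdorff1])

lemma space_hausdorff1 [simp]: "space hausdorff1 = UNIV"
  by (simp add: hausdorff1_def space_measure_of_conv)

lemma sets_hausdorff1:
  "sets (hausdorff1 :: 'a::metric_space measure) = lambda_system UNIV (Pow UNIV) hausdorff1_outer"
proof -
  have "sigma_algebra UNIV
      (lambda_system UNIV (Pow UNIV) (hausdorff1_outer :: 'a set \<Rightarrow> ennreal))"
    using measure_space_hausdorff1 unfolding measure_space_def by blast
  then show ?thesis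
    unfolding hausdorff1_def by (rule sigma_algebra.sets_measure_of_eq)
qed

lemma emeasure_hausdorff1:
  fixes A :: "'a::metric_space set"
  assumes "A \<in> sets hausdorff1"
  shows "emeasure hausdorff1 A = hausdorff1_outer A"
  unfolding hausdorff1_def
  using measure_space_hausdorff1[where 'a='a] assms unfolding sets_hausdorff1 measure_space_def
  by (intro emeasure_measure_of_sigma) blast+

subsection \<open>Nonlocal mean curvature and the energy\<close>

definition truncated_nmc :: "real \<Rightarrow> (real^2) set \<Rightarrow> real^2 \<Rightarrow> real \<Rightarrow> real" where
  "truncated_nmc s E x \<epsilon> =
     (LINT y:UNIV - ball x \<epsilon>|lebesgue.
        (indicator (- E) y - indicator E y) / norm (x - y) powr (2 + s))"

definition has_nmc :: "real \<Rightarrow> (real^2) set \<Rightarrow> real^2 \<Rightarrow> bool" where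
  "has_nmc s E x \<longleftrightarrow> (\<exists>L. (truncated_nmc s E x \<longlongrightarrow> L) (at_right 0))"

definition nmc :: "real \<Rightarrow> (real^2) set \<Rightarrow> real^2 \<Rightarrow> real" where
  "nmc s E x = Lim (at_right 0) (truncated_nmc s E x)"

definition nonlocal_energy :: "real \<Rightarrow> real \<Rightarrow> (real^2) set \<Rightarrow> ennreal" where
  "nonlocal_energy s p E =
     (if E \<in> sets lebesgue \<and> (AE x in hausdorff1. x \<in> frontier E \<longrightarrow> has_nmc s E x)
      then \<integral>\<^sup>+x\<in>frontier E. ennreal (\<bar>nmc s E x\<bar> powr p) \<partial>hausdorff1
      else \<infinity>)"

subsection \<open>The admissible class\<close>

text \<open>
  Near each boundary point, in suitable orthonormal coordinates, the boundary is the graph of a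
  \<open>C\<^sup>1\<close> function and the interior is the part above it. The interior is used because
  \<open>E\<close> need be neither open nor closed.
\<close>

definition C1_boundary :: "(real^2) set \<Rightarrow> bool" where
  "C1_boundary E \<longleftrightarrow>
     (\<forall>x\<in>frontier E. \<exists>r>0. \<exists>u v. \<exists>\<gamma> :: real \<Rightarrow> real.
        norm u = 1 \<and> norm v = 1 \<and> u \<bullet> v = 0 \<and> \<gamma> C1_differentiable_on UNIV \<and>
        frontier E \<inter> ball x r = {y \<in> ball x r. y \<bullet> v = \<gamma> (y \<bullet> u)} \<and>
        interior E \<inter> ball x r = {y \<in> ball x r. y \<bullet> v > \<gamma> (y \<bullet> u)})"

definition C1_convex_bodies :: "(real^2) set set" where
  "C1_convex_bodies = {E. convex E \<and> bounded E \<and> interior E \<noteq> {} \<and> C1_boundary E}"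

end

theory Submission
  imports Defs "HOL-Complex_Analysis.Great_Picard"
begin

text \<open>
  The direct method. If \<open>K\<close> is convex and \<open>x\<close> is a boundary point, then \<open>x + z\<close> and \<open>x - z\<close>
  lie both in \<open>K\<close> only for \<open>z\<close> in a line, so after symmetrization the principal value at \<open>x\<close> is the
  integral of \<open>norm z powr - (2 + s)\<close> over those \<open>z\<close> for which both points lie outside \<open>K\<close>. It is
  nonnegative, and Fatou's lemma makes it lower semicontinuous in \<open>(K, x)\<close>.

  The exponent \<open>1 / s\<close> makes the energy invariant under similarities, so a minimizing sequence may be
  taken with diameter 1, and Blaschke selection yields a compact convex limit \<open>E\<close>. A body of
  diameter 1 in a strip of width \<open>2 * \<delta>\<close> has energy at least a constant times \<open>1 / \<delta>\<close>, so \<open>E\<close> has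
  interior points. Boundary measures are compared without any parametrization: dilating the
  approximating bodies slightly about an interior point of \<open>E\<close> and projecting to the nearest point
  of \<open>E\<close> maps their boundaries onto \<open>frontier E\<close> with Lipschitz constant close to 1; hence the energy
  is lower semicontinuous.

  Finally \<open>E\<close> is \<open>C\<^sup>1\<close>: at distance \<open>r\<close> from a corner the curvature is at least a constant times
  \<open>r powr - s\<close>, and its power \<open>1 / s\<close> is not integrable along the boundary.
\<close>

subsection \<open>Borel sets and Lipschitz maps for the one-dimensional Hausdorff measure\<close>

text \<open>Two obstacles shape the proof. \<open>C1_convex_bodies\<close> is not closed under
  limits of convex bodies, so regularity of the limit has to be extracted from finiteness of energy.
  And the approximating energies are integrals over different curves, so Fatou's lemma handles the
  curvature but not the energy. Both are met by a Borel majorant \<open>G\<close> of the integrand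
  on \<open>frontier E\<close>, whose integral is at most the infimum. Its finiteness gives the
  principal value almost everywhere, without which the energy of \<open>E\<close> would be infinite
  by definition, and it also excludes corners. The exponent is critical: curvature scales like
  length to the power -s, so its power 1/s scales like 1/length. This cancels the scaling of arc
  length, and it is also the borderline at which an integral along a curve diverges at a corner. Arc
  length enters only through inequalities under Lipschitz maps: onto the frontier for
  semicontinuity, and onto intervals of the real line for the lower bounds of strips and corners. No
  body of finite energy has to be exhibited: if there is none, every member of the class is a
  minimizer.\<close>

lemma hausdorff1_outer_mono: "A \<subseteq> B \<Longrightarrow> hausdorff1_outer A \<le> hausdorff1_outer B"
  unfolding hausdorff1_outer_def by (intro SUP_mono' hausdorff1_pre_mono)

lemma hausdorff1_outer_empty [simp]: "hausdorff1_outer {} = 0"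
  by (auto simp: hausdorff1_outer_def hausdorff1_pre_empty intro!: SUP_eq_const)

lemma hausdorff1_outer_UN: "hausdorff1_outer (\<Union>i. A i) \<le> (\<Sum>i. hausdorff1_outer (A i))"
  for A :: "nat \<Rightarrow> _"
  unfolding hausdorff1_outer_def[of "\<Union>i. A i"]
proof (rule SUP_least)
  fix \<delta> :: real
  assume "\<delta> \<in> {0<..}"
  then have "hausdorff1_pre \<delta> (A i) \<le> hausdorff1_outer (A i)" for i
    unfolding hausdorff1_outer_def by (rule SUP_upper)
  then show "hausdorff1_pre \<delta> (\<Union>i. A i) \<le> (\<Sum>i. hausdorff1_outer (A i))"
    by (intro order_trans[OF hausdorff1_pre_countable_Union suminf_le]) auto
qed

lemma hausdorff1_outer_Un: "hausdorff1_outer (A \<union> B) \<le> hausdorff1_outer A + hausdorff1_outer B"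
proof -
  have "A \<union> B = (\<Union>i. binaryset A B i)"
    by (simp add: UN_binaryset_eq)
  then have "hausdorff1_outer (A \<union> B) \<le> (\<Sum>i. hausdorff1_outer (binaryset A B i))"
    using hausdorff1_outer_UN by metis
  also have "\<dots> = hausdorff1_outer A + hausdorff1_outer B"
    by (rule suminf_binaryset_eq) simp
  finally show ?thesis .
qed

section \<open>Caratheodory's criterion: Borel sets are measurable\<close>

lemma hausdorff1_pre_antimono: "\<delta> \<le> \<delta>' \<Longrightarrow> hausdorff1_pre \<delta>' A \<le> hausdorff1_pre \<delta> A"
  unfolding hausdorff1_pre_def by (rule INF_superset_mono) (auto intro: order_trans)

text \<open>The scales d / (n + 2) tend to 0, and even the first is strictly below d, as the
  separation estimate requires.\<close>

lemma hausdorff1_outer_eq_SUP: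
  assumes "0 < d"
  shows "hausdorff1_outer A = (SUP n::nat. hausdorff1_pre (d / (real n + 2)) A)"
proof (rule antisym)
  show "hausdorff1_outer A \<le> (SUP n::nat. hausdorff1_pre (d / (real n + 2)) A)"
    unfolding hausdorff1_outer_def
  proof (rule SUP_mono)
    fix \<delta> :: real
    assume "\<delta> \<in> {0<..}"
    then have "0 < \<delta>" by simp
    obtain n where "d / \<delta> < real n"
      using reals_Archimedean2 by blast
    then have "d / (real n + 2) \<le> \<delta>"
      using \<open>0 < \<delta>\<close> assms by (simp add: field_simps)
    then show "\<exists>m\<in>UNIV. hausdorff1_pre \<delta> A \<le> hausdorff1_pre (d / (real m + 2)) A"
      by (auto intro: hausdorff1_pre_antimono)
  qed
next
  show "(SUP n::nat. hausdorff1_pre (d / (real n + 2)) A) \<le> hausdorff1_outer A"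
    unfolding hausdorff1_outer_def
    by (rule SUP_mono) (use assms in \<open>auto intro!: bexI[of _ "d / (real _ + 2)"]\<close>)
qed

text \<open>A set of diameter at most \<delta> < d cannot meet both A and B, so a cover of the union
  splits into a cover of A and a cover of B.\<close>

lemma hausdorff1_pre_separated:
  fixes A B :: "'a::metric_space set"
  assumes "\<delta> < d" and sep: "\<And>x y. x \<in> A \<Longrightarrow> y \<in> B \<Longrightarrow> d \<le> dist x y"
  shows "hausdorff1_pre \<delta> A + hausdorff1_pre \<delta> B \<le> hausdorff1_pre \<delta> (A \<union> B)"
  unfolding hausdorff1_pre_def[of \<delta> "A \<union> B"]
proof (rule INF_greatest)
  fix U :: "nat \<Rightarrow> 'a set"
  assume "U \<in> {U. A \<union> B \<subseteq> (\<Union>i. U i) \<and> (\<forall>i. bounded (U i) \<and> diameter (U i) \<le> \<delta>)}"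
  then have U: "A \<union> B \<subseteq> (\<Union>i. U i)" "\<And>i. bounded (U i)" "\<And>i. diameter (U i) \<le> \<delta>"
    by auto
  have "0 \<le> diameter (U 0)"
    using U(2) by (rule diameter_ge_0)
  then have "0 \<le> \<delta>"
    using U(3)[of 0] by linarith
  \<comment> \<open>Members of the cover that miss C are emptied rather than dropped, so the index
    set stays the same.\<close>
  define V where "V C i = (if U i \<inter> C = {} then {} else U i)" for C i
  have pre: "hausdorff1_pre \<delta> C \<le> (\<Sum>i. ennreal (diameter (V C i)))" if "C \<subseteq> A \<union> B" for C
    unfolding hausdorff1_pre_def
  proof (rule INF_lower, safe)
    fix x assume "x \<in> C"
    then obtain i where "x \<in> U i" using subsetD[OF U(1), of x] \<open>C \<subseteq> A \<union> B\<close> by auto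
    with \<open>x \<in> C\<close> have "x \<in> V C i" by (auto simp: V_def)
    then show "x \<in> (\<Union>i. V C i)" by blast
  qed (use U \<open>0 \<le> \<delta>\<close> in \<open>auto simp: V_def\<close>)
  have "ennreal (diameter (V A i)) + ennreal (diameter (V B i)) \<le> ennreal (diameter (U i))" for i
  proof (cases "U i \<inter> A = {} \<or> U i \<inter> B = {}")
    case True
    then show ?thesis by (auto simp: V_def)
  next
    case False
    then obtain x y where xy: "x \<in> U i" "x \<in> A" "y \<in> U i" "y \<in> B" by blast
    then have "dist x y \<le> diameter (U i)"
      using U(2) by (intro diameter_bounded_bound) auto
    then show ?thesis
      using sep[OF xy(2,4)] U(3)[of i] \<open>\<delta> < d\<close> by linarith
  qed
  then have "(\<Sum>i. ennreal (diameter (V A i))) + (\<Sum>i. ennreal (diameter (V B i)))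
      \<le> (\<Sum>i. ennreal (diameter (U i)))"
    by (subst suminf_add) (auto intro!: suminf_le)
  then show "hausdorff1_pre \<delta> A + hausdorff1_pre \<delta> B \<le> (\<Sum>i. ennreal (diameter (U i)))"
    using add_mono[OF pre[of A] pre[of B]] by (auto intro: order_trans)
qed

lemma hausdorff1_outer_separated:
  assumes "0 < d" and sep: "\<And>x y. x \<in> A \<Longrightarrow> y \<in> B \<Longrightarrow> d \<le> dist x y"
  shows "hausdorff1_outer A + hausdorff1_outer B \<le> hausdorff1_outer (A \<union> B)"
proof -
  have inc: "incseq (\<lambda>n. hausdorff1_pre (d / (real n + 2)) C)" for C :: "'a set"
    using \<open>0 < d\<close> by (intro incseq_SucI hausdorff1_pre_antimono) (simp add: field_simps)
  have "hausdorff1_outer A + hausdorff1_outer B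
      = (SUP n. hausdorff1_pre (d / (real n + 2)) A + hausdorff1_pre (d / (real n + 2)) B)"
    using inc by (simp add: hausdorff1_outer_eq_SUP[OF \<open>0 < d\<close>] ennreal_SUP_add)
  also have "\<dots> \<le> (SUP n. hausdorff1_pre (d / (real n + 2)) (A \<union> B))"
  proof (intro SUP_mono' hausdorff1_pre_separated[OF _ sep])
    fix n :: nat
    have "d / (real n + 2) < d / 1"
      using \<open>0 < d\<close> by (intro divide_strict_left_mono) auto
    then show "d / (real n + 2) < d" by simp
  qed
  also have "\<dots> = hausdorff1_outer (A \<union> B)"
    using \<open>0 < d\<close> by (simp add: hausdorff1_outer_eq_SUP)
  finally show ?thesis .
qed

lemma hausdorff1_outer_sum_layers:
  fixes R :: "nat \<Rightarrow> 'a::metric_space set"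
  assumes sep: "\<And>m n. m < n \<Longrightarrow> \<exists>d>0. \<forall>x\<in>R m. \<forall>y\<in>R n. d \<le> dist x y"
  shows "(\<Sum>k<N. hausdorff1_outer (R k)) \<le> hausdorff1_outer (\<Union>k<N. R k)"
proof (induction N)
  case 0
  then show ?case by simp
next
  case (Suc N)
  have "\<forall>m\<in>{..<N}. \<exists>d>0. \<forall>x\<in>R m. \<forall>y\<in>R N. d \<le> dist x y"
    using sep by auto
  then obtain d where d: "\<And>m. m < N \<Longrightarrow> 0 < d m"
      "\<And>m x y. m < N \<Longrightarrow> x \<in> R m \<Longrightarrow> y \<in> R N \<Longrightarrow> d m \<le> dist x y"
    by (metis lessThan_iff)
  \<comment> \<open>\<open>insert 1\<close> keeps the set nonempty when N = 0.\<close>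
  define e where "e = Min (insert 1 (d ` {..<N}))"
  have "0 < e" unfolding e_def by (subst Min_gr_iff) (use d in auto)
  have "e \<le> d m" if "m < N" for m unfolding e_def using that by (intro Min_le) auto
  then have "hausdorff1_outer (\<Union>k<N. R k) + hausdorff1_outer (R N)
      \<le> hausdorff1_outer ((\<Union>k<N. R k) \<union> R N)"
    by (intro hausdorff1_outer_separated[OF \<open>0 < e\<close>]) (use d in \<open>force intro: order_trans\<close>)
  also have "(\<Union>k<N. R k) \<union> R N = (\<Union>k<Suc N. R k)"
    by (auto simp: less_Suc_eq)
  finally show ?case
    using Suc by (auto intro: order_trans add_mono)
qed

lemma hausdorff1_outer_suminf_layers:
  fixes R :: "nat \<Rightarrow> 'a::metric_space set"
  assumes sep: "\<And>m n. m < n \<Longrightarrow> \<exists>d>0. \<forall>x\<in>R m. \<forall>y\<in>R n. d \<le> dist x y"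
    and sub: "\<And>k. R k \<subseteq> X"
  shows "(\<Sum>k. hausdorff1_outer (R k)) \<le> hausdorff1_outer X"
proof (rule suminf_le_const[OF summableI])
  fix N
  have "(\<Sum>k<N. hausdorff1_outer (R k)) \<le> hausdorff1_outer (\<Union>k<N. R k)"
    by (rule hausdorff1_outer_sum_layers[OF sep])
  also have "\<dots> \<le> hausdorff1_outer X"
    by (rule hausdorff1_outer_mono) (use sub in auto)
  finally show "(\<Sum>k<N. hausdorff1_outer (R k)) \<le> hausdorff1_outer X" .
qed

lemma suminf_even_odd_ennreal:
  fixes a :: "nat \<Rightarrow> ennreal"
  shows "(\<Sum>k. a k) \<le> (\<Sum>k. a (2 * k)) + (\<Sum>k. a (2 * k + 1))"
proof (rule suminf_le_const[OF summableI])
  fix N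
  have "(\<Sum>k<N. a k) \<le> (\<Sum>k<2 * N. a k)"
    by (rule sum_mono2) auto
  also have "\<dots> = (\<Sum>k<N. a (2 * k)) + (\<Sum>k<N. a (2 * k + 1))"
    by (induction N) (auto simp: algebra_simps)
  also have "\<dots> \<le> (\<Sum>k. a (2 * k)) + (\<Sum>k. a (2 * k + 1))"
    by (intro add_mono sum_le_suminf) auto
  finally show "(\<Sum>k<N. a k) \<le> (\<Sum>k. a (2 * k)) + (\<Sum>k. a (2 * k + 1))" .
qed

lemma suminf_ennreal_tail:
  fixes a :: "nat \<Rightarrow> ennreal"
  assumes "(\<Sum>k. a k) < top" and "0 < e"
  shows "\<exists>n. (\<Sum>k. a (k + n)) \<le> ennreal e"
proof -
  have fin: "a k < top" for k
    using sum_le_suminf[of a "{k}"] assms(1) by (auto intro: le_less_trans)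
  define r where "r k = enn2real (a k)" for k
  have a: "a = (\<lambda>k. ennreal (r k))"
    using fin by (auto simp: r_def fun_eq_iff)
  have r0: "0 \<le> r k" for k by (simp add: r_def)
  have sm: "summable r"
    by (rule summable_suminf_not_top[OF r0]) (use assms(1) a in auto)
  obtain n where "norm (\<Sum>i. r (i + n)) < e"
    using suminf_exist_split[OF assms(2) sm] by auto
  moreover have "(\<Sum>k. a (k + n)) = ennreal (\<Sum>i. r (i + n))"
    unfolding a by (rule suminf_ennreal2) (use r0 sm in auto)
  ultimately show ?thesis by (auto intro!: exI[of _ n] ennreal_leI)
qed

text \<open>The sets \<open>Y n\<close> lie at positive distance from F and exhaust X - F; what they
  leave out consists of the layers \<open>R k\<close> with k \<ge> n. Adjacent layers may touch, but
  layers whose indices differ by at least 2 are separated because \<open>infdist\<close> is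
  1-Lipschitz. So the even and the odd layers each have total measure at most that of X, and the
  tail of the series tends to 0.\<close>

lemma closed_in_lambda_system_hausdorff1:
  fixes F :: "'a::metric_space set"
  assumes "closed F"
  shows "F \<in> lambda_system UNIV (Pow UNIV) hausdorff1_outer"
proof (cases "F = {}")
  case True
  then show ?thesis by (simp add: lambda_system_def)
next
  case False
  have "hausdorff1_outer (F \<inter> X) + hausdorff1_outer (X - F) \<le> hausdorff1_outer X" for X
  proof (cases "hausdorff1_outer X = top")
    case True
    then show ?thesis by simp
  next
    case fin: False
    define Y where "Y n = {x \<in> X. 1 / (real n + 1) \<le> infdist x F}" for n :: nat
    define R where "R k = {x \<in> X. 1 / (real k + 2) \<le> infdist x F \<and> infdist x F < 1 / (real k + 1)}"
      for k :: nat
    have lip: "infdist x F \<le> infdist y F + dist x y" for x y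
      by (rule infdist_triangle)
    have sep: "\<exists>d>0. \<forall>x\<in>R m. \<forall>y\<in>R n. d \<le> dist x y" if "m + 1 < n" for m n
    proof (intro exI conjI ballI)
      have "real m + 2 \<le> real n" using that by linarith
      then have "1 / (real n + 1) < 1 / (real m + 2)"
        by (intro divide_strict_left_mono) auto
      then show "0 < 1 / (real m + 2) - 1 / (real n + 1)" by simp
      fix x y assume "x \<in> R m" "y \<in> R n"
      then show "1 / (real m + 2) - 1 / (real n + 1) \<le> dist x y"
        using lip[of x y] by (auto simp: R_def)
    qed
    have "(\<Sum>k. hausdorff1_outer (R k))
        \<le> (\<Sum>k. hausdorff1_outer (R (2 * k))) + (\<Sum>k. hausdorff1_outer (R (2 * k + 1)))"
      by (rule suminf_even_odd_ennreal)
    also have "\<dots> \<le> hausdorff1_outer X + hausdorff1_outer X"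
      by (intro add_mono hausdorff1_outer_suminf_layers sep) (auto simp: R_def)
    also have "\<dots> < top" using fin by (simp add: top.not_eq_extremum)
    finally have sum_fin: "(\<Sum>k. hausdorff1_outer (R k)) < top" .
    show ?thesis
    proof (rule ennreal_le_epsilon)
      fix e :: real
      assume "0 < e"
      then obtain n where n: "(\<Sum>k. hausdorff1_outer (R (k + n))) \<le> ennreal e"
        using suminf_ennreal_tail[OF sum_fin] by blast
      have "x \<in> Y n \<union> (\<Union>k. R (k + n))" if "x \<in> X - F" for x
      proof (cases "x \<in> Y n")
        case nY: False
        have pos: "0 < infdist x F"
          using that assms \<open>F \<noteq> {}\<close>
          by (metis DiffD2 in_closed_iff_infdist_zero infdist_nonneg order_le_less)
        \<comment> \<open>\<open>x \<in> R k\<close> means k + 1 < 1 / \<open>infdist x F\<close>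
          \<le> k + 2, so k + 2 is the ceiling of the reciprocal.\<close>
        define k where "k = nat \<lceil>1 / infdist x F\<rceil> - 2"
        have lt: "infdist x F < 1 / (real n + 1)"
          using nY that by (auto simp: Y_def)
        have big: "real n + 1 < 1 / infdist x F"
          using lt pos by (simp add: field_simps)
        then have "real n + 1 < real (nat \<lceil>1 / infdist x F\<rceil>)"
          by linarith
        then have k: "nat \<lceil>1 / infdist x F\<rceil> = k + 2" "n \<le> k"
          by (auto simp: k_def)
        have "1 / infdist x F \<le> real k + 2" "real k + 1 < 1 / infdist x F"
          using k(1) big by linarith+
        then have "x \<in> R k"
          using pos that by (auto simp: R_def field_simps)
        moreover obtain j where "k = j + n"
          using k(2) by (metis add.commute le_Suc_ex)
        ultimately show ?thesis by blast
      qed auto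
      then have "hausdorff1_outer (X - F) \<le> hausdorff1_outer (Y n \<union> (\<Union>k. R (k + n)))"
        by (intro hausdorff1_outer_mono) blast
      also have "\<dots> \<le> hausdorff1_outer (Y n) + ennreal e"
        using hausdorff1_outer_Un hausdorff1_outer_UN[of "\<lambda>k. R (k + n)"] n
        by (meson add_left_mono order_trans)
      finally have "hausdorff1_outer (F \<inter> X) + hausdorff1_outer (X - F)
          \<le> hausdorff1_outer (F \<inter> X) + hausdorff1_outer (Y n) + ennreal e"
        by (simp add: add.assoc add_left_mono)
      also have "\<dots> \<le> hausdorff1_outer (F \<inter> X \<union> Y n) + ennreal e"
      proof (intro add_right_mono hausdorff1_outer_separated)
        show "0 < 1 / (real n + 1)" by simp
        fix x y assume "x \<in> F \<inter> X" "y \<in> Y n"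
        then show "1 / (real n + 1) \<le> dist x y"
          using infdist_le[of x F y] by (auto simp: Y_def dist_commute)
      qed
      also have "\<dots> \<le> hausdorff1_outer X + ennreal e"
        by (intro add_right_mono hausdorff1_outer_mono) (auto simp: Y_def)
      finally show "hausdorff1_outer (F \<inter> X) + hausdorff1_outer (X - F)
          \<le> hausdorff1_outer X + ennreal e" .
    qed
  qed
  moreover have "hausdorff1_outer X \<le> hausdorff1_outer (F \<inter> X) + hausdorff1_outer (X - F)" for X
    by (rule order_trans[OF hausdorff1_outer_mono hausdorff1_outer_Un]) blast
  moreover have "(UNIV - F) \<inter> X = X - F" for X by auto
  ultimately show ?thesis
    by (auto simp: lambda_system_def intro: antisym)
qed

lemma borel_sets_hausdorff1: "A \<in> sets borel \<Longrightarrow> A \<in> sets hausdorff1"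
proof -
  have "sigma_sets UNIV (Collect closed) \<subseteq> sets (hausdorff1 :: 'a measure)"
  proof (rule sets.sigma_sets_subset[of "Collect closed" hausdorff1, simplified])
    show "Collect closed \<subseteq> sets (hausdorff1 :: 'a measure)"
      using closed_in_lambda_system_hausdorff1 by (auto simp: sets_hausdorff1)
  qed
  then show "A \<in> sets borel \<Longrightarrow> A \<in> sets hausdorff1" for A :: "'a set"
    by (auto simp: borel_eq_closed sets_measure_of_conv)
qed

lemma borel_measurable_hausdorff1:
  "f \<in> borel_measurable borel \<Longrightarrow> f \<in> measurable hausdorff1 borel"
  by (auto simp: measurable_def borel_sets_hausdorff1)

section \<open>Lipschitz maps: measures of images and comparison of integrals\<close>

lemma hausdorff1_outer_lipschitz_image:
  fixes f :: "'a::metric_space \<Rightarrow> 'b::metric_space"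
  assumes "0 < L" and lip: "\<And>x y. x \<in> A \<Longrightarrow> y \<in> A \<Longrightarrow> dist (f x) (f y) \<le> L * dist x y"
  shows "hausdorff1_outer (f ` A) \<le> ennreal L * hausdorff1_outer A"
  unfolding hausdorff1_outer_def[of "f ` A"]
proof (rule SUP_least)
  fix \<delta> :: real
  assume "\<delta> \<in> {0<..}"
  then have "0 < \<delta>" by simp
  have "hausdorff1_pre \<delta> (f ` A) \<le> ennreal L * hausdorff1_pre (\<delta> / L) A"
  proof -
    \<comment> \<open>With L moved to the left, a bare infimum remains on the right and each cover
      can be treated by itself.\<close>
    have "ennreal (1 / L) * hausdorff1_pre \<delta> (f ` A) \<le> hausdorff1_pre (\<delta> / L) A"
      unfolding hausdorff1_pre_def[of "\<delta> / L"]
    proof (rule INF_greatest)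
    fix U :: "nat \<Rightarrow> 'a set"
    assume "U \<in> {U. A \<subseteq> (\<Union>i. U i) \<and> (\<forall>i. bounded (U i) \<and> diameter (U i) \<le> \<delta> / L)}"
    then have U: "A \<subseteq> (\<Union>i. U i)" "\<And>i. bounded (U i)" "\<And>i. diameter (U i) \<le> \<delta> / L"
      by auto
    define V where "V i = f ` (U i \<inter> A)" for i
    have dV: "dist y z \<le> L * diameter (U i)" if "y \<in> V i" "z \<in> V i" for i y z
    proof -
      obtain y' z' where yz: "y = f y'" "z = f z'" "y' \<in> U i \<inter> A" "z' \<in> U i \<inter> A"
        using \<open>y \<in> V i\<close> \<open>z \<in> V i\<close> unfolding V_def by blast
      then have "dist y z \<le> L * dist y' z'" using lip by auto
      also have "\<dots> \<le> L * diameter (U i)"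
        using yz \<open>0 < L\<close> U(2) by (intro mult_left_mono diameter_bounded_bound) auto
      finally show ?thesis .
    qed
    have "bounded (V i)" for i
      using dV unfolding bounded_two_points by blast
    moreover have diam: "diameter (V i) \<le> L * diameter (U i)" for i
      using dV \<open>0 < L\<close> diameter_ge_0[OF U(2), of i]
      by (auto simp: diameter_def[of "V i"] intro!: cSUP_least)
    moreover have "L * diameter (U i) \<le> \<delta>" for i
      using U(3)[of i] \<open>0 < L\<close> by (simp add: field_simps)
    moreover have "f ` A \<subseteq> (\<Union>i. V i)"
      using U(1) by (fastforce simp: V_def)
    ultimately have "hausdorff1_pre \<delta> (f ` A) \<le> (\<Sum>i. ennreal (diameter (V i)))"
      unfolding hausdorff1_pre_def by (intro INF_lower) (auto intro: order_trans)
    also have "\<dots> \<le> (\<Sum>i. ennreal L * ennreal (diameter (U i)))"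
      using \<open>0 < L\<close> diam by (intro suminf_le) (auto simp: ennreal_mult'[symmetric] ennreal_leI)
    also have "\<dots> = ennreal L * (\<Sum>i. ennreal (diameter (U i)))"
      by simp
    finally have "ennreal (1 / L) * hausdorff1_pre \<delta> (f ` A)
        \<le> ennreal (1 / L) * (ennreal L * (\<Sum>i. ennreal (diameter (U i))))"
      by (rule mult_left_mono) simp
    then show "ennreal (1 / L) * hausdorff1_pre \<delta> (f ` A) \<le> (\<Sum>i. ennreal (diameter (U i)))"
      using \<open>0 < L\<close> by (simp add: mult.assoc[symmetric] ennreal_mult'[symmetric])
    qed
    then have "ennreal L * (ennreal (1 / L) * hausdorff1_pre \<delta> (f ` A))
        \<le> ennreal L * hausdorff1_pre (\<delta> / L) A"
      by (rule mult_left_mono) simp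
    then show ?thesis
      using \<open>0 < L\<close> by (simp add: mult.assoc[symmetric] ennreal_mult'[symmetric])
  qed
  also have "\<dots> \<le> ennreal L * hausdorff1_outer A"
    unfolding hausdorff1_outer_def
    using \<open>0 < \<delta>\<close> \<open>0 < L\<close> by (intro mult_left_mono SUP_upper) auto
  finally show "hausdorff1_pre \<delta> (f ` A) \<le> ennreal L * hausdorff1_outer A" .
qed

text \<open>A bounded set of reals lies in an interval no longer than its diameter. Covers at the
  single scale 1 suffice, since the outer measure is the supremum over all scales.\<close>

lemma emeasure_lborel_le_hausdorff1_outer:
  fixes A :: "real set"
  assumes "A \<in> sets borel"
  shows "emeasure lborel A \<le> hausdorff1_outer A"
proof -
  have "emeasure lborel A \<le> hausdorff1_pre 1 A"
    unfolding hausdorff1_pre_def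
  proof (rule INF_greatest, safe)
    fix U :: "nat \<Rightarrow> real set"
    assume U: "A \<subseteq> (\<Union>i. U i)" and bd: "\<forall>i. bounded (U i) \<and> diameter (U i) \<le> 1"
    have sub: "\<exists>a b. U i \<subseteq> {a..b} \<and> a \<le> b \<and> b - a \<le> diameter (U i)" for i
    proof (cases "U i = {}")
      case True
      then show ?thesis by (auto intro!: exI[of _ 0])
    next
      case False
      have b: "bounded (U i)" using bd by auto
      then have ba: "bdd_above (U i)" "bdd_below (U i)"
        by (auto intro: bounded_imp_bdd_above bounded_imp_bdd_below)
      have cl: "Sup (U i) \<in> closure (U i)" "Inf (U i) \<in> closure (U i)"
        using False ba by (auto intro: closure_contains_Sup closure_contains_Inf)
      have "dist (Sup (U i)) (Inf (U i)) \<le> diameter (closure (U i))"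
        using cl b by (intro diameter_bounded_bound) auto
      then have "Sup (U i) - Inf (U i) \<le> diameter (U i)"
        using b by (simp add: diameter_closure dist_real_def)
      moreover have "U i \<subseteq> {Inf (U i)..Sup (U i)}"
        using ba by (auto intro: cInf_lower cSup_upper)
      moreover have "Inf (U i) \<le> Sup (U i)"
        using False ba by (auto intro: cInf_le_cSup)
      ultimately show ?thesis by blast
    qed
    then obtain a b where ab: "\<And>i. U i \<subseteq> {a i..b i}" "\<And>i. a i \<le> b i" "\<And>i. b i - a i \<le> diameter (U i)"
      by metis
    have "emeasure lborel A \<le> emeasure lborel (\<Union>i. {a i..b i})"
    proof (rule emeasure_mono)
      show "A \<subseteq> (\<Union>i. {a i..b i})" using U ab(1) by blast
    qed simp
    also have "\<dots> \<le> (\<Sum>i. emeasure lborel {a i..b i})"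
      by (rule emeasure_subadditive_countably) auto
    also have "\<dots> \<le> (\<Sum>i. ennreal (diameter (U i)))"
      using ab by (intro suminf_le) (auto simp: ennreal_leI)
    finally show "emeasure lborel A \<le> (\<Sum>i. ennreal (diameter (U i)))" .
  qed
  also have "\<dots> \<le> hausdorff1_outer A"
    unfolding hausdorff1_outer_def by (rule SUP_upper) simp
  finally show ?thesis .
qed

text \<open>
  The measure \<open>\<nu>\<close> stands for either the Hausdorff measure or, on the real line, Lebesgue measure.
\<close>

lemma nn_integral_lipschitz_transfer_gen:
  fixes f :: "'a::metric_space \<Rightarrow> 'b::metric_space" and \<nu> :: "'b measure"
  assumes "0 < L" and f: "continuous_on UNIV f"
    and lip: "\<And>x y. x \<in> A \<Longrightarrow> y \<in> A \<Longrightarrow> dist (f x) (f y) \<le> L * dist x y"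
    and A: "A \<in> sets borel" and B: "B \<in> sets borel" and onto: "B \<subseteq> f ` A"
    and \<nu>: "sets borel \<subseteq> sets \<nu>" "space \<nu> = UNIV"
      "\<And>S. S \<in> sets borel \<Longrightarrow> emeasure \<nu> S \<le> hausdorff1_outer S"
    and \<phi>: "\<phi> \<in> borel_measurable borel"
  shows "(\<integral>\<^sup>+y\<in>B. \<phi> y \<partial>\<nu>) \<le> ennreal L * (\<integral>\<^sup>+x\<in>A. \<phi> (f x) \<partial>hausdorff1)"
proof -
  have fm [measurable]: "f \<in> borel_measurable borel"
    using f by (rule borel_measurable_continuous_onI)
  note [measurable] = A B \<phi>
  note borel_sets_hausdorff1 [simp]
  have \<nu>m: "g \<in> borel_measurable \<nu>" if "g \<in> borel_measurable borel" for g :: "'b \<Rightarrow> ennreal"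
    using that \<nu>(1,2) by (auto simp: measurable_def)
  have idd: "(indicator B :: 'b \<Rightarrow> ennreal) \<in> borel_measurable \<nu>" "\<phi> \<in> borel_measurable \<nu>"
    using \<nu>m[OF borel_measurable_indicator[OF B]] \<nu>m[OF \<phi>] by auto
  let ?N = "distr (density \<nu> (indicator B)) borel (\<lambda>x. x)"
  let ?M = "scale_measure (ennreal L) (distr (density hausdorff1 (indicator A)) borel f)"
  have fh: "f \<in> measurable (density hausdorff1 (indicator A)) borel"
    using borel_measurable_hausdorff1[OF fm] by simp
  have idN: "(\<lambda>x. x) \<in> measurable (density \<nu> (indicator B)) borel"
    using \<nu>(1,2) by (auto simp: measurable_def)
  have Ai: "(indicator A :: 'a \<Rightarrow> ennreal) \<in> borel_measurable hausdorff1"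
    "(\<lambda>x. \<phi> (f x)) \<in> borel_measurable hausdorff1"
    by (rule borel_measurable_hausdorff1, measurable)+
  \<comment> \<open>It is enough to compare measures: \<open>\<nu>\<close> restricted to B against L
    times the image under f of the Hausdorff measure on A. On a Borel set S this is the Lipschitz
    estimate for f applied to the part of A that f sends into S, because that part covers
    \<open>S \<inter> B\<close>.\<close>
  have "?N \<le> ?M"
  proof (subst le_measure, simp, intro allI ballI)
    fix S assume "S \<in> sets ?N"
    then have S [measurable]: "S \<in> sets borel" by simp
    have fS [measurable]: "f -` S \<in> sets borel"
      using measurable_sets[OF fm S] by simp
    have S\<nu>: "S \<in> sets \<nu>" "S \<inter> B \<in> sets \<nu>" using \<nu>(1) S B by auto
    have "emeasure ?N S = emeasure \<nu> (S \<inter> B)"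
    proof -
      have "emeasure ?N S = emeasure (density \<nu> (indicator B)) S"
        using \<nu>(2) emeasure_distr[OF idN S] by simp
      also have "\<dots> = (\<integral>\<^sup>+x. indicator (S \<inter> B) x \<partial>\<nu>)"
        by (subst emeasure_density[OF idd(1) S\<nu>(1)])
           (intro nn_integral_cong, simp split: split_indicator)
      also have "\<dots> = emeasure \<nu> (S \<inter> B)"
        by (rule nn_integral_indicator[OF S\<nu>(2)])
      finally show ?thesis .
    qed
    also have "\<dots> \<le> hausdorff1_outer (S \<inter> B)"
      by (rule \<nu>(3)) simp
    also have "\<dots> \<le> hausdorff1_outer (f ` (f -` S \<inter> A))"
      by (rule hausdorff1_outer_mono) (use onto in auto)
    also have "\<dots> \<le> ennreal L * hausdorff1_outer (f -` S \<inter> A)"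
      using \<open>0 < L\<close> lip by (intro hausdorff1_outer_lipschitz_image) auto
    also have "hausdorff1_outer (f -` S \<inter> A) = emeasure hausdorff1 (f -` S \<inter> A)"
      by (rule emeasure_hausdorff1[symmetric]) simp
    also have "\<dots> = (\<integral>\<^sup>+x. indicator (f -` S \<inter> A) x \<partial>hausdorff1)"
      by (rule nn_integral_indicator[symmetric]) simp
    also have "\<dots> = emeasure (density hausdorff1 (indicator A)) (f -` S)"
      by (subst emeasure_density[OF Ai(1)], simp)
         (intro nn_integral_cong, simp split: split_indicator)
    also have "ennreal L * \<dots> = emeasure ?M S"
      using emeasure_distr[OF fh S] by simp
    finally show "emeasure ?N S \<le> emeasure ?M S" .
  qed
  then have "(\<integral>\<^sup>+y. \<phi> y \<partial>?N) \<le> (\<integral>\<^sup>+y. \<phi> y \<partial>?M)"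
    by (intro nn_integral_mono_measure) auto
  moreover have "(\<integral>\<^sup>+y. \<phi> y \<partial>?N) = (\<integral>\<^sup>+y\<in>B. \<phi> y \<partial>\<nu>)"
    using idd
    by (subst nn_integral_distr[OF idN]) (auto simp: nn_integral_density comp_def mult.commute)
  moreover have "(\<integral>\<^sup>+y. \<phi> y \<partial>?M) = ennreal L * (\<integral>\<^sup>+x\<in>A. \<phi> (f x) \<partial>hausdorff1)"
    by (subst nn_integral_scale_measure, simp, subst nn_integral_distr[OF fh])
       (auto simp: Ai nn_integral_density mult.commute)
  ultimately show ?thesis by simp
qed

lemma nn_integral_lipschitz_transfer:
  fixes f :: "'a::metric_space \<Rightarrow> 'b::metric_space"
  assumes "0 < L" and "continuous_on UNIV f"
    and "\<And>x y. x \<in> A \<Longrightarrow> y \<in> A \<Longrightarrow> dist (f x) (f y) \<le> L * dist x y"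
    and "A \<in> sets borel" and "B \<in> sets borel" and "B \<subseteq> f ` A"
    and "\<phi> \<in> borel_measurable borel"
  shows "(\<integral>\<^sup>+y\<in>B. \<phi> y \<partial>hausdorff1) \<le> ennreal L * (\<integral>\<^sup>+x\<in>A. \<phi> (f x) \<partial>hausdorff1)"
  using assms
  by (intro nn_integral_lipschitz_transfer_gen)
     (auto simp: borel_sets_hausdorff1 emeasure_hausdorff1)

lemma nn_integral_lborel_lipschitz_transfer:
  fixes f :: "'a::metric_space \<Rightarrow> real"
  assumes "0 < L" and "continuous_on UNIV f"
    and "\<And>x y. x \<in> A \<Longrightarrow> y \<in> A \<Longrightarrow> dist (f x) (f y) \<le> L * dist x y"
    and "A \<in> sets borel" and "B \<in> sets borel" and "B \<subseteq> f ` A"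
    and "\<phi> \<in> borel_measurable borel"
  shows "(\<integral>\<^sup>+y\<in>B. \<phi> y \<partial>lborel) \<le> ennreal L * (\<integral>\<^sup>+x\<in>A. \<phi> (f x) \<partial>hausdorff1)"
  using assms
  by (intro nn_integral_lipschitz_transfer_gen) (auto intro: emeasure_lborel_le_hausdorff1_outer)

subsection \<open>The nonlocal mean curvature of a convex set\<close>

definition riesz_kernel :: "real \<Rightarrow> real^2 \<Rightarrow> real" where
  "riesz_kernel s z = 1 / norm z powr (2 + s)"

lemma riesz_kernel_measurable [measurable]: "riesz_kernel s \<in> borel_measurable borel"
  unfolding riesz_kernel_def[abs_def] by measurable

lemma riesz_kernel_nonneg [simp]: "0 \<le> riesz_kernel s z"
  by (simp add: riesz_kernel_def)

lemma riesz_kernel_zero [simp]: "riesz_kernel s 0 = 0"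
  by (simp add: riesz_kernel_def)

lemma riesz_kernel_minus [simp]: "riesz_kernel s (- z) = riesz_kernel s z"
  by (simp add: riesz_kernel_def)

lemma riesz_kernel_antimono:
  assumes "0 < r" "r \<le> norm z" "0 < s"
  shows "riesz_kernel s z \<le> 1 / r powr (2 + s)"
  unfolding riesz_kernel_def using assms
  by (intro divide_left_mono powr_mono2 mult_pos_pos) auto

text \<open>
  For convex \<open>K\<close> and \<open>x\<close> on its boundary this is the nonlocal mean curvature at \<open>x\<close>, with value
  \<open>\<infinity>\<close> when the principal value does not exist.
\<close>

definition sym_curv :: "real \<Rightarrow> (real^2) set \<Rightarrow> real^2 \<Rightarrow> ennreal" where
  "sym_curv s K x =
     (\<integral>\<^sup>+z. indicator (- K) (x + z) * indicator (- K) (x - z) * ennreal (riesz_kernel s z) \<partial>lborel)"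

definition sym_curv_trunc :: "real \<Rightarrow> (real^2) set \<Rightarrow> real^2 \<Rightarrow> real \<Rightarrow> ennreal" where
  "sym_curv_trunc s K x \<epsilon> =
     (\<integral>\<^sup>+z. indicator {z. \<epsilon> \<le> norm z} z *
        (indicator (- K) (x + z) * indicator (- K) (x - z) * ennreal (riesz_kernel s z)) \<partial>lborel)"

text \<open>Dyadic annuli: where \<open>r k\<close> \<le> |z| \<le> 2 \<open>r k\<close> the kernel
  is at most \<open>r k\<close> to the power -(2 + s), on a disc of area 4 pi times the square of
  \<open>r k\<close>. The products form a geometric series of ratio q = 2 to the power -s.\<close>

lemma riesz_kernel_tail_finite:
  assumes "0 < s" "0 < \<epsilon>"
  shows "(\<integral>\<^sup>+z. indicator {z. \<epsilon> \<le> norm z} z * ennreal (riesz_kernel s z) \<partial>lborel) < top"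
proof -
  define r where "r k = 2 ^ k * \<epsilon>" for k :: nat
  define q where "q = 2 powr (- s)"
  have r: "0 < r k" for k using assms by (simp add: r_def)
  have q: "0 < q" "q < 1" using assms by (auto simp: q_def powr_less_one)
  define c where "c = pi * 4 * \<epsilon> powr (- s)"
  have summand: "(1 / r k powr (2 + s)) * (pi * (r (Suc k))\<^sup>2) = c * q ^ k" for k
  proof -
    have "r k powr (2 + s) = (r k)\<^sup>2 * r k powr s"
      using r[of k] by (simp add: powr_add)
    moreover have "r k powr (- s) = q ^ k * \<epsilon> powr (- s)"
      using assms by (simp add: r_def q_def powr_mult powr_realpow[symmetric] powr_powr mult.commute)
    moreover have "(r (Suc k))\<^sup>2 = 4 * (r k)\<^sup>2"
      by (simp add: r_def power2_eq_square)
    ultimately show ?thesis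
      using r[of k] q by (simp add: c_def powr_minus field_simps)
  qed
  have "(\<integral>\<^sup>+z. indicator {z. \<epsilon> \<le> norm z} z * ennreal (riesz_kernel s z) \<partial>lborel)
      \<le> (\<integral>\<^sup>+z. (\<Sum>k. ennreal (1 / r k powr (2 + s)) * indicator (cball (0::real^2) (r (Suc k))) z) \<partial>lborel)"
  proof (rule nn_integral_mono)
    fix z :: "real^2"
    show "indicator {z. \<epsilon> \<le> norm z} z * ennreal (riesz_kernel s z)
        \<le> (\<Sum>k. ennreal (1 / r k powr (2 + s)) * indicator (cball 0 (r (Suc k))) z)"
    proof (cases "\<epsilon> \<le> norm z")
      case True
      define m where "m = (LEAST k. norm z \<le> r (Suc k))"
      obtain n where "norm z / \<epsilon> < 2 ^ n"
        using real_arch_pow[of 2] by auto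
      then have "norm z < r n"
        using assms by (simp add: r_def field_simps)
      moreover have "r n \<le> r (Suc n)"
        using assms by (simp add: r_def)
      ultimately have "norm z \<le> r (Suc n)"
        by simp
      then have m: "norm z \<le> r (Suc m)"
        unfolding m_def by (rule LeastI)
      have "r m \<le> norm z"
      proof (cases m)
        case 0
        then show ?thesis using True by (simp add: r_def)
      next
        case (Suc j)
        then have "\<not> norm z \<le> r (Suc j)"
          unfolding m_def by (intro not_less_Least) auto
        then show ?thesis using Suc by simp
      qed
      then have "ennreal (riesz_kernel s z) \<le> ennreal (1 / r m powr (2 + s))"
        using assms r by (intro ennreal_leI riesz_kernel_antimono) auto
      also have "\<dots> = (\<Sum>k\<in>{m}. ennreal (1 / r k powr (2 + s)) * indicator (cball 0 (r (Suc k))) z)"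
        using m by simp
      also have "\<dots> \<le> (\<Sum>k. ennreal (1 / r k powr (2 + s)) * indicator (cball 0 (r (Suc k))) z)"
        by (intro sum_le_suminf) auto
      finally show ?thesis using True by simp
    qed simp
  qed
  also have "\<dots> = (\<Sum>k. \<integral>\<^sup>+z. ennreal (1 / r k powr (2 + s)) * indicator (cball (0::real^2) (r (Suc k))) z \<partial>lborel)"
  proof (rule nn_integral_suminf)
    fix k
    have "(indicator (cball (0::real^2) (r (Suc k))) :: _ \<Rightarrow> ennreal) \<in> borel_measurable lborel"
      by (rule borel_measurable_indicator) simp
    then show "(\<lambda>z. ennreal (1 / r k powr (2 + s)) * indicator (cball (0::real^2) (r (Suc k))) z)
        \<in> borel_measurable lborel"
      by (rule borel_measurable_times_ennreal[OF borel_measurable_const])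
  qed
  also have "\<dots> = (\<Sum>k. ennreal (c * q ^ k))"
  proof (rule suminf_cong)
    fix k
    have "(\<integral>\<^sup>+z. ennreal (1 / r k powr (2 + s)) * indicator (cball (0::real^2) (r (Suc k))) z \<partial>lborel)
        = ennreal (1 / r k powr (2 + s)) * emeasure lborel (cball (0::real^2) (r (Suc k)))"
      by (rule nn_integral_cmult_indicator) simp
    also have "\<dots> = ennreal ((1 / r k powr (2 + s)) * (pi * (r (Suc k))\<^sup>2))"
      using r[of "Suc k"] by (subst emeasure_cball) (auto simp: unit_ball_vol_2 ennreal_mult'[symmetric])
    finally show "(\<integral>\<^sup>+z. ennreal (1 / r k powr (2 + s)) * indicator (cball (0::real^2) (r (Suc k))) z \<partial>lborel)
        = ennreal (c * q ^ k)"
      unfolding summand .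
  qed
  also have "\<dots> = ennreal (\<Sum>k. c * q ^ k)"
    using q by (intro suminf_ennreal2 summable_mult summable_geometric) (auto simp: c_def)
  also have "\<dots> < top" by simp
  finally show ?thesis .
qed

section \<open>Symmetrization of the principal value\<close>

lemma lborel_integral_translate_reflect:
  fixes f :: "real^2 \<Rightarrow> real"
  assumes "f \<in> borel_measurable borel"
  shows "(\<integral>z. f (x + z) \<partial>lborel) = (\<integral>y. f y \<partial>lborel)"
    and "(\<integral>z. f (x - z) \<partial>lborel) = (\<integral>y. f y \<partial>lborel)"
proof -
  have 1: "distr lborel borel (\<lambda>z. x + 1 *\<^sub>R z) = lborel"
    using lborel_affine[of 1 x] by (simp add: density_1)
  have 2: "distr lborel borel (\<lambda>z. x + (-1) *\<^sub>R z) = lborel"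
    using lborel_affine[of "-1" x] by (simp add: density_1)
  show "(\<integral>z. f (x + z) \<partial>lborel) = (\<integral>y. f y \<partial>lborel)"
    using integral_distr[of "\<lambda>z. x + 1 *\<^sub>R z" lborel borel f] assms unfolding 1 by simp
  show "(\<integral>z. f (x - z) \<partial>lborel) = (\<integral>y. f y \<partial>lborel)"
    using integral_distr[of "\<lambda>z. x + (-1) *\<^sub>R z" lborel borel f] assms unfolding 2 by simp
qed

lemma AE_lborel_negligible_closed:
  fixes N :: "(real^2) set"
  assumes "negligible N" "closed N"
  shows "AE z in lborel. z \<notin> N"
proof -
  have "N \<in> null_sets lborel"
    using assms by (auto simp: negligible_iff_null_sets null_sets_completion_iff)
  then show ?thesis by (rule AE_not_in)
qed

text \<open>A supporting line at x with normal a bounds a \<bullet> z from both sides when x + z and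
  x - z both lie in the closure, so a \<bullet> z = 0.\<close>

lemma AE_not_symmetric_in_convex:
  fixes F :: "(real^2) set"
  assumes "convex F" "interior F \<noteq> {}" "x \<in> frontier F"
  shows "AE z in lborel. \<not> (x + z \<in> closure F \<and> x - z \<in> closure F)"
proof -
  have "x \<notin> rel_interior F" "x \<in> closure F"
    using assms by (auto simp: frontier_def rel_interior_nonempty_interior)
  then obtain a where a: "a \<noteq> 0" "\<And>y. y \<in> closure F \<Longrightarrow> a \<bullet> x \<le> a \<bullet> y"
    using supporting_hyperplane_relative_frontier[OF assms(1)] by metis
  have "AE z in lborel. z \<notin> {z. a \<bullet> z = 0}"
    using a(1) by (intro AE_lborel_negligible_closed negligible_hyperplane closed_hyperplane) auto
  then show ?thesis
  proof eventually_elim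
    case (elim z)
    then show ?case
      using a(2)[of "x + z"] a(2)[of "x - z"] by (auto simp: inner_add_right inner_diff_right)
  qed
qed

text \<open>The truncated integral is the average of its translated and its reflected form, and
  averaging the signs at x + z and x - z removes all cancellation.\<close>

lemma ennreal_truncated_nmc:
  assumes "0 < s" "0 < \<epsilon>" and F: "convex F" "bounded F" "interior F \<noteq> {}" and x: "x \<in> frontier F"
  shows "ennreal (truncated_nmc s F x \<epsilon>) = sym_curv_trunc s (closure F) x \<epsilon>"
    and "0 \<le> truncated_nmc s F x \<epsilon>"
proof -
  let ?K = "closure F"
  define \<sigma> :: "real^2 \<Rightarrow> real" where "\<sigma> y = 1 - 2 * indicator ?K y" for y
  define h where "h y = indicator (UNIV - ball x \<epsilon>) y * (\<sigma> y * riesz_kernel s (x - y))" for y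
  have \<sigma>m [measurable]: "\<sigma> \<in> borel_measurable borel"
    unfolding \<sigma>_def[abs_def] by measurable
  have [measurable]: "UNIV - ball x \<epsilon> \<in> sets borel" by auto
  have hm [measurable]: "h \<in> borel_measurable borel"
    unfolding h_def[abs_def] by measurable
  have Fm: "F \<in> sets lebesgue"
    using measurable_convex[OF F(1,2)] by (rule fmeasurableD)
  \<comment> \<open>The frontier of a convex set is null, so F may be replaced by its closure. This
    is a Borel set, which allows the passage from \<open>lebesgue\<close> to
    \<open>lborel\<close>.\<close>
  have "AE y in lborel. y \<notin> frontier F"
    using F(1) by (intro AE_lborel_negligible_closed negligible_convex_frontier) auto
  then have aeF: "AE y in lebesgue. y \<notin> frontier F"
    by (rule AE_completion)
  have "truncated_nmc s F x \<epsilon> = (\<integral>y. indicator (UNIV - ball x \<epsilon>) y *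
      ((indicator (- F) y - indicator F y) / norm (x - y) powr (2 + s)) \<partial>lebesgue)"
    by (simp add: truncated_nmc_def set_lebesgue_integral_def)
  also have "\<dots> = (\<integral>y. h y \<partial>lebesgue)"
  proof (rule integral_cong_AE)
    have [measurable]: "F \<in> sets lebesgue" by (rule Fm)
    have [measurable]: "(\<lambda>y. norm (x - y) powr (2 + s)) \<in> borel_measurable lebesgue"
      "(indicator (UNIV - ball x \<epsilon>) :: _ \<Rightarrow> real) \<in> borel_measurable lebesgue"
      by (rule measurable_completion, simp, measurable)+
    show "(\<lambda>y. indicator (UNIV - ball x \<epsilon>) y *
        ((indicator (- F) y - indicator F y) / norm (x - y) powr (2 + s)))
        \<in> borel_measurable lebesgue"
      by measurable
    show "h \<in> borel_measurable lebesgue"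
      by (rule measurable_completion) simp
    show "AE y in lebesgue. indicator (UNIV - ball x \<epsilon>) y *
        ((indicator (- F) y - indicator F y) / norm (x - y) powr (2 + s)) = h y"
      using aeF
    proof eventually_elim
      case (elim y)
      then have "y \<in> F \<longleftrightarrow> y \<in> ?K"
        using closure_subset interior_subset by (auto simp: frontier_def)
      then show ?case
        by (auto simp: h_def \<sigma>_def riesz_kernel_def split: split_indicator)
    qed
  qed
  also have "\<dots> = (\<integral>y. h y \<partial>lborel)"
    by (rule integral_completion) simp
  finally have T: "truncated_nmc s F x \<epsilon> = (\<integral>y. h y \<partial>lborel)" .
  define g where "g z = indicator {z. \<epsilon> \<le> norm z} z * riesz_kernel s z" for z :: "real^2"
  have gm [measurable]: "g \<in> borel_measurable borel"
    unfolding g_def[abs_def] by measurable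
  have gi: "integrable lborel g"
    using riesz_kernel_tail_finite[OF assms(1,2)]
    by (intro integrableI_nonneg) (auto simp: g_def ennreal_mult' ennreal_indicator)
  have h1: "h (x + z) = g z * \<sigma> (x + z)" and h2: "h (x - z) = g z * \<sigma> (x - z)" for z
    by (auto simp: h_def g_def dist_norm split: split_indicator)
  have \<sigma>b: "\<bar>\<sigma> y\<bar> \<le> 1" for y by (auto simp: \<sigma>_def split: split_indicator)
  have gn: "0 \<le> g z" for z by (simp add: g_def)
  have i1: "integrable lborel (\<lambda>z. h (x + z))" and i2: "integrable lborel (\<lambda>z. h (x - z))"
    unfolding h1 h2 using \<sigma>b gn
    by (auto intro!: Bochner_Integration.integrable_bound[OF gi] simp: abs_mult mult_left_le)
  define u :: "real^2 \<Rightarrow> real" where "u z = indicator (- ?K) (x + z) * indicator (- ?K) (x - z)" for z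
  have um [measurable]: "u \<in> borel_measurable borel"
    unfolding u_def[abs_def] by measurable
  have gu: "integrable lborel (\<lambda>z. g z * u z)"
    by (rule Bochner_Integration.integrable_bound[OF gi])
       (auto simp: abs_mult mult_left_le gn u_def split: split_indicator)
  have "2 * truncated_nmc s F x \<epsilon> = (\<integral>z. h (x + z) \<partial>lborel) + (\<integral>z. h (x - z) \<partial>lborel)"
    unfolding T by (simp add: lborel_integral_translate_reflect)
  also have "\<dots> = (\<integral>z. h (x + z) + h (x - z) \<partial>lborel)"
    using i1 i2 by simp
  also have "\<dots> = (\<integral>z. 2 * (g z * u z) \<partial>lborel)"
  proof (rule integral_cong_AE)
    \<comment> \<open>With one point inside and one outside, the signs cancel; both inside happens
      on a null set; both outside gives the factor 2.\<close>
    show "AE z in lborel. h (x + z) + h (x - z) = 2 * (g z * u z)"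
      using AE_not_symmetric_in_convex[OF F(1,3) x]
    proof eventually_elim
      case (elim z)
      then show ?case
        by (auto simp: h1 h2 \<sigma>_def u_def split: split_indicator)
    qed
  qed (use um in measurable)
  finally have T2: "truncated_nmc s F x \<epsilon> = (\<integral>z. g z * u z \<partial>lborel)"
    by simp
  have nn: "0 \<le> g z * u z" for z by (simp add: gn u_def)
  show "0 \<le> truncated_nmc s F x \<epsilon>"
    unfolding T2 by (intro integral_nonneg_AE) (simp add: nn)
  have "ennreal (truncated_nmc s F x \<epsilon>) = (\<integral>\<^sup>+z. ennreal (g z * u z) \<partial>lborel)"
    unfolding T2 by (rule nn_integral_eq_integral[symmetric, OF gu]) (simp add: nn)
  also have "\<dots> = sym_curv_trunc s ?K x \<epsilon>"
    unfolding sym_curv_trunc_def g_def u_def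
    by (intro nn_integral_cong) (auto split: split_indicator)
  finally show "ennreal (truncated_nmc s F x \<epsilon>) = sym_curv_trunc s ?K x \<epsilon>" .
qed

lemma sym_curv_trunc_antimono: "\<epsilon> \<le> \<epsilon>' \<Longrightarrow> sym_curv_trunc s K x \<epsilon>' \<le> sym_curv_trunc s K x \<epsilon>"
  unfolding sym_curv_trunc_def by (intro nn_integral_mono) (auto split: split_indicator)

lemma sym_curv_trunc_le: "sym_curv_trunc s K x \<epsilon> \<le> sym_curv s K x"
  unfolding sym_curv_trunc_def sym_curv_def by (intro nn_integral_mono) (auto split: split_indicator)

lemma sym_curv_eq_SUP_trunc:
  assumes "closed K"
  shows "sym_curv s K x = (SUP n::nat. sym_curv_trunc s K x (1 / (real n + 1)))"
proof -
  have [measurable]: "K \<in> sets borel" using assms by simp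
  let ?f = "\<lambda>z. indicator (- K) (x + z) * indicator (- K) (x - z) * ennreal (riesz_kernel s z)"
  have "(SUP n::nat. sym_curv_trunc s K x (1 / (real n + 1)))
      = (\<integral>\<^sup>+z. (SUP n::nat. indicator {z. 1 / (real n + 1) \<le> norm z} z * ?f z) \<partial>lborel)"
    unfolding sym_curv_trunc_def
  proof (rule nn_integral_monotone_convergence_SUP[symmetric])
    show "incseq (\<lambda>n z. indicator {z. 1 / (real n + 1) \<le> norm z} z * ?f z)"
    proof (intro incseq_SucI le_funI mult_right_mono)
      fix n z
      have "1 / (real (Suc n) + 1) \<le> 1 / (real n + 1)" by (simp add: field_simps)
      then show "(indicator {z. 1 / (real n + 1) \<le> norm z} z :: ennreal)
          \<le> indicator {z. 1 / (real (Suc n) + 1) \<le> norm z} z"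
        by (auto split: split_indicator)
    qed simp
  qed measurable
  also have "\<dots> = sym_curv s K x"
    unfolding sym_curv_def
  proof (rule nn_integral_cong)
    fix z
    show "(SUP n::nat. indicator {z. 1 / (real n + 1) \<le> norm z} z * ?f z) = ?f z"
    \<comment> \<open>The origin lies in none of the truncated regions, but the kernel vanishes
      there because 1 / 0 = 0.\<close>
    proof (cases "z = 0")
      case False
      then obtain n where n: "1 / (real n + 1) \<le> norm z"
        using reals_Archimedean[of "norm z"] by (auto simp: inverse_eq_divide add.commute intro: less_imp_le)
      show ?thesis
      proof (rule antisym)
        show "(SUP n::nat. indicator {z. 1 / (real n + 1) \<le> norm z} z * ?f z) \<le> ?f z"
          by (intro SUP_least) (auto split: split_indicator)
        show "?f z \<le> (SUP n::nat. indicator {z. 1 / (real n + 1) \<le> norm z} z * ?f z)"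
          by (rule SUP_upper2[of n]) (use n in auto)
      qed
    qed simp
  qed
  finally show ?thesis by simp
qed

lemma sym_curv_trunc_tendsto:
  assumes "closed K"
  shows "(sym_curv_trunc s K x \<longlongrightarrow> sym_curv s K x) (at_right 0)"
proof (rule order_tendstoI)
  fix c assume "c < sym_curv s K x"
  then obtain n where n: "c < sym_curv_trunc s K x (1 / (real n + 1))"
    unfolding sym_curv_eq_SUP_trunc[OF assms] less_SUP_iff by blast
  have "eventually (\<lambda>\<epsilon>. \<epsilon> \<in> {0<..<1 / (real n + 1)}) (at_right 0)"
    by (rule eventually_at_rightI[of _ "1 / (real n + 1)"]) auto
  then show "eventually (\<lambda>\<epsilon>. c < sym_curv_trunc s K x \<epsilon>) (at_right 0)"
    by eventually_elim (auto intro: less_le_trans[OF n sym_curv_trunc_antimono])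
next
  fix c assume "sym_curv s K x < c"
  then show "eventually (\<lambda>\<epsilon>. sym_curv_trunc s K x \<epsilon> < c) (at_right 0)"
    by (intro always_eventually allI le_less_trans[OF sym_curv_trunc_le])
qed

text \<open>The truncated values are nonnegative and grow as \<epsilon> decreases, so they always
  converge in [0, \<infinity>]; a real limit fails to exist exactly when this limit is
  infinite.\<close>

lemma
  assumes "0 < s" and F: "convex F" "bounded F" "interior F \<noteq> {}" and x: "x \<in> frontier F"
  shows has_nmc_iff_sym_curv: "has_nmc s F x \<longleftrightarrow> sym_curv s (closure F) x < top"
    and abs_nmc_eq_sym_curv: "has_nmc s F x \<Longrightarrow> \<bar>nmc s F x\<bar> = enn2real (sym_curv s (closure F) x)"
proof -
  let ?C = "sym_curv s (closure F) x"
  have ev: "eventually (\<lambda>\<epsilon>. 0 < \<epsilon>) (at_right (0::real))"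
    by (rule eventually_at_right_less)
  have lim: "((\<lambda>\<epsilon>. ennreal (truncated_nmc s F x \<epsilon>)) \<longlongrightarrow> ?C) (at_right 0)"
  proof (rule Lim_transform_eventually[OF sym_curv_trunc_tendsto])
    show "eventually (\<lambda>\<epsilon>. sym_curv_trunc s (closure F) x \<epsilon> = ennreal (truncated_nmc s F x \<epsilon>)) (at_right 0)"
      using ev by eventually_elim (use ennreal_truncated_nmc(1)[OF assms(1) _ F x] in auto)
  qed simp
  have nt: "\<not> trivial_limit (at_right (0::real))" by simp
  have A: "?C = ennreal L" if L: "(truncated_nmc s F x \<longlongrightarrow> L) (at_right 0)" for L
  proof -
    have "((\<lambda>\<epsilon>. ennreal (truncated_nmc s F x \<epsilon>)) \<longlongrightarrow> ennreal L) (at_right 0)"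
      using L by (rule tendsto_ennrealI)
    then show ?thesis by (rule tendsto_unique[OF nt lim])
  qed
  have B: "(truncated_nmc s F x \<longlongrightarrow> enn2real ?C) (at_right 0)" if "?C < top"
  proof (rule Lim_transform_eventually)
    show "((\<lambda>\<epsilon>. enn2real (ennreal (truncated_nmc s F x \<epsilon>))) \<longlongrightarrow> enn2real ?C) (at_right 0)"
      using lim that by (intro tendsto_enn2real) auto
    show "eventually (\<lambda>\<epsilon>. enn2real (ennreal (truncated_nmc s F x \<epsilon>)) = truncated_nmc s F x \<epsilon>) (at_right 0)"
      using ev by eventually_elim (use ennreal_truncated_nmc(2)[OF assms(1) _ F x] in auto)
  qed
  show iff: "has_nmc s F x \<longleftrightarrow> ?C < top"
    using A B unfolding has_nmc_def by (metis ennreal_less_top)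
  show "\<bar>nmc s F x\<bar> = enn2real ?C" if "has_nmc s F x"
  proof -
    have "nmc s F x = enn2real ?C"
      unfolding nmc_def using B that iff by (intro tendsto_Lim nt) auto
    then show ?thesis by simp
  qed
qed

lemma sym_curv_measurable:
  assumes "closed K"
  shows "sym_curv s K \<in> borel_measurable borel"
proof -
  have [measurable]: "K \<in> sets borel" using assms by simp
  show ?thesis
    unfolding sym_curv_def[abs_def] by measurable
qed

text \<open>Common source of the strip and the corner estimates: the area of the ball times the
  kernel at its farthest point. The condition \<open>\<rho> \<le> norm z1\<close> keeps out the
  origin, where the kernel takes the default value 0.\<close>

lemma sym_curv_ge_ball:
  assumes "0 < \<rho>" "\<rho> \<le> norm z1" "0 < s"
    and out: "\<And>z. z \<in> ball z1 \<rho> \<Longrightarrow> x + z \<notin> K \<and> x - z \<notin> K"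
  shows "ennreal (pi * \<rho>\<^sup>2 / (norm z1 + \<rho>) powr (2 + s)) \<le> sym_curv s K x"
proof -
  have "ennreal (pi * \<rho>\<^sup>2 / (norm z1 + \<rho>) powr (2 + s))
      = ennreal (1 / (norm z1 + \<rho>) powr (2 + s)) * emeasure lborel (ball z1 \<rho>)"
    using assms by (subst emeasure_ball) (auto simp: unit_ball_vol_2 ennreal_mult'[symmetric])
  also have "\<dots> = (\<integral>\<^sup>+z. ennreal (1 / (norm z1 + \<rho>) powr (2 + s)) * indicator (ball z1 \<rho>) z \<partial>lborel)"
    by (rule nn_integral_cmult_indicator[symmetric]) simp
  also have "\<dots> \<le> sym_curv s K x"
    unfolding sym_curv_def
  proof (rule nn_integral_mono)
    fix z
    show "ennreal (1 / (norm z1 + \<rho>) powr (2 + s)) * indicator (ball z1 \<rho>) z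
        \<le> indicator (- K) (x + z) * indicator (- K) (x - z) * ennreal (riesz_kernel s z)"
    proof (cases "z \<in> ball z1 \<rho>")
      case True
      have "norm z \<le> norm z1 + dist z1 z" "norm z1 \<le> norm z + dist z1 z"
        unfolding dist_norm by (metis add.commute norm_triangle_sub norm_minus_commute)+
      then have "0 < norm z" "norm z \<le> norm z1 + \<rho>"
        using True assms(2) by auto
      then have "1 / (norm z1 + \<rho>) powr (2 + s) \<le> riesz_kernel s z"
        unfolding riesz_kernel_def using assms by (intro divide_left_mono powr_mono2 mult_pos_pos) auto
      then show ?thesis using True out[OF True] by (auto intro: ennreal_leI)
    qed simp
  qed
  finally show ?thesis .
qed

text \<open>The change of variables contributes c to the power 2, the kernel c to the power -(2 +
  s).\<close>

lemma sym_curv_scale: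
  assumes "closed K" "0 < c"
  shows "sym_curv s ((\<lambda>y. c *\<^sub>R (y - q)) ` K) (c *\<^sub>R (x - q)) = ennreal (c powr (- s)) * sym_curv s K x"
proof -
  let ?K = "(\<lambda>y. c *\<^sub>R (y - q)) ` K"
  have inj: "inj (\<lambda>y. c *\<^sub>R (y - q))" using \<open>0 < c\<close> by (auto simp: inj_on_def)
  have mem: "c *\<^sub>R (y - q) \<in> ?K \<longleftrightarrow> y \<in> K" for y
    using inj_image_mem_iff[OF inj] .
  have "closed ((\<lambda>y. c *\<^sub>R y) ` ((\<lambda>y. y - q) ` K))"
    using assms by (intro closed_scaling closed_translation_subtract)
  then have "closed ?K" by (simp add: image_image)
  then have [measurable]: "?K \<in> sets borel" by simp
  let ?f = "\<lambda>z. indicator (- ?K) (c *\<^sub>R (x - q) + z) * indicator (- ?K) (c *\<^sub>R (x - q) - z)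
    * ennreal (riesz_kernel s z)"
  have fm: "?f \<in> borel_measurable borel"
    by measurable
  have "sym_curv s ?K (c *\<^sub>R (x - q)) = (\<integral>\<^sup>+z. ?f z \<partial>lborel)"
    by (simp add: sym_curv_def)
  also have "\<dots> = (\<integral>\<^sup>+z. ?f z \<partial>(density (distr lborel borel (\<lambda>z. 0 + c *\<^sub>R z)) (\<lambda>_. ennreal (\<bar>c\<bar>^DIM(real^2)))))"
    using lborel_affine[of c "0 :: real^2"] \<open>0 < c\<close> by simp
  also have "\<dots> = (\<integral>\<^sup>+z. ennreal (c\<^sup>2) * ?f (c *\<^sub>R z) \<partial>lborel)"
    using fm \<open>0 < c\<close> by (simp add: nn_integral_density nn_integral_distr)
  also have "\<dots> = (\<integral>\<^sup>+z. ennreal (c powr (- s)) *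
      (indicator (- K) (x + z) * indicator (- K) (x - z) * ennreal (riesz_kernel s z)) \<partial>lborel)"
  proof (rule nn_integral_cong)
    fix z
    have "c *\<^sub>R (x - q) + c *\<^sub>R z = c *\<^sub>R ((x + z) - q)" "c *\<^sub>R (x - q) - c *\<^sub>R z = c *\<^sub>R ((x - z) - q)"
      by (simp_all add: algebra_simps)
    then have ind: "indicator (- ?K) (c *\<^sub>R (x - q) + c *\<^sub>R z) = (indicator (- K) (x + z) :: ennreal)"
      "indicator (- ?K) (c *\<^sub>R (x - q) - c *\<^sub>R z) = (indicator (- K) (x - z) :: ennreal)"
      using mem[of "x + z"] mem[of "x - z"] by (auto split: split_indicator)
    have "c\<^sup>2 * riesz_kernel s (c *\<^sub>R z) = c powr (- s) * riesz_kernel s z"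
      using \<open>0 < c\<close> by (simp add: riesz_kernel_def powr_mult powr_add powr_minus field_simps)
    then have "ennreal (c\<^sup>2) * ennreal (riesz_kernel s (c *\<^sub>R z)) = ennreal (c powr (- s)) * ennreal (riesz_kernel s z)"
      by (simp add: ennreal_mult'[symmetric])
    then show "ennreal (c\<^sup>2) * ?f (c *\<^sub>R z) = ennreal (c powr (- s)) *
        (indicator (- K) (x + z) * indicator (- K) (x - z) * ennreal (riesz_kernel s z))"
      unfolding ind by (simp split: split_indicator)
  qed
  also have "\<dots> = ennreal (c powr (- s)) * sym_curv s K x"
  proof -
    have [measurable]: "K \<in> sets borel" using assms by simp
    show ?thesis unfolding sym_curv_def by (rule nn_integral_cmult) measurable
  qed
  finally show ?thesis .
qed

text \<open>By \<open>upper\<close>, if \<open>x0 + z\<close> and \<open>x0 - z\<close> lie outside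
  E, then the corresponding points for \<open>x n\<close> lie outside \<open>K n\<close> eventually.
  So the integrand of the limit is pointwise at most the lower limit of the integrands, and Fatou's
  lemma applies.\<close>

lemma sym_curv_lower_semicontinuous:
  assumes lim: "x \<longlonglongrightarrow> x0" and cl: "\<And>n. closed (K n)"
    and upper: "\<And>y y0. y \<longlonglongrightarrow> y0 \<Longrightarrow> y0 \<notin> E \<Longrightarrow> eventually (\<lambda>n. y n \<notin> K n) sequentially"
    and le: "\<And>n. sym_curv s (K n) (x n) \<le> c"
  shows "sym_curv s E x0 \<le> c"
proof -
  let ?f = "\<lambda>K x z. indicator (- K) (x + z) * indicator (- K) (x - z) * ennreal (riesz_kernel s z)"
  have m: "?f (K n) (x n) \<in> borel_measurable lborel" for n
  proof -
    have [measurable]: "K n \<in> sets borel" using cl by simp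
    show ?thesis by measurable
  qed
  have "sym_curv s E x0 \<le> (\<integral>\<^sup>+z. liminf (\<lambda>n. ?f (K n) (x n) z) \<partial>lborel)"
    unfolding sym_curv_def
  proof (rule nn_integral_mono)
    fix z
    show "?f E x0 z \<le> liminf (\<lambda>n. ?f (K n) (x n) z)"
    proof (cases "x0 + z \<in> E \<or> x0 - z \<in> E")
      case False
      have "(\<lambda>n. x n + z) \<longlonglongrightarrow> x0 + z" "(\<lambda>n. x n - z) \<longlonglongrightarrow> x0 - z"
        using lim by (auto intro!: tendsto_intros)
      then have "eventually (\<lambda>n. x n + z \<notin> K n) sequentially" "eventually (\<lambda>n. x n - z \<notin> K n) sequentially"
        using upper False by blast+
      then have "eventually (\<lambda>n. ?f E x0 z \<le> ?f (K n) (x n) z) sequentially"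
        by eventually_elim (use False in auto)
      then show ?thesis by (rule Liminf_bounded)
    qed auto
  qed
  also have "\<dots> \<le> liminf (\<lambda>n. sym_curv s (K n) (x n))"
    unfolding sym_curv_def by (rule nn_integral_liminf[OF m])
  also have "\<dots> \<le> liminf (\<lambda>n. c)"
    by (intro Liminf_mono always_eventually allI le)
  also have "\<dots> = c" by (simp add: Liminf_const)
  finally show ?thesis .
qed

subsection \<open>The energy\<close>

text \<open>The case distinction is needed because \<^const>\<open>enn2real\<close> maps \<open>\<infinity>\<close> to 0.\<close>

definition epow :: "real \<Rightarrow> ennreal \<Rightarrow> ennreal" where
  "epow p t = (if t = top then top else ennreal (enn2real t powr p))"

lemma epow_mono:
  assumes "0 \<le> p" "t \<le> u"
  shows "epow p t \<le> epow p u"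
proof (cases "u = top")
  case False
  then have "t < top" "u < top" using assms(2) by (auto simp: top.not_eq_extremum intro: le_less_trans)
  then show ?thesis
    using assms by (auto simp: epow_def intro!: ennreal_leI powr_mono2 enn2real_mono)
qed (simp add: epow_def)

lemma epow_measurable [measurable (raw)]:
  assumes f [measurable]: "f \<in> borel_measurable M"
  shows "(\<lambda>x. epow p (f x)) \<in> borel_measurable M"
proof -
  have "f -` {top} \<inter> space M \<in> sets M"
    using f by (rule measurable_sets) simp
  then have "{x \<in> space M. f x = top} \<in> sets M"
    by (simp add: vimage_def Int_def conj_commute)
  moreover have "(\<lambda>x. ennreal (enn2real (f x) powr p)) \<in> borel_measurable M"
    by measurable
  ultimately show ?thesis
    unfolding epow_def by (intro measurable_If) auto
qed

lemma epow_ennreal: "0 \<le> r \<Longrightarrow> epow p (ennreal r) = ennreal (r powr p)"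
  by (simp add: epow_def)

text \<open>Translates a bound on the energy density into a bound on the curvature, the form in
  which semicontinuity is available.\<close>

lemma epow_le_iff:
  assumes "0 < p" "0 \<le> r"
  shows "epow p t \<le> ennreal r \<longleftrightarrow> t \<le> ennreal (r powr (1 / p))"
proof (cases t)
  case (real a)
  then have "epow p t \<le> ennreal r \<longleftrightarrow> a powr p \<le> r"
    using assms by (simp add: epow_ennreal)
  also have "\<dots> \<longleftrightarrow> a \<le> r powr (1 / p)"
  proof
    assume "a powr p \<le> r"
    then have "(a powr p) powr (1 / p) \<le> r powr (1 / p)"
      using assms by (intro powr_mono2) auto
    then show "a \<le> r powr (1 / p)" using assms real by (simp add: powr_powr)
  next
    assume "a \<le> r powr (1 / p)"
    then have "a powr p \<le> (r powr (1 / p)) powr p"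
      using assms real by (intro powr_mono2) auto
    then show "a powr p \<le> r" using assms by (simp add: powr_powr)
  qed
  also have "\<dots> \<longleftrightarrow> t \<le> ennreal (r powr (1 / p))"
    using real by simp
  finally show ?thesis .
qed (simp add: epow_def top_unique)

lemma epow_scale:
  assumes "0 < c" "0 < s"
  shows "epow (1 / s) (ennreal (c powr (- s)) * t) = ennreal (1 / c) * epow (1 / s) t"
proof (cases t)
  case (real a)
  have "(c powr (- s) * a) powr (1 / s) = (1 / c) * a powr (1 / s)"
  proof -
    have "(c powr (- s)) powr (1 / s) = 1 / c"
      using assms by (simp only: powr_powr) (simp add: powr_minus_divide)
    then show ?thesis
      using assms real by (subst powr_mult) auto
  qed
  then show ?thesis
    using assms real by (simp add: epow_ennreal ennreal_mult'[symmetric])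
next
  case top
  then show ?thesis using assms by (simp add: epow_def ennreal_mult_top)
qed

definition sym_energy :: "real \<Rightarrow> (real^2) set \<Rightarrow> ennreal" where
  "sym_energy s K = (\<integral>\<^sup>+x\<in>frontier K. epow (1 / s) (sym_curv s K x) \<partial>hausdorff1)"

lemma frontier_closure_convex:
  fixes F :: "'a::euclidean_space set"
  assumes "convex F"
  shows "frontier (closure F) = frontier F"
  using convex_interior_closure[OF assms] by (simp add: frontier_def)

text \<open>Where the principal value does not exist, \<open>nmc\<close> is an unspecified limit
  while \<open>sym_curv\<close> is infinite; \<open>ae\<close> confines this discrepancy to a null
  set.\<close>

lemma nonlocal_energy_eq_sym_energy:
  assumes "0 < s" and F: "convex F" "bounded F" "interior F \<noteq> {}"
    and ae: "AE x in hausdorff1. x \<in> frontier F \<longrightarrow> has_nmc s F x"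
  shows "nonlocal_energy s (1 / s) F = sym_energy s (closure F)"
proof -
  have "F \<in> sets lebesgue"
    using measurable_convex[OF F(1,2)] by (rule fmeasurableD)
  then have "nonlocal_energy s (1 / s) F
      = (\<integral>\<^sup>+x\<in>frontier F. ennreal (\<bar>nmc s F x\<bar> powr (1 / s)) \<partial>hausdorff1)"
    using ae by (simp add: nonlocal_energy_def)
  also have "\<dots> = (\<integral>\<^sup>+x\<in>frontier F. epow (1 / s) (sym_curv s (closure F) x) \<partial>hausdorff1)"
    using ae
  proof (intro nn_integral_cong_AE, eventually_elim)
    case (elim x)
    show ?case
    proof (cases "x \<in> frontier F")
      case True
      then show ?thesis
        using elim has_nmc_iff_sym_curv[OF assms(1) F True] abs_nmc_eq_sym_curv[OF assms(1) F True]
        by (simp add: epow_def)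
    qed simp
  qed
  finally show ?thesis
    by (simp add: sym_energy_def frontier_closure_convex[OF F(1)])
qed

lemma nonlocal_energy_finite_imp:
  assumes "0 < s" and F: "convex F" "bounded F" "interior F \<noteq> {}"
    and fin: "nonlocal_energy s (1 / s) F < top"
  shows "nonlocal_energy s (1 / s) F = sym_energy s (closure F)"
  using fin
  by (intro nonlocal_energy_eq_sym_energy[OF assms(1) F]) (auto simp: nonlocal_energy_def split: if_splits)

text \<open>A finite integral of G makes G, hence \<open>sym_curv\<close>, finite almost everywhere
  on the frontier. Thus the principal value exists there, and the definition of the energy takes its
  integral branch.\<close>

lemma nonlocal_energy_le_of_majorant:
  assumes "0 < s" and E: "convex E" "compact E" "interior E \<noteq> {}"
    and G: "G \<in> borel_measurable borel"
      "\<And>x. x \<in> frontier E \<Longrightarrow> epow (1 / s) (sym_curv s E x) \<le> G x"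
      "(\<integral>\<^sup>+x\<in>frontier E. G x \<partial>hausdorff1) \<le> m"
    and "m < top"
  shows "nonlocal_energy s (1 / s) E \<le> m"
proof -
  have cE: "closure E = E" using E(2) by (simp add: compact_imp_closed)
  have "(\<lambda>x. G x * indicator (frontier E) x) \<in> borel_measurable borel"
    using G(1) by (intro borel_measurable_times_ennreal borel_measurable_indicator) auto
  then have "(\<lambda>x. G x * indicator (frontier E) x) \<in> borel_measurable hausdorff1"
    by (rule borel_measurable_hausdorff1)
  then have "AE x in hausdorff1. G x * indicator (frontier E) x \<noteq> \<infinity>"
    by (rule nn_integral_PInf_AE) (use G(3) \<open>m < top\<close> in \<open>auto simp: top_unique\<close>)
  then have "AE x in hausdorff1. x \<in> frontier E \<longrightarrow> has_nmc s E x"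
  proof eventually_elim
    case (elim x)
    show ?case
    proof
      assume x: "x \<in> frontier E"
      then have "epow (1 / s) (sym_curv s E x) < top"
        using elim G(2)[OF x] by (auto simp: top.not_eq_extremum intro: le_less_trans)
      then show "has_nmc s E x"
        using has_nmc_iff_sym_curv[OF assms(1) E(1) compact_imp_bounded[OF E(2)] E(3) x]
        by (auto simp: cE epow_def top.not_eq_extremum split: if_splits)
    qed
  qed
  then have "nonlocal_energy s (1 / s) E = sym_energy s E"
    using nonlocal_energy_eq_sym_energy[OF assms(1) E(1) compact_imp_bounded[OF E(2)] E(3)] cE by simp
  also have "\<dots> \<le> (\<integral>\<^sup>+x\<in>frontier E. G x \<partial>hausdorff1)"
    unfolding sym_energy_def using G(2) by (intro nn_integral_mono) (auto split: split_indicator)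
  finally show ?thesis using G(3) by simp
qed

text \<open>The map multiplies lengths by c and the density by 1 / c, the power 1/s of the curvature
  factor. One inequality suffices, since rescaling a minimizing sequence only must not raise its
  energy.\<close>

lemma sym_energy_scale_le:
  assumes "closed K" "0 < c" "0 < s"
  shows "sym_energy s ((\<lambda>y. c *\<^sub>R (y - q)) ` K) \<le> sym_energy s K"
proof -
  let ?f = "\<lambda>y. c *\<^sub>R (y - q)"
  have im: "?f ` S = (\<lambda>y. c *\<^sub>R y) ` ((\<lambda>y. y - q) ` S)" for S
    by (simp add: image_image)
  have cl: "closed (?f ` K)"
    unfolding im using assms by (intro closed_scaling closed_translation_subtract)
  have sub: "frontier (?f ` K) \<subseteq> ?f ` frontier K"
  proof
    fix y assume "y \<in> frontier (?f ` K)"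
    then have y: "y \<in> ?f ` K" "y \<notin> interior (?f ` K)"
      using cl by (auto simp: frontier_def)
    then obtain x where x: "x \<in> K" "y = ?f x" by blast
    have "open (?f ` interior K)"
      unfolding im using assms by (intro open_scaling open_translation_subtract) auto
    then have "?f ` interior K \<subseteq> interior (?f ` K)"
      using interior_subset by (intro interior_maximal image_mono) auto
    then have "x \<notin> interior K" using y(2) x(2) by blast
    then show "y \<in> ?f ` frontier K"
      using x assms(1) by (auto simp: frontier_def)
  qed
  have "sym_energy s (?f ` K) \<le> ennreal c *
      (\<integral>\<^sup>+x\<in>frontier K. epow (1 / s) (sym_curv s (?f ` K) (?f x)) \<partial>hausdorff1)"
    unfolding sym_energy_def
  proof (rule nn_integral_lipschitz_transfer[OF \<open>0 < c\<close> _ _ _ _ sub])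
    show "continuous_on UNIV ?f" by (intro continuous_intros)
    show "dist (?f x) (?f y) \<le> c * dist x y" for x y
      using \<open>0 < c\<close> by (simp add: dist_norm scaleR_diff_right[symmetric])
    show "(\<lambda>y. epow (1 / s) (sym_curv s (?f ` K) y)) \<in> borel_measurable borel"
      by (intro epow_measurable sym_curv_measurable cl)
  qed auto
  also have "(\<integral>\<^sup>+x\<in>frontier K. epow (1 / s) (sym_curv s (?f ` K) (?f x)) \<partial>hausdorff1)
      = (\<integral>\<^sup>+x. ennreal (1 / c) * (epow (1 / s) (sym_curv s K x) * indicator (frontier K) x) \<partial>hausdorff1)"
    using assms by (simp add: sym_curv_scale epow_scale mult.assoc)
  also have "\<dots> = ennreal (1 / c) * sym_energy s K"
    unfolding sym_energy_def
    by (intro nn_integral_cmult borel_measurable_hausdorff1 borel_measurable_times_ennreal epow_measurable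
        sym_curv_measurable borel_measurable_indicator) (use assms in auto)
  also have "ennreal c * (ennreal (1 / c) * sym_energy s K) = sym_energy s K"
    using \<open>0 < c\<close> by (simp add: mult.assoc[symmetric] ennreal_mult'[symmetric])
  finally show ?thesis .
qed

section \<open>Energy of bodies in a thin strip\<close>

lemma sym_curv_ge_strip:
  assumes "0 < s" "0 < \<delta>" and a: "norm a = 1"
    and K: "\<And>y. y \<in> K \<Longrightarrow> \<bar>a \<bullet> y - b\<bar> \<le> \<delta>" and "x \<in> K"
  shows "ennreal (pi / 5 powr (2 + s) * \<delta> powr (- s)) \<le> sym_curv s K x"
proof -
  have "pi / 5 powr (2 + s) * \<delta> powr (- s) = pi * \<delta>\<^sup>2 / (norm ((4 * \<delta>) *\<^sub>R a) + \<delta>) powr (2 + s)"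
  proof -
    have "norm ((4 * \<delta>) *\<^sub>R a) + \<delta> = 5 * \<delta>"
      using a \<open>0 < \<delta>\<close> by simp
    moreover have "(5 * \<delta>) powr (2 + s) = 5 powr (2 + s) * \<delta> powr (2 + s)"
      using \<open>0 < \<delta>\<close> by (simp add: powr_mult)
    moreover have "\<delta> powr (2 + s) = \<delta>\<^sup>2 * \<delta> powr s"
      using \<open>0 < \<delta>\<close> by (simp add: powr_add)
    ultimately show ?thesis
      using \<open>0 < \<delta>\<close> by (simp add: powr_minus divide_simps)
  qed
  \<comment> \<open>Every z within \<delta> of 4 \<delta> a changes the a-coordinate by more than 3
    \<delta>, whereas K has width at most 2 \<delta>; so x + z and x - z both leave K. The constant
    5 is 4 + 1, the farthest distance in units of \<delta>.\<close>
  also have "ennreal \<dots> \<le> sym_curv s K x"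
  proof (rule sym_curv_ge_ball)
    fix z assume "z \<in> ball ((4 * \<delta>) *\<^sub>R a) \<delta>"
    then have "norm ((4 * \<delta>) *\<^sub>R a - z) < \<delta>" by (simp add: dist_norm)
    then have "a \<bullet> ((4 * \<delta>) *\<^sub>R a - z) < \<delta>"
      using norm_cauchy_schwarz[of a "(4 * \<delta>) *\<^sub>R a - z"] a by simp
    then have az: "3 * \<delta> < a \<bullet> z"
      using a by (simp add: inner_diff_right dot_square_norm)
    show "x + z \<notin> K \<and> x - z \<notin> K"
      using K[of "x + z"] K[of "x - z"] K[OF \<open>x \<in> K\<close>] az \<open>0 < \<delta>\<close>
      by (auto simp: inner_add_right inner_diff_right)
  qed (use assms in simp_all)
  finally show ?thesis .
qed

text \<open>By convexity K meets every line perpendicular to w at an intermediate height, and such a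
  line must cross the frontier to leave the bounded set K.\<close>

lemma frontier_projection_onto:
  fixes K :: "(real^2) set"
  assumes K: "convex K" "compact K" and PQ: "P \<in> K" "Q \<in> K"
  shows "{w \<bullet> Q..w \<bullet> P} \<subseteq> (\<bullet>) w ` frontier K"
proof
  fix t assume t: "t \<in> {w \<bullet> Q..w \<bullet> P}"
  obtain y where y: "y \<in> K" "w \<bullet> y = t"
    using connected_ivt_hyperplane[OF convex_connected[OF K(1)] PQ(2,1), of w t] t by auto
  obtain v where v: "v \<noteq> 0" "w \<bullet> v = 0"
    using orthogonal_to_vector_exists[of w] by (auto simp: orthogonal_def)
  obtain B where B: "\<And>y. y \<in> K \<Longrightarrow> norm y \<le> B"
    using compact_imp_bounded[OF K(2)] by (auto simp: bounded_iff)
  \<comment> \<open>The displacement has length B + |y| + 1, which forces |z| > B and so puts z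
    outside K.\<close>
  define z where "z = y + ((B + norm y + 1) / norm v) *\<^sub>R v"
  have "0 \<le> B" using B[OF y(1)] norm_ge_zero order_trans by blast
  have "B < norm z"
  proof -
    have "norm (z - y) = B + norm y + 1"
      using v \<open>0 \<le> B\<close> by (simp add: z_def)
    then show ?thesis using norm_triangle_ineq4[of z y] by linarith
  qed
  then have "z \<notin> K" using B by force
  then obtain x where x: "x \<in> closed_segment y z" "x \<in> frontier K"
    using connected_Int_frontier[OF connected_segment(1), of y z K] y(1) by blast
  have "w \<bullet> z = t" using v y by (simp add: z_def inner_add_right)
  obtain u where "x = (1 - u) *\<^sub>R y + u *\<^sub>R z"
    using x(1) unfolding closed_segment_def by blast
  then have "w \<bullet> x = (1 - u) * t + u * t"
    using y(2) \<open>w \<bullet> z = t\<close> by (simp add: inner_add_right)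
  then have "w \<bullet> x = t"
    by (simp add: algebra_simps)
  then show "t \<in> (\<bullet>) w ` frontier K" using x(2) by blast
qed

text \<open>Projection to the direction of P - Q is 1-Lipschitz and maps the frontier onto an
  interval of length 1. On the frontier the density is at least the constant given by the strip
  estimate, whose power 1/s turns \<delta> to the power -s into 1 / \<delta>.\<close>

lemma sym_energy_ge_strip:
  assumes "0 < s" "0 < \<delta>" and a: "norm a = 1"
    and K: "convex K" "compact K" "\<And>y. y \<in> K \<Longrightarrow> \<bar>a \<bullet> y - b\<bar> \<le> \<delta>"
    and PQ: "P \<in> K" "Q \<in> K" "dist P Q = 1"
  shows "ennreal ((pi / 5 powr (2 + s)) powr (1 / s) / \<delta>) \<le> sym_energy s K"
proof -
  define c where "c = (pi / 5 powr (2 + s)) powr (1 / s) / \<delta>"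
  define w where "w = P - Q"
  have w: "norm w = 1" using PQ(3) by (simp add: w_def dist_norm)
  have len: "w \<bullet> P - w \<bullet> Q = 1"
    using w by (simp add: inner_diff_right[symmetric] w_def[symmetric] dot_square_norm)
  have le: "ennreal c \<le> epow (1 / s) (sym_curv s K x)" if "x \<in> frontier K" for x
  proof -
    have "x \<in> K" using that K(2) by (auto simp: frontier_def compact_imp_closed)
    have "ennreal c = epow (1 / s) (ennreal (pi / 5 powr (2 + s) * \<delta> powr (- s)))"
      using \<open>0 < \<delta>\<close> \<open>0 < s\<close> by (subst epow_ennreal) (auto simp: c_def powr_mult powr_powr powr_minus_divide powr_divide)
    also have "\<dots> \<le> epow (1 / s) (sym_curv s K x)"
      using assms \<open>x \<in> K\<close> by (intro epow_mono sym_curv_ge_strip) auto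
    finally show ?thesis .
  qed
  have "ennreal c = (\<integral>\<^sup>+t\<in>{w \<bullet> Q..w \<bullet> P}. ennreal c \<partial>lborel)"
    using len by (subst nn_integral_cmult_indicator) auto
  also have "\<dots> \<le> ennreal 1 * (\<integral>\<^sup>+x\<in>frontier K. ennreal c \<partial>hausdorff1)"
  proof (rule nn_integral_lborel_lipschitz_transfer[OF _ _ _ _ _ frontier_projection_onto[OF K(1,2) PQ(1,2)]])
    show "dist (w \<bullet> x) (w \<bullet> y) \<le> 1 * dist x y" for x y
      using Cauchy_Schwarz_ineq2[of w "x - y"] w by (simp add: dist_norm inner_diff_right)
  qed (auto intro!: continuous_intros)
  also have "\<dots> \<le> sym_energy s K"
    unfolding sym_energy_def using le
    by (simp, intro nn_integral_mono) (auto split: split_indicator)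
  finally show ?thesis unfolding c_def .
qed

subsection \<open>Lower semicontinuity and compactness\<close>

text \<open>The contracted point is the centre of a ball of radius \<eta> \<rho> / (1 + \<eta>) in
  E, spanned by z and the ball around p. If a line separated the centre from K, the point of this
  ball farthest from that line on the other side would be more than \<delta> away from K.\<close>

lemma shrunk_convex_subset:
  fixes E K :: "'a::euclidean_space set"
  assumes E: "convex E" and ball: "cball p \<rho> \<subseteq> E" and "0 < \<eta>"
    and K: "convex K" "closed K" "K \<noteq> {}" and near: "\<And>x. x \<in> E \<Longrightarrow> infdist x K < \<delta>"
    and \<delta>: "\<delta> \<le> \<eta> * \<rho> / (1 + \<eta>)" and "0 \<le> \<rho>" and z: "z \<in> E"
  shows "p + (z - p) /\<^sub>R (1 + \<eta>) \<in> K"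
proof (rule ccontr)
  define w where "w = p + (z - p) /\<^sub>R (1 + \<eta>)"
  assume "p + (z - p) /\<^sub>R (1 + \<eta>) \<notin> K"
  then have "w \<notin> K" by (simp add: w_def)
  then obtain a b where ab: "a \<bullet> w < b" "\<And>x. x \<in> K \<Longrightarrow> b < a \<bullet> x"
    using separating_hyperplane_closed_point[OF K(1,2)] by metis
  then have "a \<noteq> 0" using K(3) by force
  \<comment> \<open>The point of the ball around p that lies deepest in the direction -a, away from
    K.\<close>
  define u where "u = p - (\<rho> / norm a) *\<^sub>R a"
  have "u \<in> E"
    using ball \<open>a \<noteq> 0\<close> \<open>0 \<le> \<rho>\<close> by (auto simp: u_def dist_norm subset_iff)
  define e where "e = (1 / (1 + \<eta>)) *\<^sub>R z + (\<eta> / (1 + \<eta>)) *\<^sub>R u"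
  have sum1: "1 / (1 + \<eta>) + \<eta> / (1 + \<eta>) = 1"
    using \<open>0 < \<eta>\<close> by (simp add: add_divide_distrib[symmetric])
  have "e \<in> E"
    unfolding e_def using z \<open>u \<in> E\<close> \<open>0 < \<eta>\<close> sum1 by (intro convexD[OF E]) auto
  then have "infdist e K < \<delta>" by (rule near)
  moreover obtain k where k: "k \<in> K" "infdist e K = dist e k"
    using infdist_attains_inf[OF K(2,3)] by metis
  ultimately have "norm (k - e) < \<delta>" by (simp add: dist_norm norm_minus_commute)
  have ew: "e = w - (\<eta> / (1 + \<eta>) * \<rho> / norm a) *\<^sub>R a"
  proof -
    have "e - w = (1 / (1 + \<eta>)) *\<^sub>R p + (\<eta> / (1 + \<eta>)) *\<^sub>R p - p - (\<eta> / (1 + \<eta>) * \<rho> / norm a) *\<^sub>R a"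
      by (simp add: e_def w_def u_def algebra_simps divide_inverse)
    also have "(1 / (1 + \<eta>)) *\<^sub>R p + (\<eta> / (1 + \<eta>)) *\<^sub>R p = p"
      by (simp add: scaleR_left_distrib[symmetric] sum1)
    finally show ?thesis by (simp add: algebra_simps)
  qed
  have "a \<bullet> e = a \<bullet> w - \<eta> * \<rho> / (1 + \<eta>) * norm a"
    unfolding ew using \<open>a \<noteq> 0\<close> by (simp add: inner_diff_right dot_square_norm power2_eq_square)
  moreover have "a \<bullet> (k - e) \<le> norm a * norm (k - e)"
    by (rule norm_cauchy_schwarz)
  moreover have "norm a * norm (k - e) < norm a * (\<eta> * \<rho> / (1 + \<eta>))"
    using \<open>a \<noteq> 0\<close> \<open>norm (k - e) < \<delta>\<close> \<delta> by (intro mult_strict_left_mono) auto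
  ultimately have "a \<bullet> k < a \<bullet> w"
    by (simp add: inner_diff_right algebra_simps)
  then show False using ab k(1) by (meson less_asym less_trans)
qed

text \<open>All points of the outward normal ray at x, here x - \<tau> a with \<tau> \<ge> 0, have x
  as their nearest point in E. Contracted about p, the ray starts in K and ends outside it; where it
  crosses \<open>frontier K\<close>, dilation and projection lead back to x.\<close>

lemma frontier_subset_retract:
  fixes E K :: "'a::euclidean_space set"
  assumes E: "convex E" "compact E" "p \<in> interior E" and K: "compact K" and "0 < \<eta>"
    and sub: "\<And>z. z \<in> E \<Longrightarrow> p + (z - p) /\<^sub>R (1 + \<eta>) \<in> K"
  shows "frontier E \<subseteq> (\<lambda>y. closest_point E (p + (1 + \<eta>) *\<^sub>R (y - p))) ` frontier K"
proof
  fix x assume "x \<in> frontier E"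
  then have x: "x \<in> E" "x \<notin> rel_interior E"
    using E rel_interior_nonempty_interior[of E] by (auto simp: frontier_def compact_imp_closed)
  then obtain a where a: "a \<noteq> 0" "\<And>y. y \<in> E \<Longrightarrow> a \<bullet> x \<le> a \<bullet> y"
    using supporting_hyperplane_rel_boundary[OF E(1)] by metis
  define h where "h \<tau> = p + (x - \<tau> *\<^sub>R a - p) /\<^sub>R (1 + \<eta>)" for \<tau>
  have h0: "h 0 \<in> K" using sub[OF x(1)] by (simp add: h_def)
  obtain B where B: "\<And>y. y \<in> K \<Longrightarrow> norm y \<le> B"
    using compact_imp_bounded[OF K] by (auto simp: bounded_iff)
  have "0 \<le> B" using B[OF h0] norm_ge_zero order_trans by blast
  define T where "T = (1 + \<eta>) * (B + norm (h 0) + 1) / norm a"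
  have hd: "h \<tau> = h 0 - (\<tau> / (1 + \<eta>)) *\<^sub>R a" for \<tau>
    by (simp add: h_def algebra_simps divide_inverse)
  have "norm (h T - h 0) = B + norm (h 0) + 1"
    unfolding hd[of T] using a(1) \<open>0 < \<eta>\<close> \<open>0 \<le> B\<close> by (simp add: T_def)
  then have "B < norm (h T)" using norm_triangle_ineq4[of "h T" "h 0"] by linarith
  then have "h T \<notin> K" using B by force
  then obtain y where y: "y \<in> closed_segment (h 0) (h T)" "y \<in> frontier K"
    using connected_Int_frontier[OF connected_segment(1), of "h 0" "h T" K] h0 by blast
  obtain v where v: "0 \<le> v" "y = (1 - v) *\<^sub>R h 0 + v *\<^sub>R h T"
    using y(1) unfolding closed_segment_def by blast
  have "y = h (v * T)"
    unfolding v(2) hd[of T] hd[of "v * T"] by (simp add: algebra_simps)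
  then have "p + (1 + \<eta>) *\<^sub>R (y - p) = x - (v * T) *\<^sub>R a"
    using \<open>0 < \<eta>\<close> by (simp add: h_def)
  moreover have "x = closest_point E (x - (v * T) *\<^sub>R a)"
  proof (rule closest_point_unique[OF E(1) compact_imp_closed[OF E(2)] x(1)], intro ballI)
    fix z assume z: "z \<in> E"
    define t where "t = v * T"
    have "0 \<le> t" using v(1) \<open>0 \<le> B\<close> \<open>0 < \<eta>\<close> by (simp add: t_def T_def)
    then have "0 \<le> t * (a \<bullet> (z - x))"
      using a(2)[OF z] by (intro mult_nonneg_nonneg) (auto simp: inner_diff_right)
    then have "(norm (t *\<^sub>R a))\<^sup>2 \<le> (norm (t *\<^sub>R a + (z - x)))\<^sup>2"
    proof -
      have "(norm (t *\<^sub>R a + (z - x)))\<^sup>2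
          = (norm (t *\<^sub>R a))\<^sup>2 + 2 * ((t *\<^sub>R a) \<bullet> (z - x)) + (norm (z - x))\<^sup>2"
        unfolding power2_norm_eq_inner inner_add_left inner_add_right
        by (simp add: inner_commute)
      then show ?thesis
        using \<open>0 \<le> t * (a \<bullet> (z - x))\<close> by simp
    qed
    then have "norm (t *\<^sub>R a) \<le> norm (t *\<^sub>R a + (z - x))"
      by (simp add: power2_le_iff_abs_le)
    then show "dist (x - (v * T) *\<^sub>R a) x \<le> dist (x - (v * T) *\<^sub>R a) z"
      by (simp add: dist_norm t_def norm_minus_commute algebra_simps)
  qed
  ultimately show "x \<in> (\<lambda>y. closest_point E (p + (1 + \<eta>) *\<^sub>R (y - p))) ` frontier K"
    using y(2) by (intro image_eqI[of _ _ y]) auto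
qed

text \<open>\<open>F j x\<close> is the infimum of the densities of \<open>K n\<close>, n \<ge> j,
  over frontier points within 1 / (j + 1) of x. The limit of \<open>F j\<close> dominates the
  density of E by semicontinuity along a sequence of such points. Conversely, the projection f moves
  points of \<open>K n\<close> by less than 1 / (j + 1), so \<open>F j (f y)\<close> is at most the
  density of \<open>K n\<close> at y; this bounds the integral.\<close>

lemma sym_energy_lower_semicontinuous:
  fixes K :: "nat \<Rightarrow> (real^2) set"
  assumes "0 < s" and E: "convex E" "compact E" "interior E \<noteq> {}"
    and K: "\<And>n. convex (K n)" "\<And>n. compact (K n)" "\<And>n. K n \<noteq> {}"
    and upper: "\<And>r y y0. strict_mono r \<Longrightarrow> y \<longlonglongrightarrow> y0 \<Longrightarrow> y0 \<notin> E \<Longrightarrow> eventually (\<lambda>n. y n \<notin> K (r n)) sequentially"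
    and lower: "\<And>\<delta>. 0 < \<delta> \<Longrightarrow> eventually (\<lambda>n. \<forall>x\<in>E. infdist x (K n) < \<delta>) sequentially"
    and outer: "\<And>\<delta>. 0 < \<delta> \<Longrightarrow> eventually (\<lambda>n. \<forall>y\<in>K n. infdist y E < \<delta>) sequentially"
    and bound: "\<And>\<delta>. 0 < \<delta> \<Longrightarrow> eventually (\<lambda>n. sym_energy s (K n) \<le> ennreal (m + \<delta>)) sequentially"
    and "0 \<le> m"
  obtains G where "G \<in> borel_measurable borel"
    "\<And>x. x \<in> frontier E \<Longrightarrow> epow (1 / s) (sym_curv s E x) \<le> G x"
    "(\<integral>\<^sup>+x\<in>frontier E. G x \<partial>hausdorff1) \<le> ennreal m"
proof
  \<comment> \<open>Taking the infimum over balls instead of fibres of the projections makes \<open>F j\<close> upper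
    semicontinuous, hence measurable.\<close>
  define Q where "Q n y = epow (1 / s) (sym_curv s (K n) y)" for n y
  define I where "I j x = {(n, y). j \<le> n \<and> y \<in> frontier (K n) \<and> dist y x < 1 / (real j + 1)}"
    for j :: nat and x
  define F where "F j x = (INF (n, y)\<in>I j x. Q n y)" for j x
  define G where "G x = (SUP j. F j x)" for x
  have F_less: "F j x < t \<longleftrightarrow> (\<exists>n y. j \<le> n \<and> y \<in> frontier (K n) \<and> dist y x < 1 / (real j + 1) \<and> Q n y < t)"
    for j x t
    unfolding F_def INF_less_iff by (auto simp: I_def)
  have Fm: "F j \<in> borel_measurable borel" for j
  proof (rule borel_measurableI_less)
    fix t
    have "{x. F j x < t} = (\<Union>(n, y)\<in>{(n, y). j \<le> n \<and> y \<in> frontier (K n) \<and> Q n y < t}. ball y (1 / (real j + 1)))"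
      unfolding F_less by (auto simp: set_eq_iff)
    moreover have "open \<dots>" by (intro open_UN) auto
    ultimately show "{x \<in> space borel. F j x < t} \<in> sets borel" by simp
  qed
  have "I (Suc j) x \<subseteq> I j x" for j x
  proof -
    have "1 / (real (Suc j) + 1) \<le> 1 / (real j + 1)" by (simp add: field_simps)
    then show ?thesis unfolding I_def by auto
  qed
  then have incF: "incseq F"
    unfolding F_def by (intro incseq_SucI le_funI INF_superset_mono) auto
  show Gm: "G \<in> borel_measurable borel"
    unfolding G_def[abs_def] using Fm by measurable
  show "epow (1 / s) (sym_curv s E x) \<le> G x" if x: "x \<in> frontier E" for x
  proof (rule ccontr)
    assume "\<not> epow (1 / s) (sym_curv s E x) \<le> G x"
    then obtain t where t: "G x < t" "t < epow (1 / s) (sym_curv s E x)"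
      using dense not_le by metis
    have "F j x < t" for j
      using t(1) unfolding G_def by (meson SUP_upper UNIV_I le_less_trans)
    then have "\<forall>j. \<exists>n y. j \<le> n \<and> y \<in> frontier (K n) \<and> dist y x < 1 / (real j + 1) \<and> Q n y < t"
      unfolding F_less by blast
    then obtain N y where Ny: "\<And>j. j \<le> N j" "\<And>j. dist (y j) x < 1 / (real j + 1)" "\<And>j. Q (N j) (y j) < t"
      by metis
    \<comment> \<open>The indices satisfy only \<open>j \<le> N j\<close>; r thins them to a
      strictly increasing sequence, as \<open>upper\<close> demands.\<close>
    obtain r where r: "strict_mono (r :: nat \<Rightarrow> nat)" "strict_mono (N \<circ> r)"
    proof -
      define r where "r = rec_nat 0 (\<lambda>_ k. N k + 1)"
      have "N (r k) < r (Suc k)" for k by (simp add: r_def)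
      then have "r k < r (Suc k)" "N (r k) < N (r (Suc k))" for k
        using Ny(1) le_less_trans less_le_trans by blast+
      then show ?thesis
        using that[of r] by (simp add: strict_mono_Suc_iff)
    qed
    obtain c where c: "0 \<le> c" "t = ennreal c"
      using t(2) by (cases t) (auto simp: top_unique)
    have ylim: "y \<longlonglongrightarrow> x"
    proof (rule metric_tendsto_imp_tendsto[of "\<lambda>j. 1 / (real j + 1)" 0])
      show "(\<lambda>j. 1 / (real j + 1)) \<longlonglongrightarrow> 0"
        using LIMSEQ_inverse_real_of_nat by (simp add: inverse_eq_divide add.commute)
      show "eventually (\<lambda>j. dist (y j) x \<le> dist (1 / (real j + 1)) 0) sequentially"
        using Ny(2) by (intro always_eventually) (auto intro: less_imp_le)
    qed
    have "sym_curv s E x \<le> ennreal (c powr s)"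
    proof (rule sym_curv_lower_semicontinuous)
      show "(\<lambda>j. (y \<circ> r) j) \<longlonglongrightarrow> x"
        using LIMSEQ_subseq_LIMSEQ[OF ylim r(1)] by (simp add: comp_def)
      show "closed (K ((N \<circ> r) j))" for j using K(2) by (rule compact_imp_closed)
      show "eventually (\<lambda>n. y n \<notin> K ((N \<circ> r) n)) sequentially" if "y \<longlonglongrightarrow> y0" "y0 \<notin> E" for y y0
        using upper[OF r(2) that] .
      have "Q (N j) (y j) \<le> ennreal c" for j
        using Ny(3)[of j] c(2) by simp
      then show "sym_curv s (K ((N \<circ> r) j)) ((y \<circ> r) j) \<le> ennreal (c powr s)" for j
        using epow_le_iff[of "1 / s" c] \<open>0 < s\<close> c(1) unfolding Q_def by simp
    qed
    then have "epow (1 / s) (sym_curv s E x) \<le> ennreal c"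
      using epow_le_iff[of "1 / s" c] \<open>0 < s\<close> c(1) by simp
    then show False using t(2) c(2) by simp
  qed
  obtain p where pE: "p \<in> interior E" using E(3) by blast
  then obtain \<rho> where \<rho>: "0 < \<rho>" "cball p \<rho> \<subseteq> E"
    using mem_interior_cball by blast
  have "E \<noteq> {}" using E(3) interior_subset by blast
  obtain R where R: "0 \<le> R" "\<And>x. x \<in> E \<Longrightarrow> dist p x \<le> R"
    using compact_imp_bounded[OF E(2)] by (metis bounded_any_center zero_le_dist order_trans \<open>E \<noteq> {}\<close> ex_in_conv)
  have step: "(\<integral>\<^sup>+x\<in>frontier E. F j x \<partial>hausdorff1) \<le> ennreal ((1 + \<eta>) * (m + \<eta>))"
    if \<eta>: "0 < \<eta>" "\<eta> * (R + 1) < 1 / (2 * (real j + 1))" for \<eta> j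
  proof -
    \<comment> \<open>Half of the allowance 1 / (j + 1) goes to the distance from E, the other half
      to the dilation. The bound 1 keeps \<open>K n\<close> within distance R + 1 of p, whence the
      factor R + 1 in the condition on \<eta>.\<close>
    define \<delta> where "\<delta> = min 1 (1 / (2 * (real j + 1)))"
    have "0 < \<delta>" by (simp add: \<delta>_def)
    have "0 < \<eta> * \<rho> / (1 + \<eta>)" using \<eta>(1) \<rho>(1) by simp
    have "eventually (\<lambda>n. j \<le> n \<and> (\<forall>x\<in>E. infdist x (K n) < \<eta> * \<rho> / (1 + \<eta>)) \<and>
        (\<forall>y\<in>K n. infdist y E < \<delta>) \<and> sym_energy s (K n) \<le> ennreal (m + \<eta>)) sequentially"
      by (intro eventually_conj eventually_ge_at_top lower outer bound) fact+
    from eventually_happens'[OF sequentially_bot this]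
    obtain n where n: "j \<le> n" "\<And>x. x \<in> E \<Longrightarrow> infdist x (K n) < \<eta> * \<rho> / (1 + \<eta>)"
      "\<And>y. y \<in> K n \<Longrightarrow> infdist y E < \<delta>" "sym_energy s (K n) \<le> ennreal (m + \<eta>)"
      by blast
    define f where "f y = closest_point E (p + (1 + \<eta>) *\<^sub>R (y - p))" for y
    have lip1: "dist (closest_point E y) (closest_point E z) \<le> dist y z" for y z
      using E \<open>E \<noteq> {}\<close> by (intro closest_point_lipschitz) (auto simp: compact_imp_closed)
    have close: "dist (f y) y < 1 / (real j + 1)" if y: "y \<in> K n" for y
    proof -
      have cp: "dist (closest_point E y) y = infdist y E" "closest_point E y \<in> E"
        using setdist_closest_point[of E y] closest_point_in_set[of E y] E(2) \<open>E \<noteq> {}\<close>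
        by (simp_all add: infdist_eq_setdist compact_imp_closed dist_commute)
      have "dist p y \<le> R + \<delta>"
        using dist_triangle[of p y "closest_point E y"] cp R(2)[OF cp(2)] n(3)[OF y] by simp
      moreover have "\<delta> \<le> 1" unfolding \<delta>_def by (rule min.cobounded1)
      ultimately have py: "dist p y \<le> R + 1" by linarith
      have "dist (f y) (closest_point E y) \<le> dist (p + (1 + \<eta>) *\<^sub>R (y - p)) y"
        unfolding f_def by (rule lip1)
      also have "\<dots> = \<eta> * dist p y"
      proof -
        have "p + (1 + \<eta>) *\<^sub>R (y - p) - y = \<eta> *\<^sub>R (y - p)" by (simp add: algebra_simps)
        then show ?thesis using \<eta>(1) by (simp add: dist_norm norm_minus_commute)
      qed
      also have "\<dots> \<le> \<eta> * (R + 1)" using py \<eta>(1) by simp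
      finally have "dist (f y) (closest_point E y) < 1 / (2 * (real j + 1))" using \<eta>(2) by simp
      moreover have "dist (closest_point E y) y < 1 / (2 * (real j + 1))"
        using cp(1) n(3)[OF y] by (simp add: \<delta>_def)
      ultimately have "dist (f y) y < 1 / (2 * (real j + 1)) + 1 / (2 * (real j + 1))"
        using dist_triangle[of "f y" y "closest_point E y"] by linarith
      then show ?thesis by (simp add: field_simps)
    qed
    have sub: "frontier E \<subseteq> f ` frontier (K n)"
      unfolding f_def
      by (rule frontier_subset_retract[OF E(1,2) pE K(2) \<eta>(1)],
          rule shrunk_convex_subset[OF E(1) \<rho>(2) \<eta>(1) K(1) compact_imp_closed[OF K(2)] K(3) n(2)])
         (use \<rho> in auto)
    have "(\<integral>\<^sup>+x\<in>frontier E. F j x \<partial>hausdorff1)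
        \<le> ennreal (1 + \<eta>) * (\<integral>\<^sup>+y\<in>frontier (K n). F j (f y) \<partial>hausdorff1)"
    proof (rule nn_integral_lipschitz_transfer[OF _ _ _ _ _ sub Fm])
      show "continuous_on UNIV f"
        unfolding f_def
        by (intro continuous_on_compose2[OF continuous_on_closest_point[of E UNIV]] continuous_intros)
           (use E \<open>E \<noteq> {}\<close> in \<open>auto simp: compact_imp_closed\<close>)
      show "dist (f x) (f y) \<le> (1 + \<eta>) * dist x y" for x y
      proof -
        have "dist (f x) (f y) \<le> dist (p + (1 + \<eta>) *\<^sub>R (x - p)) (p + (1 + \<eta>) *\<^sub>R (y - p))"
          unfolding f_def by (rule lip1)
        also have "\<dots> = (1 + \<eta>) * dist x y"
          using \<eta>(1) by (simp add: dist_norm scaleR_diff_right[symmetric])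
        finally show ?thesis .
      qed
    qed (use \<eta>(1) in auto)
    also have "(\<integral>\<^sup>+y\<in>frontier (K n). F j (f y) \<partial>hausdorff1) \<le> sym_energy s (K n)"
      unfolding sym_energy_def
    proof (rule nn_integral_mono)
      fix y
      show "F j (f y) * indicator (frontier (K n)) y
          \<le> epow (1 / s) (sym_curv s (K n) y) * indicator (frontier (K n)) y"
      proof (cases "y \<in> frontier (K n)")
        case True
        then have "y \<in> K n" using K(2)[of n] by (auto simp: frontier_def compact_imp_closed)
        then have "(n, y) \<in> I j (f y)"
          using True n(1) close by (auto simp: I_def dist_commute)
        then have "F j (f y) \<le> Q n y"
          unfolding F_def by (rule INF_lower2) simp
        then show ?thesis using True by (simp add: Q_def)
      qed simp
    qed
    also have "\<dots> \<le> ennreal (m + \<eta>)" by (rule n(4))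
    also have "ennreal (1 + \<eta>) * ennreal (m + \<eta>) = ennreal ((1 + \<eta>) * (m + \<eta>))"
      using \<eta>(1) \<open>0 \<le> m\<close> by (simp add: ennreal_mult)
    finally show ?thesis by (simp add: mult_left_mono)
  qed
  have Fle: "(\<integral>\<^sup>+x\<in>frontier E. F j x \<partial>hausdorff1) \<le> ennreal m" for j
  proof (rule tendsto_lowerbound)
    have "((\<lambda>\<eta>. (1 + \<eta>) * (m + \<eta>)) \<longlongrightarrow> (1 + 0) * (m + 0)) (at_right 0)"
      by (intro tendsto_intros)
    then show "((\<lambda>\<eta>. ennreal ((1 + \<eta>) * (m + \<eta>))) \<longlongrightarrow> ennreal m) (at_right 0)"
      by (intro tendsto_ennrealI) simp
    have "eventually (\<lambda>\<eta>. \<eta> \<in> {0<..<1 / (2 * (real j + 1)) / (R + 1)}) (at_right 0)"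
      using R(1) by (intro eventually_at_rightI[of _ "1 / (2 * (real j + 1)) / (R + 1)"]) auto
    then show "eventually (\<lambda>\<eta>. (\<integral>\<^sup>+x\<in>frontier E. F j x \<partial>hausdorff1) \<le> ennreal ((1 + \<eta>) * (m + \<eta>))) (at_right 0)"
    proof eventually_elim
      case (elim \<eta>)
      then have "\<eta> * (R + 1) < 1 / (2 * (real j + 1))"
        using R(1) by (subst pos_less_divide_eq[symmetric]) auto
      then show ?case using elim by (intro step) auto
    qed
  qed simp
  have "(\<integral>\<^sup>+x\<in>frontier E. G x \<partial>hausdorff1)
      = (\<integral>\<^sup>+x. (SUP j. F j x * indicator (frontier E) x) \<partial>hausdorff1)"
    unfolding G_def by (simp add: SUP_mult_right_ennreal)
  also have "\<dots> = (SUP j. \<integral>\<^sup>+x\<in>frontier E. F j x \<partial>hausdorff1)"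
  proof (rule nn_integral_monotone_convergence_SUP)
    show "incseq (\<lambda>j x. F j x * indicator (frontier E) x)"
      using incF by (auto simp: incseq_def le_fun_def intro!: mult_right_mono)
    show "(\<lambda>x. F j x * indicator (frontier E) x) \<in> borel_measurable hausdorff1" for j
      by (intro borel_measurable_hausdorff1 borel_measurable_times_ennreal Fm borel_measurable_indicator) simp
  qed
  also have "\<dots> \<le> ennreal m" using Fle by (intro SUP_least)
  finally show "(\<integral>\<^sup>+x\<in>frontier E. G x \<partial>hausdorff1) \<le> ennreal m" .
qed

section \<open>Blaschke selection\<close>

lemma infdist_convex_combination:
  fixes K :: "'a::euclidean_space set"
  assumes K: "convex K" "closed K" "K \<noteq> {}" and uv: "0 \<le> u" "0 \<le> v" "u + v = 1"
  shows "infdist (u *\<^sub>R x + v *\<^sub>R y) K \<le> u * infdist x K + v * infdist y K"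
proof -
  obtain a b where ab: "a \<in> K" "infdist x K = dist x a" "b \<in> K" "infdist y K = dist y b"
    using infdist_attains_inf[OF K(2,3)] by metis
  have "infdist (u *\<^sub>R x + v *\<^sub>R y) K \<le> dist (u *\<^sub>R x + v *\<^sub>R y) (u *\<^sub>R a + v *\<^sub>R b)"
    using ab uv by (intro infdist_le convexD[OF K(1)])
  also have "\<dots> = norm (u *\<^sub>R (x - a) + v *\<^sub>R (y - b))"
    by (simp add: dist_norm algebra_simps)
  also have "\<dots> \<le> u * infdist x K + v * infdist y K"
    using norm_triangle_ineq[of "u *\<^sub>R (x - a)" "v *\<^sub>R (y - b)"] uv ab by (simp add: dist_norm)
  finally show ?thesis .
qed

text \<open>The distance functions of the sets are 1-Lipschitz and bounded by 2 on the unit ball, so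
  Arzela-Ascoli gives a uniformly convergent subsequence. The limit set is where the limit function
  vanishes.\<close>

lemma blaschke_selection:
  fixes K :: "nat \<Rightarrow> 'a::euclidean_space set"
  assumes K: "\<And>n. convex (K n)" "\<And>n. closed (K n)" "\<And>n. K n \<noteq> {}" "\<And>n. K n \<subseteq> cball 0 1"
  obtains r E where "strict_mono (r :: nat \<Rightarrow> nat)" "convex E" "compact E"
    "\<And>q y y0. strict_mono q \<Longrightarrow> y \<longlonglongrightarrow> y0 \<Longrightarrow> y0 \<notin> E \<Longrightarrow> eventually (\<lambda>n. y n \<notin> K (r (q n))) sequentially"
    "\<And>\<delta>. 0 < \<delta> \<Longrightarrow> eventually (\<lambda>n. \<forall>x\<in>E. infdist x (K (r n)) < \<delta>) sequentially"
    "\<And>\<delta>. 0 < \<delta> \<Longrightarrow> eventually (\<lambda>n. \<forall>y\<in>K (r n). infdist y E < \<delta>) sequentially"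
proof -
  let ?S = "cball (0::'a) 1"
  have lip: "\<bar>infdist x (K n) - infdist y (K n)\<bar> \<le> dist x y" for x y n
    using infdist_triangle[of x "K n" y] infdist_triangle[of y "K n" x] by (auto simp: dist_commute)
  obtain g r where g: "continuous_on ?S g" "strict_mono (r :: nat \<Rightarrow> nat)"
    "\<And>e. 0 < e \<Longrightarrow> \<exists>N. \<forall>n x. n \<ge> N \<and> x \<in> ?S \<longrightarrow> norm (infdist x (K (r n)) - g x) < e"
  proof (rule Arzela_Ascoli[of ?S "\<lambda>n x. infdist x (K n)" 2])
    show "norm (infdist x (K n)) \<le> 2" if "x \<in> ?S" for n x
    proof -
      obtain a where "a \<in> K n" using K(3) by blast
      then have "infdist x (K n) \<le> dist x a" "a \<in> ?S" using subsetD[OF K(4)] by (auto intro: infdist_le)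
      moreover have "dist x a \<le> norm x + norm a" unfolding dist_norm by (rule norm_triangle_ineq4)
      ultimately show ?thesis using that infdist_nonneg[of x "K n"] by simp
    qed
    show "\<exists>d>0. \<forall>n y. y \<in> ?S \<and> norm (x - y) < d \<longrightarrow> norm (infdist x (K n) - infdist y (K n)) < e"
      if "0 < e" for x e
      using that lip by (intro exI[of _ e]) (auto simp: dist_norm intro: le_less_trans)
  qed auto
  have conv: "(\<lambda>n. infdist x (K (r n))) \<longlonglongrightarrow> g x" if "x \<in> ?S" for x
    unfolding LIMSEQ_iff using g(3) that by meson
  \<comment> \<open>The limit g is nonnegative on the ball, so this is its zero set; as a sublevel
    set of a convex continuous function it is visibly convex and closed.\<close>
  define E where "E = {x \<in> ?S. g x \<le> 0}"
  have "convex E"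
  proof (rule convexI)
    fix x y and u v :: real
    assume xy: "x \<in> E" "y \<in> E" and uv: "0 \<le> u" "0 \<le> v" "u + v = 1"
    have S: "u *\<^sub>R x + v *\<^sub>R y \<in> ?S"
      using xy uv by (intro convexD[OF convex_cball]) (auto simp: E_def)
    have "g (u *\<^sub>R x + v *\<^sub>R y) \<le> u * g x + v * g y"
    proof (rule LIMSEQ_le[OF conv[OF S]])
      show "(\<lambda>n. u * infdist x (K (r n)) + v * infdist y (K (r n))) \<longlonglongrightarrow> u * g x + v * g y"
        using xy by (intro tendsto_intros conv) (auto simp: E_def)
      show "\<exists>N. \<forall>n\<ge>N. infdist (u *\<^sub>R x + v *\<^sub>R y) (K (r n)) \<le> u * infdist x (K (r n)) + v * infdist y (K (r n))"
        using infdist_convex_combination[OF K(1-3) uv] by blast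
    qed
    also have "\<dots> \<le> 0" using xy uv by (auto simp: E_def intro!: add_nonpos_nonpos mult_nonneg_nonpos)
    finally show "u *\<^sub>R x + v *\<^sub>R y \<in> E" using S by (simp add: E_def)
  qed
  moreover have "compact E"
  proof -
    have "closed E"
      unfolding E_def using continuous_closed_preimage[OF g(1) closed_cball, of "{..0}"]
      by (simp add: vimage_def Int_def)
    moreover have "bounded E" by (rule bounded_subset[OF bounded_cball[of 0 1]]) (auto simp: E_def)
    ultimately show ?thesis by (simp add: compact_eq_bounded_closed)
  qed
  moreover have upper: "eventually (\<lambda>n. y n \<notin> K (r (q n))) sequentially"
    if q: "strict_mono q" and y: "y \<longlonglongrightarrow> y0" and y0: "y0 \<notin> E" for q :: "nat \<Rightarrow> nat" and y y0
  proof (rule ccontr)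
    assume "\<not> ?thesis"
    then have "\<exists>\<^sub>F n in sequentially. y n \<in> K (r (q n))"
      by (simp add: frequently_def)
    then have "infinite {n. y n \<in> K (r (q n))}"
      by (metis cofinite_eq_sequentially frequently_cofinite)
    from infinite_enumerate[OF this]
    obtain h where h: "strict_mono (h :: nat \<Rightarrow> nat)" "\<And>n. y (h n) \<in> K (r (q (h n)))"
      unfolding mem_Collect_eq by blast
    have yh: "(\<lambda>n. y (h n)) \<longlonglongrightarrow> y0"
      using LIMSEQ_subseq_LIMSEQ[OF y h(1)] by (simp add: comp_def)
    have S: "y0 \<in> ?S"
      by (rule closed_sequentially[OF closed_cball _ yh]) (use h K(4) in blast)
    have "strict_mono (q \<circ> h)" using q h(1) by (rule strict_mono_o)
    then have "(\<lambda>n. infdist y0 (K (r (q (h n))))) \<longlonglongrightarrow> g y0"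
      using LIMSEQ_subseq_LIMSEQ[OF conv[OF S]] by (fastforce simp: comp_def)
    moreover have "(\<lambda>n. dist y0 (y (h n))) \<longlonglongrightarrow> 0"
      using tendsto_dist[OF tendsto_const[of y0] yh] by simp
    ultimately have "g y0 \<le> 0"
      by (rule LIMSEQ_le) (use h(2) in \<open>auto intro: infdist_le\<close>)
    then show False using y0 S by (simp add: E_def)
  qed
  moreover have "eventually (\<lambda>n. \<forall>x\<in>E. infdist x (K (r n)) < \<delta>) sequentially" if "0 < \<delta>" for \<delta>
  proof -
    obtain N where "\<forall>n x. n \<ge> N \<and> x \<in> ?S \<longrightarrow> norm (infdist x (K (r n)) - g x) < \<delta>"
      using g(3)[OF \<open>0 < \<delta>\<close>] by blast
    then show ?thesis unfolding eventually_sequentially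
      by (intro exI[of _ N]) (fastforce simp: E_def)
  qed
  moreover have "eventually (\<lambda>n. \<forall>y\<in>K (r n). infdist y E < \<delta>) sequentially" if "0 < \<delta>" for \<delta>
  proof (rule ccontr)
    assume "\<not> ?thesis"
    then have "\<exists>\<^sub>F n in sequentially. \<exists>y\<in>K (r n). \<delta> \<le> infdist y E"
      by (simp add: frequently_def not_less not_le)
    then have "infinite {n. \<exists>y\<in>K (r n). \<delta> \<le> infdist y E}"
      by (metis (no_types, lifting) cofinite_eq_sequentially frequently_cofinite)
    from infinite_enumerate[OF this]
    obtain h where h: "strict_mono (h :: nat \<Rightarrow> nat)" "\<And>n. \<exists>y\<in>K (r (h n)). \<delta> \<le> infdist y E"
      unfolding mem_Collect_eq by blast
    then obtain y where y: "\<And>n. y n \<in> K (r (h n))" "\<And>n. \<delta> \<le> infdist (y n) E" by metis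
    have "\<forall>n. y n \<in> ?S" using y(1) K(4) by blast
    then obtain y0 k where k: "strict_mono (k :: nat \<Rightarrow> nat)" "(y \<circ> k) \<longlonglongrightarrow> y0"
      using compact_cball unfolding compact_def by (metis (no_types, lifting))
    have "strict_mono (h \<circ> k)" using h(1) k(1) by (rule strict_mono_o)
    have "y0 \<in> E"
    proof (rule ccontr)
      assume "y0 \<notin> E"
      from upper[OF \<open>strict_mono (h \<circ> k)\<close> k(2) this] show False
        using y(1) by (simp add: eventually_False)
    qed
    then have "(\<lambda>n. infdist ((y \<circ> k) n) E) \<longlonglongrightarrow> infdist y0 E"
      using k(2) by (intro tendsto_infdist)
    then have "\<delta> \<le> infdist y0 E"
      by (rule LIMSEQ_le_const) (use y(2) in auto)
    then show False using \<open>y0 \<in> E\<close> that by simp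
  qed
  ultimately show thesis using that[OF g(2)] by blast
qed

subsection \<open>Corners and regularity\<close>

lemma orthonormal_expansion:
  fixes u v w :: "real^2"
  assumes "norm u = 1" "norm v = 1" "u \<bullet> v = 0"
  shows "w = (w \<bullet> u) *\<^sub>R u + (w \<bullet> v) *\<^sub>R v"
proof -
  have uv: "u \<bullet> u = 1" "v \<bullet> v = 1" "v \<bullet> u = 0"
    using assms by (auto simp: dot_square_norm inner_commute)
  have ne: "u \<noteq> v" "u \<noteq> 0" "v \<noteq> 0" using uv assms by auto
  have ind: "independent {u, v}"
    using ne assms(3) by (intro pairwise_orthogonal_independent) (auto simp: pairwise_def orthogonal_def inner_commute)
  have "dim {u, v} = 2"
    using dim_eq_card_independent[OF ind] ne by simp
  then have span: "span {u, v} = UNIV"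
    using dim_eq_full[of "{u, v}"] by simp
  define r where "r = w - ((w \<bullet> u) *\<^sub>R u + (w \<bullet> v) *\<^sub>R v)"
  have "orthogonal r r"
  proof (rule orthogonal_to_span[of r "{u, v}"])
    show "r \<in> span {u, v}" by (simp add: span)
    show "orthogonal r y" if "y \<in> {u, v}" for y
      using that uv assms(3) by (auto simp: orthogonal_def r_def inner_diff_left inner_add_left inner_diff_right
          inner_add_right inner_commute)
  qed
  then have "r = 0" by (simp add: orthogonal_def)
  then show ?thesis by (simp add: r_def)
qed

lemma sym_curv_ge_corner:
  fixes E :: "(real^2) set"
  assumes "0 < s" and E: "interior E \<noteq> {}" and ab: "norm a = 1" "norm b = 1" "a \<noteq> b"
    and a: "\<And>y. y \<in> E \<Longrightarrow> a \<bullet> (y - x0) \<le> 0" and b: "\<And>y. y \<in> E \<Longrightarrow> b \<bullet> (y - x0) \<le> 0"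
  obtains c e where "0 < c" "norm e = 1"
    "\<And>y. y \<in> E \<Longrightarrow> e \<bullet> (y - x0) \<le> 0"
    "\<And>x. x \<in> E \<Longrightarrow> x \<noteq> x0 \<Longrightarrow> ennreal (c * norm (x - x0) powr (- s)) \<le> sym_curv s E x"
proof -
  \<comment> \<open>The orthogonal vectors \<open>a + b\<close> and \<open>a - b\<close> are the axis of the supporting cone at \<open>x0\<close> and its
    normal; a point of \<open>E\<close> at distance \<open>r\<close> from \<open>x0\<close> stays outside the cone when moved along the
    latter in either direction by a large multiple of \<open>r\<close>.\<close>
  define m d where "m = a + b" and "d = a - b"
  have "d \<noteq> 0" using ab by (simp add: d_def)
  have "m \<noteq> 0"
  proof
    assume "m = 0"
    then have "b = - a" by (simp add: m_def add_eq_0_iff)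
    then have "E \<subseteq> {y. a \<bullet> y = a \<bullet> x0}"
      using a b by (force simp: inner_diff_right)
    moreover have "interior {y. a \<bullet> y = a \<bullet> x0} = {}"
      using ab by (intro interior_hyperplane) auto
    ultimately show False using E interior_mono by blast
  qed
  define e g where "e = m /\<^sub>R norm m" and "g = d /\<^sub>R norm d"
  have md: "m \<bullet> d = 0"
    using ab by (simp add: m_def d_def inner_add_left inner_add_right inner_diff_left inner_diff_right
      inner_commute dot_square_norm)
  have eg: "norm e = 1" "norm g = 1" "e \<bullet> g = 0"
    using \<open>m \<noteq> 0\<close> \<open>d \<noteq> 0\<close> md by (auto simp: e_def g_def)
  \<comment> \<open>Opening constant of the cone: the two support conditions say |d \<bullet> w|
    \<le> -(m \<bullet> w), which bounds the component of w along g, and hence |w|, by a multiple of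
    -(e \<bullet> w).\<close>
  define \<kappa> where "\<kappa> = norm d / (norm m + norm d)"
  have \<kappa>: "0 < \<kappa>" using \<open>m \<noteq> 0\<close> \<open>d \<noteq> 0\<close> by (simp add: \<kappa>_def add_pos_pos)
  have cone: "\<kappa> * norm w \<le> - (e \<bullet> w)" if "a \<bullet> w \<le> 0" "b \<bullet> w \<le> 0" for w
  proof -
    have dm: "\<bar>d \<bullet> w\<bar> \<le> - (m \<bullet> w)"
      using that by (auto simp: m_def d_def inner_add_left inner_diff_left)
    have em: "m \<bullet> w = norm m * (e \<bullet> w)" "d \<bullet> w = norm d * (g \<bullet> w)"
      using \<open>m \<noteq> 0\<close> \<open>d \<noteq> 0\<close> by (auto simp: e_def g_def)
    have "norm w \<le> \<bar>e \<bullet> w\<bar> + \<bar>g \<bullet> w\<bar>"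
      using norm_triangle_ineq[of "(w \<bullet> e) *\<^sub>R e" "(w \<bullet> g) *\<^sub>R g"] eg
      by (subst orthonormal_expansion[OF eg, of w]) (simp add: inner_commute)
    then have "norm d * norm w \<le> norm d * (\<bar>e \<bullet> w\<bar> + \<bar>g \<bullet> w\<bar>)"
      by (rule mult_left_mono) simp
    also have "\<dots> = norm d * \<bar>e \<bullet> w\<bar> + \<bar>d \<bullet> w\<bar>"
      unfolding em(2) by (simp add: abs_mult distrib_left)
    also have "\<dots> \<le> norm d * \<bar>e \<bullet> w\<bar> - norm m * (e \<bullet> w)"
      using dm em(1) by simp
    also have "\<dots> = (norm m + norm d) * - (e \<bullet> w)"
    proof -
      have "norm m * (e \<bullet> w) \<le> 0" using dm em(1) by linarith
      then have "e \<bullet> w \<le> 0" using \<open>m \<noteq> 0\<close> by (simp add: mult_le_0_iff)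
      then show ?thesis by (simp add: algebra_simps)
    qed
    finally have "norm d * norm w / (norm m + norm d) \<le> - (e \<bullet> w)"
      using \<open>m \<noteq> 0\<close> by (subst pos_divide_le_eq) (auto simp: mult.commute add_pos_nonneg)
    then show ?thesis by (simp add: \<kappa>_def)
  qed
  define c where "c = pi / (3 + 3 / \<kappa>) powr (2 + s)"
  show thesis
  proof
    have "0 < 3 + 3 / \<kappa>" using \<kappa> by (simp add: add_pos_pos)
    then show "0 < c" by (simp add: c_def)
    show "norm e = 1" by (rule eg)
    show "e \<bullet> (y - x0) \<le> 0" if "y \<in> E" for y
      using cone[OF a[OF that] b[OF that]] \<kappa> by (smt (verit) mult_nonneg_nonneg norm_ge_zero)
    show "ennreal (c * norm (x - x0) powr (- s)) \<le> sym_curv s E x" if x: "x \<in> E" "x \<noteq> x0" for x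
    proof -
      define r where "r = norm (x - x0)"
      have "0 < r" using x by (simp add: r_def)
      \<comment> \<open>Chosen so that \<kappa> (t - 2 r) = 3 r: a displaced point has distance more
        than t - 2 r from x0 and would need depth more than 3 r in the cone, but its e-coordinate is
        below 2 r in absolute value. Since t + r = r (3 + 3 / \<kappa>), this also explains the
        constant c.\<close>
      define t where "t = r * (2 + 3 / \<kappa>)"
      have "0 < t" using \<open>0 < r\<close> \<kappa> by (simp add: t_def add_pos_pos)
      have out: "x0 + (w + z) \<notin> E" if z: "norm (z - t *\<^sub>R g) < r \<or> norm (z + t *\<^sub>R g) < r" and w: "w = x - x0" for z w
      proof
        assume "x0 + (w + z) \<in> E"
        then have le: "\<kappa> * norm (w + z) \<le> - (e \<bullet> (w + z))"
          using cone a[of "x0 + (w + z)"] b[of "x0 + (w + z)"] by simp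
        obtain \<sigma> where \<sigma>: "norm (z - (\<sigma> * t) *\<^sub>R g) < r" "\<bar>\<sigma>\<bar> = 1"
          using z by (metis abs_1 abs_minus_cancel diff_minus_eq_add mult_1 mult_minus_left scaleR_minus_left)
        have "\<bar>e \<bullet> (z - (\<sigma> * t) *\<^sub>R g)\<bar> \<le> norm (z - (\<sigma> * t) *\<^sub>R g)"
          using Cauchy_Schwarz_ineq2[of e "z - (\<sigma> * t) *\<^sub>R g"] eg by simp
        then have ez: "\<bar>e \<bullet> z\<bar> < r" using \<sigma> eg by (simp add: inner_diff_right)
        have ew: "\<bar>e \<bullet> w\<bar> \<le> r"
          using Cauchy_Schwarz_ineq2[of e w] eg w by (simp add: r_def)
        have "norm ((\<sigma> * t) *\<^sub>R g) = t" using \<sigma> eg \<open>0 < t\<close> by (simp add: abs_mult)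
        moreover have "norm ((\<sigma> * t) *\<^sub>R g) \<le> norm (w + z) + norm w + norm (z - (\<sigma> * t) *\<^sub>R g)"
        proof -
          have "norm ((w + z) - w - (z - (\<sigma> * t) *\<^sub>R g))
              \<le> norm (w + z) + norm w + norm (z - (\<sigma> * t) *\<^sub>R g)"
            using norm_triangle_ineq4[of "(w + z) - w" "z - (\<sigma> * t) *\<^sub>R g"]
              norm_triangle_ineq4[of "w + z" w] by linarith
          then show ?thesis by simp
        qed
        ultimately have "t - 2 * r < norm (w + z)"
          using \<sigma>(1) w by (simp add: r_def)
        then have "\<kappa> * (t - 2 * r) < \<kappa> * norm (w + z)" using \<kappa> by simp
        moreover have "\<kappa> * (t - 2 * r) = 3 * r" using \<kappa> by (simp add: t_def field_simps)
        ultimately show False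
          using le ez ew \<open>0 < r\<close> by (simp add: inner_add_right)
      qed
      have "ennreal (pi * r\<^sup>2 / (norm (t *\<^sub>R g) + r) powr (2 + s)) \<le> sym_curv s E x"
      proof (rule sym_curv_ge_ball[OF \<open>0 < r\<close> _ \<open>0 < s\<close>])
        show "r \<le> norm (t *\<^sub>R g)"
          using eg \<open>0 < t\<close> \<open>0 < r\<close> \<kappa> by (simp add: t_def distrib_left)
        fix z assume "z \<in> ball (t *\<^sub>R g) r"
        then have "norm (z - t *\<^sub>R g) < r" "norm (- z + t *\<^sub>R g) < r"
          by (auto simp: dist_norm norm_minus_commute)
        then show "x + z \<notin> E \<and> x - z \<notin> E"
          using out[of z "x - x0"] out[of "- z" "x - x0"] by simp
      qed
      moreover have "pi * r\<^sup>2 / (norm (t *\<^sub>R g) + r) powr (2 + s) = c * r powr (- s)"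
      proof -
        have "norm (t *\<^sub>R g) = t" using eg \<open>0 < t\<close> by simp
        then have "norm (t *\<^sub>R g) + r = r * (3 + 3 / \<kappa>)"
          by (simp add: t_def algebra_simps)
        moreover have "(r * (3 + 3 / \<kappa>)) powr (2 + s) = (r\<^sup>2 * r powr s) * (3 + 3 / \<kappa>) powr (2 + s)"
          using \<open>0 < r\<close> \<kappa> by (simp add: powr_mult powr_add)
        ultimately show ?thesis
          using \<open>0 < r\<close> by (simp add: c_def powr_minus field_simps)
      qed
      ultimately show ?thesis by (simp add: r_def)
    qed
  qed
qed

lemma nn_integral_inverse_diverges:
  assumes "0 < r0" "0 < C"
  shows "(\<integral>\<^sup>+t\<in>{0<..r0}. ennreal (C / t) \<partial>lborel) = top"
proof (rule ccontr)
  assume "\<not> ?thesis"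
  then obtain M where M: "0 \<le> M" "(\<integral>\<^sup>+t\<in>{0<..r0}. ennreal (C / t) \<partial>lborel) = ennreal M"
    by (metis ennreal_cases)
  \<comment> \<open>The cut-off at which the integral of C / t from \<epsilon> to r0 equals M +
    1.\<close>
  define \<epsilon> where "\<epsilon> = r0 * exp (- (M + 1) / C)"
  have "- (M + 1) / C < 0" using M(1) assms by (intro divide_neg_pos) auto
  then have "exp (- (M + 1) / C) < 1" by simp
  then have \<epsilon>: "0 < \<epsilon>" "\<epsilon> < r0" using assms by (auto simp: \<epsilon>_def)
  have "ln \<epsilon> = ln r0 - (M + 1) / C"
    using assms by (simp add: \<epsilon>_def ln_mult minus_divide_left)
  then have val: "C * ln r0 - C * ln \<epsilon> = M + 1"
    using assms by (simp add: right_diff_distrib)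
  have "(\<integral>\<^sup>+t. ennreal (C / t) * indicator {\<epsilon>..r0} t \<partial>lborel) = ennreal (C * ln r0 - C * ln \<epsilon>)"
  proof (rule nn_integral_FTC_Icc)
    show "((\<lambda>t. C * ln t) has_real_derivative C / t) (at t)" if "t \<in> {\<epsilon>..r0}" for t
      using that \<epsilon> by (auto intro!: derivative_eq_intros simp: field_simps)
  qed (use \<epsilon> assms in auto)
  moreover have "(\<integral>\<^sup>+t. ennreal (C / t) * indicator {\<epsilon>..r0} t \<partial>lborel)
      \<le> (\<integral>\<^sup>+t\<in>{0<..r0}. ennreal (C / t) \<partial>lborel)"
    using \<epsilon> by (intro nn_integral_mono) (auto split: split_indicator)
  ultimately show False using M val by simp
qed

text \<open>The distance to the corner is 1-Lipschitz and maps the frontier onto an interval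
  starting at 0: each small circle around x0 contains a point of E, towards q, and a point outside,
  in direction e. The density is at least C divided by this distance.\<close>

lemma corner_energy_infinite:
  fixes E :: "(real^2) set"
  assumes "0 < s" and E: "convex E" "compact E" "interior E \<noteq> {}" and x0: "x0 \<in> E"
    and ab: "norm a = 1" "norm b = 1" "a \<noteq> b"
    and a: "\<And>y. y \<in> E \<Longrightarrow> a \<bullet> (y - x0) \<le> 0" and b: "\<And>y. y \<in> E \<Longrightarrow> b \<bullet> (y - x0) \<le> 0"
    and G: "\<And>x. x \<in> frontier E \<Longrightarrow> epow (1 / s) (sym_curv s E x) \<le> G x"
  shows "(\<integral>\<^sup>+x\<in>frontier E. G x \<partial>hausdorff1) = top"
proof -
  obtain c e where ce: "0 < c" "norm e = 1" "\<And>y. y \<in> E \<Longrightarrow> e \<bullet> (y - x0) \<le> 0"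
    "\<And>x. x \<in> E \<Longrightarrow> x \<noteq> x0 \<Longrightarrow> ennreal (c * norm (x - x0) powr (- s)) \<le> sym_curv s E x"
    using sym_curv_ge_corner[OF assms(1) E(3) ab a b] by blast
  define C where "C = c powr (1 / s)"
  have "0 < C" using ce by (simp add: C_def)
  obtain q where q: "q \<in> E" "q \<noteq> x0"
    using E(3) interior_mono[of E "{x0}"] by auto
  define r0 where "r0 = norm (q - x0)"
  have "0 < r0" using q by (simp add: r0_def)
  have onto: "{0<..r0} \<subseteq> (\<lambda>x. norm (x - x0)) ` frontier E"
  proof
    fix t assume t: "t \<in> {0<..r0}"
    define y where "y = x0 + (t / r0) *\<^sub>R (q - x0)"
    have "y = (1 - t / r0) *\<^sub>R x0 + (t / r0) *\<^sub>R q" by (simp add: y_def algebra_simps)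
    then have "y \<in> E"
      using t \<open>0 < r0\<close> x0 q by (auto intro!: convexD_alt[OF E(1)])
    moreover have "y \<in> sphere x0 t"
      using t \<open>0 < r0\<close> by (simp add: y_def dist_norm r0_def[symmetric])
    moreover have "x0 + t *\<^sub>R e \<in> sphere x0 t - E"
      using t ce(2) ce(3)[of "x0 + t *\<^sub>R e"] by (auto simp: dist_norm dot_square_norm)
    moreover have "connected (sphere x0 t)" by (rule connected_sphere) simp
    ultimately obtain x where "x \<in> sphere x0 t" "x \<in> frontier E"
      using connected_Int_frontier[of "sphere x0 t" E] by blast
    then show "t \<in> (\<lambda>x. norm (x - x0)) ` frontier E"
      by (auto simp: dist_norm norm_minus_commute)
  qed
  have "top = (\<integral>\<^sup>+t\<in>{0<..r0}. ennreal (C / t) \<partial>lborel)"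
    using nn_integral_inverse_diverges[OF \<open>0 < r0\<close> \<open>0 < C\<close>] by simp
  also have "\<dots> \<le> ennreal 1 * (\<integral>\<^sup>+x\<in>frontier E. ennreal (C / norm (x - x0)) \<partial>hausdorff1)"
  proof (rule nn_integral_lborel_lipschitz_transfer[OF _ _ _ _ _ onto])
    show "dist (norm (x - x0)) (norm (y - x0)) \<le> 1 * dist x y" for x y
      using norm_triangle_ineq3[of "x - x0" "y - x0"] by (simp add: dist_norm)
  qed (auto intro!: continuous_intros)
  also have "\<dots> \<le> (\<integral>\<^sup>+x\<in>frontier E. G x \<partial>hausdorff1)"
  proof (simp, rule nn_integral_mono)
    fix x
    show "ennreal (C / norm (x - x0)) * indicator (frontier E) x \<le> G x * indicator (frontier E) x"
    \<comment> \<open>At x0 the lower bound reads C / 0 = 0, so the corner itself costs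
      nothing.\<close>
    proof (cases "x \<in> frontier E \<and> x \<noteq> x0")
      case True
      then have "x \<in> E" using E(2) by (auto simp: frontier_def compact_imp_closed)
      have "C / norm (x - x0) = (c * norm (x - x0) powr (- s)) powr (1 / s)"
      proof -
        have "(norm (x - x0) powr (- s)) powr (1 / s) = 1 / norm (x - x0)"
          using \<open>0 < s\<close> True by (simp only: powr_powr) (simp add: powr_minus_divide)
        then show ?thesis using ce(1) by (subst powr_mult) (auto simp: C_def)
      qed
      then have "ennreal (C / norm (x - x0)) = epow (1 / s) (ennreal (c * norm (x - x0) powr (- s)))"
        using ce(1) by (simp add: epow_ennreal)
      also have "\<dots> \<le> epow (1 / s) (sym_curv s E x)"
        using True \<open>x \<in> E\<close> \<open>0 < s\<close> by (intro epow_mono ce(4)) auto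
      also have "\<dots> \<le> G x" using G True by blast
      finally show ?thesis using True by simp
    qed (auto split: split_indicator)
  qed
  finally show ?thesis by (simp add: top_unique)
qed

section \<open>From unique supporting lines to a C1 boundary\<close>

text \<open>Existence of subgradients expresses convexity, uniqueness differentiability. The slope m
  is monotone, hence bounded on the compact half-size interval; a limit of subgradients is a
  subgradient, so uniqueness closes the graph of m, and a closed graph with compact range gives
  continuity.\<close>

lemma C1_extension_of_unique_subgradients:
  fixes f :: "real \<Rightarrow> real"
  assumes "0 < \<rho>"
    and ex: "\<And>t. \<bar>t - t0\<bar> < \<rho> \<Longrightarrow> \<exists>!m. \<forall>t'. \<bar>t' - t0\<bar> < \<rho> \<longrightarrow> f t + m * (t' - t) \<le> f t'"
  obtains \<gamma> where "\<gamma> C1_differentiable_on UNIV" "\<And>t. \<bar>t - t0\<bar> \<le> \<rho> / 2 \<Longrightarrow> \<gamma> t = f t"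
proof -
  define I where "I = {t. \<bar>t - t0\<bar> < \<rho>}"
  define m where "m t = (THE m. \<forall>t'. \<bar>t' - t0\<bar> < \<rho> \<longrightarrow> f t + m * (t' - t) \<le> f t')" for t
  have sub: "f t + m t * (t' - t) \<le> f t'" if "t \<in> I" "t' \<in> I" for t t'
    using theI'[OF ex[of t]] that unfolding m_def I_def by simp
  have uniq: "\<mu> = m t" if "t \<in> I" "\<And>t'. t' \<in> I \<Longrightarrow> f t + \<mu> * (t' - t) \<le> f t'" for t \<mu>
    using ex[of t] sub[OF that(1)] that unfolding I_def by blast
  have mono: "m t \<le> m t'" if "t \<in> I" "t' \<in> I" "t \<le> t'" for t t'
  proof (cases "t = t'")
    case False
    have "m t * (t' - t) \<le> m t' * (t' - t)"
      using sub[OF that(1,2)] sub[OF that(2,1)] by (simp add: algebra_simps)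
    then show ?thesis using False that(3) by simp
  qed simp
  define \<alpha> \<beta> where "\<alpha> = t0 - \<rho> / 2" and "\<beta> = t0 + \<rho> / 2"
  have \<alpha>\<beta>: "\<alpha> < \<beta>" "\<alpha> \<in> I" "\<beta> \<in> I" "{\<alpha>..\<beta>} \<subseteq> I"
    using \<open>0 < \<rho>\<close> by (auto simp: \<alpha>_def \<beta>_def I_def abs_less_iff)
  define T where "T = {m \<alpha>..m \<beta>}"
  have mT: "m t \<in> T" if "t \<in> {\<alpha>..\<beta>}" for t
    using that \<alpha>\<beta> mono by (auto simp: T_def)
  obtain B where B: "\<And>t. t \<in> {\<alpha>..\<beta>} \<Longrightarrow> \<bar>m t\<bar> \<le> B"
    using mT by (metis T_def bounded_closed_interval bounded_iff real_norm_def)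
  have flip: "\<bar>f t - f t'\<bar> \<le> B * \<bar>t - t'\<bar>" if "t \<in> {\<alpha>..\<beta>}" "t' \<in> {\<alpha>..\<beta>}" for t t'
  proof -
    have "\<bar>m t * (t' - t)\<bar> \<le> B * \<bar>t - t'\<bar>" "\<bar>m t' * (t - t')\<bar> \<le> B * \<bar>t - t'\<bar>"
      unfolding abs_mult using B[OF that(1)] B[OF that(2)]
      by (auto simp: abs_minus_commute intro: mult_right_mono)
    then show ?thesis
      using sub[of t t'] sub[of t' t] that \<alpha>\<beta>(4) by (smt (verit) subsetD)
  qed
  have fcont: "continuous_on {\<alpha>..\<beta>} f"
  proof (rule lipschitz_on_continuous_on)
    show "\<bar>B\<bar>-lipschitz_on {\<alpha>..\<beta>} f"
    proof (rule lipschitz_onI)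
      fix x y assume "x \<in> {\<alpha>..\<beta>}" "y \<in> {\<alpha>..\<beta>}"
      then have "\<bar>f x - f y\<bar> \<le> B * \<bar>x - y\<bar>" by (rule flip)
      also have "\<dots> \<le> \<bar>B\<bar> * \<bar>x - y\<bar>" by (intro mult_right_mono) auto
      finally show "dist (f x) (f y) \<le> \<bar>B\<bar> * dist x y" by (simp add: dist_real_def)
    qed simp
  qed
  have mcont: "continuous_on {\<alpha>..\<beta>} m"
  proof (rule continuous_from_closed_graph)
    show "compact T" by (simp add: T_def)
    show "m \<in> {\<alpha>..\<beta>} \<rightarrow> T" using mT by auto
    show "closed ((\<lambda>x. (x, m x)) ` {\<alpha>..\<beta>})"
      unfolding closed_sequential_limits
    proof (intro allI impI, elim conjE)
      fix P l assume P: "\<forall>n. P n \<in> (\<lambda>x. (x, m x)) ` {\<alpha>..\<beta>}" and lim: "P \<longlonglongrightarrow> l"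
      have Pn: "fst (P n) \<in> {\<alpha>..\<beta>}" "snd (P n) = m (fst (P n))" for n
        using P[rule_format, of n] by auto
      have lims: "(\<lambda>n. fst (P n)) \<longlonglongrightarrow> fst l" "(\<lambda>n. snd (P n)) \<longlonglongrightarrow> snd l"
        using lim by (auto intro: tendsto_fst tendsto_snd)
      have l: "fst l \<in> {\<alpha>..\<beta>}"
        by (rule closed_sequentially[OF closed_atLeastAtMost _ lims(1)]) (use Pn in auto)
      have flim: "(\<lambda>n. f (fst (P n))) \<longlonglongrightarrow> f (fst l)"
        by (rule continuous_on_tendsto_compose[OF fcont lims(1) l]) (use Pn in auto)
      have "snd l = m (fst l)"
      proof (rule uniq)
        show "fst l \<in> I" using l \<alpha>\<beta>(4) by blast
        fix t' assume t': "t' \<in> I"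
        show "f (fst l) + snd l * (t' - fst l) \<le> f t'"
        proof (rule LIMSEQ_le_const2)
          show "(\<lambda>n. f (fst (P n)) + snd (P n) * (t' - fst (P n))) \<longlonglongrightarrow> f (fst l) + snd l * (t' - fst l)"
            by (intro tendsto_intros flim lims)
          show "\<exists>N. \<forall>n\<ge>N. f (fst (P n)) + snd (P n) * (t' - fst (P n)) \<le> f t'"
            using Pn sub t' \<alpha>\<beta>(4) by (metis subsetD)
        qed
      qed
      then show "l \<in> (\<lambda>x. (x, m x)) ` {\<alpha>..\<beta>}"
        using l by (cases l) auto
    qed
  qed
  have fder: "(f has_vector_derivative m t) (at t within {\<alpha>..\<beta>})" if t: "t \<in> {\<alpha>..\<beta>}" for t
    unfolding has_real_derivative_iff_has_vector_derivative[symmetric] has_field_derivative_iff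
  proof (rule Lim_null_comparison[where g = "\<lambda>y. \<bar>m y - m t\<bar>", THEN LIM_zero_cancel])
    have "((\<lambda>y. m y) \<longlongrightarrow> m t) (at t within {\<alpha>..\<beta>})"
      using mcont t by (simp add: continuous_on_def)
    then show "((\<lambda>y. \<bar>m y - m t\<bar>) \<longlongrightarrow> 0) (at t within {\<alpha>..\<beta>})"
      by (intro tendsto_rabs_zero) (rule LIM_zero)
    \<comment> \<open>The subgradient inequalities at t and at y trap the difference quotient
      between m t and m y.\<close>
    show "\<forall>\<^sub>F y in at t within {\<alpha>..\<beta>}. norm ((f y - f t) / (y - t) - m t) \<le> \<bar>m y - m t\<bar>"
      unfolding eventually_at
    proof (intro exI[of _ 1] conjI ballI impI)
      fix y assume y: "y \<in> {\<alpha>..\<beta>}" "y \<noteq> t \<and> dist y t < 1"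
      have s1: "f t + m t * (y - t) \<le> f y" "f y + m y * (t - y) \<le> f t"
        using sub[of t y] sub[of y t] y t \<alpha>\<beta>(4) by blast+
      have "\<bar>f y - f t - m t * (y - t)\<bar> \<le> (m y - m t) * (y - t)"
        using s1 by (simp add: abs_le_iff algebra_simps)
      also have "\<dots> \<le> \<bar>m y - m t\<bar> * \<bar>y - t\<bar>"
        by (metis abs_ge_self abs_mult)
      finally have "\<bar>f y - f t - m t * (y - t)\<bar> / \<bar>y - t\<bar> \<le> \<bar>m y - m t\<bar>"
        using y by (subst pos_divide_le_eq) auto
      moreover have "(f y - f t) / (y - t) - m t = (f y - f t - m t * (y - t)) / (y - t)"
        using y by (simp add: field_simps)
      ultimately show "norm ((f y - f t) / (y - t) - m t) \<le> \<bar>m y - m t\<bar>"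
        by (simp add: abs_divide)
    qed simp
  qed
  \<comment> \<open>Clamping extends the slope continuously by constants; an antiderivative on the
    whole line then agrees with f on the interval up to the constant k.\<close>
  define D where "D t = m (max \<alpha> (min \<beta> t))" for t
  have Dcont: "continuous_on UNIV D"
    unfolding D_def
    by (rule continuous_on_compose2[OF mcont]) (use \<alpha>\<beta>(1) in \<open>auto intro!: continuous_intros\<close>)
  obtain \<Gamma> where \<Gamma>: "\<And>t. (\<Gamma> has_vector_derivative D t) (at t)"
    using einterval_antiderivative[of "-\<infinity>" "\<infinity>" D] Dcont
    by (auto simp: continuous_on_eq_continuous_at)
  obtain k where k: "\<And>t. t \<in> {\<alpha>..\<beta>} \<Longrightarrow> f t - \<Gamma> t = k"
  proof (rule has_vector_derivative_zero_constant[of "{\<alpha>..\<beta>}" "\<lambda>t. f t - \<Gamma> t"])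
    fix t assume t: "t \<in> {\<alpha>..\<beta>}"
    then have "D t = m t" by (simp add: D_def)
    then show "((\<lambda>t. f t - \<Gamma> t) has_vector_derivative 0) (at t within {\<alpha>..\<beta>})"
      using has_vector_derivative_diff[OF fder[OF t] has_vector_derivative_at_within[OF \<Gamma>]] by simp
  qed auto
  show thesis
  proof
    show "(\<lambda>t. \<Gamma> t + k) C1_differentiable_on UNIV"
      unfolding C1_differentiable_on_def
      using Dcont has_vector_derivative_add[OF \<Gamma> has_vector_derivative_const] by auto
    fix t assume "\<bar>t - t0\<bar> \<le> \<rho> / 2"
    then have "t \<in> {\<alpha>..\<beta>}" unfolding \<alpha>_def \<beta>_def atLeastAtMost_iff by linarith
    then show "\<Gamma> t + k = f t" using k[of t] by simp
  qed
qed

text \<open>In coordinates whose second axis points from x0 to an interior point p, the lower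
  boundary of E below a ball around p is the graph of a convex f. A subgradient m of f yields the
  outer normal m u - v of a supporting line of E, so \<open>uniq\<close> makes subgradients
  unique.\<close>

lemma C1_boundary_of_unique_support:
  fixes E :: "(real^2) set"
  assumes E: "convex E" "compact E" "interior E \<noteq> {}"
    and uniq: "\<And>x a b. x \<in> frontier E \<Longrightarrow> norm a = 1 \<Longrightarrow> norm b = 1 \<Longrightarrow>
      (\<And>y. y \<in> E \<Longrightarrow> a \<bullet> (y - x) \<le> 0) \<Longrightarrow> (\<And>y. y \<in> E \<Longrightarrow> b \<bullet> (y - x) \<le> 0) \<Longrightarrow> a = b"
  shows "C1_boundary E"
  unfolding C1_boundary_def
proof
  fix x0 assume x0: "x0 \<in> frontier E"
  have cl: "closed E" using E(2) by (rule compact_imp_closed)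
  have fr: "y \<in> frontier E \<longleftrightarrow> y \<in> E \<and> y \<notin> interior E" for y
    using cl by (simp add: frontier_def)
  obtain p where p: "p \<in> interior E" using E(3) by blast
  then obtain \<rho> where \<rho>: "0 < \<rho>" "ball p \<rho> \<subseteq> E"
    using mem_interior by blast
  then have ball_int: "ball p \<rho> \<subseteq> interior E" by (simp add: interior_maximal)
  define L where "L = norm (p - x0)"
  have "p \<noteq> x0" using p x0 fr by blast
  then have L: "0 < L" by (simp add: L_def)
  define v where "v = (p - x0) /\<^sub>R L"
  have v: "norm v = 1" using L by (simp add: v_def L_def[symmetric])
  obtain u where u: "norm u = 1" "u \<bullet> v = 0"
  proof -
    obtain w where w: "w \<noteq> 0" "orthogonal v w"
      using orthogonal_to_vector_exists[of v] by auto
    show thesis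
      by (rule that[of "w /\<^sub>R norm w"]) (use w in \<open>auto simp: orthogonal_def inner_commute\<close>)
  qed
  have uv: "u \<bullet> u = 1" "v \<bullet> v = 1" "v \<bullet> u = 0"
    using u v by (auto simp: dot_square_norm inner_commute)
  define pt where "pt t \<tau> = t *\<^sub>R u + \<tau> *\<^sub>R v" for t \<tau> :: real
  have ptuv: "pt t \<tau> \<bullet> u = t" "pt t \<tau> \<bullet> v = \<tau>" for t \<tau>
    using uv u by (auto simp: pt_def inner_add_left)
  have expand: "y = pt (y \<bullet> u) (y \<bullet> v)" for y
    unfolding pt_def by (rule orthonormal_expansion[OF u(1) v u(2)])
  define t0 h where "t0 = p \<bullet> u" and "h = p \<bullet> v"
  have px0: "p = x0 + L *\<^sub>R v" using L by (simp add: v_def)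
  have x0t: "x0 \<bullet> u = t0" "x0 \<bullet> v = h - L"
    using uv u by (simp_all add: t0_def h_def px0 inner_add_left)
  define I where "I = {t. \<bar>t - t0\<bar> < \<rho>}"
  have top_int: "pt t h \<in> interior E" if "t \<in> I" for t
  proof -
    have "p - pt t h = (t0 - t) *\<^sub>R u"
      using expand[of p] by (simp add: pt_def t0_def h_def algebra_simps)
    then have "dist p (pt t h) = \<bar>t - t0\<bar>" using u by (simp add: dist_norm abs_minus_commute)
    then show ?thesis using ball_int that by (auto simp: I_def)
  qed
  define A where "A t = {\<tau>. pt t \<tau> \<in> E}" for t
  define f where "f t = Inf (A t)" for t
  have Acl: "closed (A t)" for t
  proof -
    have "continuous_on UNIV (pt t)" unfolding pt_def by (intro continuous_intros)
    then have "closed (pt t -` E)" using cl by (rule closed_vimage[rotated])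
    then show ?thesis by (simp add: A_def vimage_def)
  qed
  obtain B where B: "\<And>y. y \<in> E \<Longrightarrow> norm y \<le> B"
    using compact_imp_bounded[OF E(2)] by (auto simp: bounded_iff)
  have Abd: "bdd_below (A t)" for t
  proof (rule bdd_belowI)
    fix \<tau> assume "\<tau> \<in> A t"
    then have "norm (pt t \<tau>) \<le> B" using B by (simp add: A_def)
    moreover have "\<bar>pt t \<tau> \<bullet> v\<bar> \<le> norm (pt t \<tau>)"
      using Cauchy_Schwarz_ineq2[of "pt t \<tau>" v] v by simp
    ultimately show "- B \<le> \<tau>" using ptuv by simp
  qed
  have fA: "pt t (f t) \<in> E" if "t \<in> I" for t
  proof -
    have "h \<in> A t" using top_int[OF that] interior_subset by (auto simp: A_def)
    then have "f t \<in> A t" unfolding f_def using Acl Abd by (intro closed_contains_Inf) auto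
    then show ?thesis by (simp add: A_def)
  qed
  have fle: "f t \<le> \<tau>" if "pt t \<tau> \<in> E" for t \<tau>
    unfolding f_def using that Abd by (intro cInf_lower) (auto simp: A_def)
  have nbelow: "pt t \<tau> \<notin> interior E" if "pt t \<tau> \<in> E" "\<tau> \<le> f t" for t \<tau>
  proof
    assume "pt t \<tau> \<in> interior E"
    then obtain e where e: "0 < e" "cball (pt t \<tau>) e \<subseteq> E" using mem_interior_cball by blast
    have "pt t \<tau> - pt t (\<tau> - e) = e *\<^sub>R v" by (simp add: pt_def algebra_simps)
    then have "pt t (\<tau> - e) \<in> E" using e v by (auto simp: dist_norm subset_iff)
    then show False using fle[of t "\<tau> - e"] that e(1) by simp
  qed
  have fh: "f t < h" if "t \<in> I" for t
    using nbelow[of t h] top_int[OF that] interior_subset by (meson not_le subsetD)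
  have above: "pt t \<tau> \<in> interior E" if "t \<in> I" "f t < \<tau>" "\<tau> < h" for t \<tau>
  proof -
    define \<theta> where "\<theta> = (h - \<tau>) / (h - f t)"
    have \<theta>: "0 < \<theta>" "\<theta> < 1" using that by (auto simp: \<theta>_def divide_simps)
    have "\<theta> * (h - f t) = h - \<tau>" using that by (simp add: \<theta>_def)
    then have "pt t \<tau> = (1 - \<theta>) *\<^sub>R pt t h + \<theta> *\<^sub>R pt t (f t)"
    proof -
      have "(1 - \<theta>) *\<^sub>R pt t h + \<theta> *\<^sub>R pt t (f t) = t *\<^sub>R u + (h - \<theta> * (h - f t)) *\<^sub>R v"
        by (simp add: pt_def algebra_simps)
      then show ?thesis by (simp add: \<open>\<theta> * (h - f t) = h - \<tau>\<close> pt_def)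
    qed
    moreover have "pt t h \<noteq> pt t (f t)"
      using fh[OF that(1)] ptuv(2) by (metis less_irrefl)
    ultimately have "pt t \<tau> \<in> open_segment (pt t h) (pt t (f t))"
      using \<theta> by (auto simp: in_segment)
    then show ?thesis
      using in_interior_closure_convex_segment[OF E(1) top_int[OF that(1)], of "pt t (f t)"]
        fA[OF that(1)] closure_subset by blast
  qed
  have front: "pt t (f t) \<in> frontier E" if "t \<in> I" for t
    using fr fA[OF that] nbelow by blast
  have subgrad_ex: "\<exists>m. \<forall>t'\<in>I. f t + m * (t' - t) \<le> f t'" if t: "t \<in> I" for t
  proof -
    have "pt t (f t) \<notin> rel_interior E"
      using front[OF t] fr rel_interior_nonempty_interior[OF E(3)] by simp
    then obtain a where a: "\<And>y. y \<in> E \<Longrightarrow> a \<bullet> pt t (f t) \<le> a \<bullet> y"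
      "\<And>y. y \<in> interior E \<Longrightarrow> a \<bullet> pt t (f t) < a \<bullet> y"
      using supporting_hyperplane_rel_boundary[OF E(1) fA[OF t]] rel_interior_nonempty_interior[OF E(3)]
      by metis
    have ap: "a \<bullet> pt s \<tau> = s * (a \<bullet> u) + \<tau> * (a \<bullet> v)" for s \<tau>
      by (simp add: pt_def inner_add_right)
    have "0 < (h - f t) * (a \<bullet> v)"
      using a(2)[OF top_int[OF t]] by (simp add: ap algebra_simps)
    then have av: "0 < a \<bullet> v" using fh[OF t] by (simp add: zero_less_mult_iff)
    have "f t + (- (a \<bullet> u) / (a \<bullet> v)) * (t' - t) \<le> f t'" if "t' \<in> I" for t'
      using a(1)[OF fA[OF that]] av by (simp add: ap field_simps)
    then show ?thesis by blast
  qed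
  have subgrad_support: "(m *\<^sub>R u - v) \<bullet> (y - pt t (f t)) \<le> 0"
    if t: "t \<in> I" and m: "\<And>t'. t' \<in> I \<Longrightarrow> f t + m * (t' - t) \<le> f t'" and y: "y \<in> E" for t m y
  proof -
    define k where "k = y \<bullet> u - t"
    \<comment> \<open>The subgradient inequality is known only over I, while y may lie anywhere in
      E. A short step from the graph point towards y stays over I, and convexity scales the
      inequality back up.\<close>
    define \<theta> where "\<theta> = min 1 ((\<rho> - \<bar>t - t0\<bar>) / (2 * (\<bar>k\<bar> + 1)))"
    have pos: "0 < \<rho> - \<bar>t - t0\<bar>" using t by (simp add: I_def)
    have \<theta>: "0 < \<theta>" "\<theta> \<le> 1" using pos by (auto simp: \<theta>_def)
    have "\<theta> * \<bar>k\<bar> \<le> (\<rho> - \<bar>t - t0\<bar>) / (2 * (\<bar>k\<bar> + 1)) * (\<bar>k\<bar> + 1)"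
      using \<theta> by (intro mult_mono) (auto simp: \<theta>_def)
    also have "\<dots> = (\<rho> - \<bar>t - t0\<bar>) / 2"
    proof -
      have "d / (2 * j) * j = d / 2" if "0 < j" for d j :: real
        using that by (simp add: field_simps)
      from this[of "\<bar>k\<bar> + 1"] show ?thesis by simp
    qed
    finally have "\<bar>\<theta> * k\<bar> < \<rho> - \<bar>t - t0\<bar>" using pos \<theta> by (simp add: abs_mult)
    then have I: "t + \<theta> * k \<in> I" by (simp add: I_def abs_less_iff) linarith
    have "(1 - \<theta>) *\<^sub>R pt t (f t) + \<theta> *\<^sub>R y \<in> E"
      using \<theta> y fA[OF t] by (intro convexD_alt[OF E(1)]) auto
    moreover have "(1 - \<theta>) *\<^sub>R pt t (f t) + \<theta> *\<^sub>R y = pt (t + \<theta> * k) ((1 - \<theta>) * f t + \<theta> * (y \<bullet> v))"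
      by (subst expand[of y]) (simp add: pt_def k_def algebra_simps)
    ultimately have "f (t + \<theta> * k) \<le> (1 - \<theta>) * f t + \<theta> * (y \<bullet> v)"
      using fle by metis
    then have "\<theta> * (m * k) \<le> \<theta> * (y \<bullet> v - f t)"
      using m[OF I] by (simp add: algebra_simps)
    then have "m * k \<le> y \<bullet> v - f t" using \<theta>(1) by simp
    then show ?thesis
      using ptuv uv u by (simp add: k_def inner_diff_right inner_diff_left inner_commute algebra_simps)
  qed
  have subgrad_uniq: "m = m'" if t: "t \<in> I" and m: "\<forall>t'\<in>I. f t + m * (t' - t) \<le> f t'"
    and m': "\<forall>t'\<in>I. f t + m' * (t' - t) \<le> f t'" for t m m'
  proof -
    define n where "n k = (k *\<^sub>R u - v) /\<^sub>R norm (k *\<^sub>R u - v)" for k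
    have ne: "k *\<^sub>R u - v \<noteq> 0" for k
      using uv by (metis eq_iff_diff_eq_0 inner_scaleR_left mult_zero_right u(2) zero_neq_one)
    have "n m = n m'"
    proof (rule uniq[OF front[OF t]])
      show "norm (n m) = 1" "norm (n m') = 1" using ne by (auto simp: n_def)
      show "n m \<bullet> (y - pt t (f t)) \<le> 0" if "y \<in> E" for y
        using subgrad_support[OF t _ that, of m] m ne[of m]
        by (simp add: n_def mult_nonneg_nonpos)
      show "n m' \<bullet> (y - pt t (f t)) \<le> 0" if "y \<in> E" for y
        using subgrad_support[OF t _ that, of m'] m' ne[of m']
        by (simp add: n_def mult_nonneg_nonpos)
    qed
    \<comment> \<open>\<open>uniq\<close> compares unit normals. Equal v-components give equal norms
      before normalization, and then the u-components give equal slopes.\<close>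
    have nv: "n k \<bullet> v = - (1 / norm (k *\<^sub>R u - v))" and nu: "n k \<bullet> u = k / norm (k *\<^sub>R u - v)" for k
    proof -
      have "(k *\<^sub>R u - v) \<bullet> v = - 1" "(k *\<^sub>R u - v) \<bullet> u = k"
        using uv u(2) by (simp_all add: inner_diff_left)
      then show "n k \<bullet> v = - (1 / norm (k *\<^sub>R u - v))" "n k \<bullet> u = k / norm (k *\<^sub>R u - v)"
        unfolding n_def inner_scaleR_left by (simp_all add: divide_inverse)
    qed
    have "1 / norm (m *\<^sub>R u - v) = 1 / norm (m' *\<^sub>R u - v)"
      using nv[of m] nv[of m'] unfolding \<open>n m = n m'\<close> by linarith
    then have N: "norm (m *\<^sub>R u - v) = norm (m' *\<^sub>R u - v)"
      by (metis divide_cancel_left zero_neq_one)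
    have "m / norm (m' *\<^sub>R u - v) = m' / norm (m' *\<^sub>R u - v)"
      using nu[of m] nu[of m'] unfolding \<open>n m = n m'\<close> N by (rule trans[OF sym])
    moreover have "norm (m' *\<^sub>R u - v) \<noteq> 0"
      using ne[of m'] unfolding norm_eq_zero .
    ultimately show "m = m'"
      by (simp only: divide_cancel_right) blast
  qed
  have unique_subgrad: "\<exists>!m. \<forall>t'. \<bar>t' - t0\<bar> < \<rho> \<longrightarrow> f t + m * (t' - t) \<le> f t'" if "\<bar>t - t0\<bar> < \<rho>" for t
    using subgrad_ex[of t] subgrad_uniq[of t] that unfolding I_def by blast
  obtain \<gamma> where \<gamma>: "\<gamma> C1_differentiable_on UNIV" "\<And>t. \<bar>t - t0\<bar> \<le> \<rho> / 2 \<Longrightarrow> \<gamma> t = f t"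
    using C1_extension_of_unique_subgradients[OF \<rho>(1) unique_subgrad] by blast
  \<comment> \<open>The bound \<rho> / 2 stays where \<gamma> agrees with f; the bound L stays below
    the height h of p, so that only the lower boundary is seen.\<close>
  define r where "r = min (\<rho> / 2) L"
  have key: "y \<bullet> u \<in> I \<and> \<gamma> (y \<bullet> u) = f (y \<bullet> u) \<and> y \<bullet> v < h" if "y \<in> ball x0 r" for y
  proof -
    have d: "norm (y - x0) < r" using that by (simp add: dist_norm norm_minus_commute)
    have "\<bar>(y - x0) \<bullet> u\<bar> \<le> norm (y - x0)" "\<bar>(y - x0) \<bullet> v\<bar> \<le> norm (y - x0)"
      using Cauchy_Schwarz_ineq2[of "y - x0" u] Cauchy_Schwarz_ineq2[of "y - x0" v] u v by auto
    then have "\<bar>y \<bullet> u - t0\<bar> < \<rho> / 2" "\<bar>y \<bullet> v - (h - L)\<bar> < L"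
      using d by (auto simp: r_def inner_diff_left x0t)
    then show ?thesis using \<gamma>(2) \<rho>(1) by (auto simp: I_def)
  qed
  have f1: "y \<in> frontier E \<longleftrightarrow> y \<bullet> v = \<gamma> (y \<bullet> u)" and f2: "y \<in> interior E \<longleftrightarrow> \<gamma> (y \<bullet> u) < y \<bullet> v"
    if y: "y \<in> ball x0 r" for y
  proof -
    have k: "y \<bullet> u \<in> I" "\<gamma> (y \<bullet> u) = f (y \<bullet> u)" "y \<bullet> v < h" using key[OF y] by auto
    show "y \<in> interior E \<longleftrightarrow> \<gamma> (y \<bullet> u) < y \<bullet> v"
      using above[OF k(1) _ k(3)] nbelow[of "y \<bullet> u" "y \<bullet> v"] interior_subset[of E] expand[of y] k(2)
      by (metis not_le subsetD)
    then show "y \<in> frontier E \<longleftrightarrow> y \<bullet> v = \<gamma> (y \<bullet> u)"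
      using fr[of y] fle[of "y \<bullet> u" "y \<bullet> v"] expand[of y] k(2) fA[OF k(1)] nbelow[of "y \<bullet> u" "y \<bullet> v"]
      by (metis antisym_conv3 leD order_refl)
  qed
  show "\<exists>r>0. \<exists>u v. \<exists>\<gamma> :: real \<Rightarrow> real. norm u = 1 \<and> norm v = 1 \<and> u \<bullet> v = 0 \<and> \<gamma> C1_differentiable_on UNIV \<and>
      frontier E \<inter> ball x0 r = {y \<in> ball x0 r. y \<bullet> v = \<gamma> (y \<bullet> u)} \<and>
      interior E \<inter> ball x0 r = {y \<in> ball x0 r. y \<bullet> v > \<gamma> (y \<bullet> u)}"
  proof (intro exI conjI)
    show "0 < r" using \<rho>(1) L by (simp add: r_def)
    show "norm u = 1" "norm v = 1" "u \<bullet> v = 0" "\<gamma> C1_differentiable_on UNIV"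
      using u v \<gamma>(1) by auto
    show "frontier E \<inter> ball x0 r = {y \<in> ball x0 r. y \<bullet> v = \<gamma> (y \<bullet> u)}"
      using f1 by blast
    show "interior E \<inter> ball x0 r = {y \<in> ball x0 r. y \<bullet> v > \<gamma> (y \<bullet> u)}"
      using f2 by blast
  qed
qed

lemma C1_convex_bodiesI:
  fixes E :: "(real^2) set"
  assumes "0 < s" and E: "convex E" "compact E" "interior E \<noteq> {}"
    and G: "\<And>x. x \<in> frontier E \<Longrightarrow> epow (1 / s) (sym_curv s E x) \<le> G x"
      "(\<integral>\<^sup>+x\<in>frontier E. G x \<partial>hausdorff1) < top"
  shows "E \<in> C1_convex_bodies"
proof -
  have "C1_boundary E"
  proof (rule C1_boundary_of_unique_support[OF E], rule ccontr)
    fix x a b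
    assume "x \<in> frontier E" and ab: "norm a = 1" "norm b = 1" "a \<noteq> b"
      and sup: "\<And>y. y \<in> E \<Longrightarrow> a \<bullet> (y - x) \<le> 0" "\<And>y. y \<in> E \<Longrightarrow> b \<bullet> (y - x) \<le> 0"
    then have "x \<in> E" using E(2) by (auto simp: frontier_def compact_imp_closed)
    then have "(\<integral>\<^sup>+x\<in>frontier E. G x \<partial>hausdorff1) = top"
      using corner_energy_infinite[OF assms(1) E _ ab sup G(1)] by blast
    then show False using G(2) by simp
  qed
  then show ?thesis
    using E compact_imp_bounded by (auto simp: C1_convex_bodies_def)
qed

text \<open>Testing the support condition at y = a, a point of the disc, gives |a - x|^2 = 2 a
  \<bullet> (a - x) \<le> 0. The disc shows that the class is nonempty.\<close>

lemma disc_in_C1_convex_bodies: "cball 0 1 \<in> C1_convex_bodies"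
proof -
  have "C1_boundary (cball 0 1)"
  proof (rule C1_boundary_of_unique_support)
    fix x a b :: "real^2"
    assume x: "x \<in> frontier (cball 0 1)" and ab: "norm a = 1" "norm b = 1"
      and sup: "\<And>y. y \<in> cball 0 1 \<Longrightarrow> a \<bullet> (y - x) \<le> 0" "\<And>y. y \<in> cball 0 1 \<Longrightarrow> b \<bullet> (y - x) \<le> 0"
    have "norm x = 1" using x by (simp add: frontier_cball)
    have "c = x" if "norm c = 1" "c \<bullet> (c - x) \<le> 0" for c
    proof -
      have "c \<bullet> c = 1" "x \<bullet> x = 1"
        using that(1) \<open>norm x = 1\<close> by (simp_all add: dot_square_norm)
      then have "(norm (c - x))\<^sup>2 = 2 * (c \<bullet> (c - x))"
        by (simp add: power2_norm_eq_inner inner_diff_left inner_diff_right inner_commute)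
      then have "(norm (c - x))\<^sup>2 \<le> 0" using that(2) by simp
      then show ?thesis by simp
    qed
    then show "a = b" using ab sup(1)[of a] sup(2)[of b] by auto
  qed auto
  then show ?thesis by (simp add: C1_convex_bodies_def)
qed

subsection \<open>Existence of a minimizer\<close>

lemma exists_minimizer:
  assumes "0 < s" and fin: "\<exists>F\<in>C1_convex_bodies. nonlocal_energy s (1 / s) F < top"
  shows "\<exists>E\<in>C1_convex_bodies. \<forall>F\<in>C1_convex_bodies.
           nonlocal_energy s (1 / s) E \<le> nonlocal_energy s (1 / s) F"
proof -
  define M where "M = (INF F\<in>C1_convex_bodies. nonlocal_energy s (1 / s) F)"
  have "M < top" using fin unfolding M_def INF_less_iff .
  then obtain m where m: "0 \<le> m" "M = ennreal m" by (cases M) auto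
  have "\<exists>F\<in>C1_convex_bodies. nonlocal_energy s (1 / s) F < ennreal (m + 1 / (real n + 1))" for n
  proof -
    have "M < ennreal (m + 1 / (real n + 1))" using m by (simp add: ennreal_lessI add_nonneg_pos)
    then show ?thesis unfolding M_def INF_less_iff .
  qed
  then obtain F where F: "\<And>n. F n \<in> C1_convex_bodies"
    "\<And>n. nonlocal_energy s (1 / s) (F n) < ennreal (m + 1 / (real n + 1))"
    by metis
  have "\<exists>K. convex K \<and> compact K \<and> K \<noteq> {} \<and> K \<subseteq> cball 0 1 \<and> (\<exists>P\<in>K. \<exists>Q\<in>K. dist P Q = 1) \<and>
      sym_energy s K \<le> ennreal (m + 1 / (real n + 1))" for n
  proof -
    let ?C = "closure (F n)"
    have Fn: "convex (F n)" "bounded (F n)" "interior (F n) \<noteq> {}"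
      using F(1)[of n] by (auto simp: C1_convex_bodies_def)
    have C: "convex ?C" "compact ?C" "?C \<noteq> {}"
      using Fn by (auto simp: convex_closure compact_closure)
    obtain P Q where PQ: "P \<in> ?C" "Q \<in> ?C" "dist P Q = diameter ?C"
      using diameter_compact_attained[OF C(2,3)] by blast
    have "P \<noteq> Q"
    proof
      assume "P = Q"
      then have "diameter ?C = 0" using PQ(3) by simp
      have "x = P" if "x \<in> ?C" for x
        using diameter_bounded_bound[OF compact_imp_bounded[OF C(2)] that PQ(1)] \<open>diameter ?C = 0\<close> by simp
      then have "F n \<subseteq> {P}" using closure_subset by blast
      then show False using Fn(3) interior_mono[of "F n" "{P}"] by auto
    qed
    then have d: "0 < diameter ?C" using PQ(3) by (metis zero_less_dist_iff)
    define c where "c = 1 / diameter ?C"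
    have c: "0 < c" "c * diameter ?C = 1" using d by (auto simp: c_def)
    \<comment> \<open>One endpoint of a diameter is sent to the origin, so the rescaled body of
      diameter 1 lies in the unit ball and still contains two points at distance 1.\<close>
    let ?f = "\<lambda>y. c *\<^sub>R (y - P)"
    have dist_f: "dist (?f x) (?f y) = c * dist x y" for x y
      using c(1) by (simp add: dist_norm scaleR_diff_right[symmetric])
    have im: "?f ` ?C = (\<lambda>y. c *\<^sub>R y) ` ((\<lambda>y. y - P) ` ?C)"
      by (simp add: image_image)
    show ?thesis
    proof (intro exI[of _ "?f ` ?C"] conjI)
      show "convex (?f ` ?C)"
        unfolding im using C(1) by (intro convex_scaling convex_translation_subtract)
      show "compact (?f ` ?C)"
        using C(2) by (intro compact_continuous_image continuous_intros)
      show "?f ` ?C \<noteq> {}" using C(3) by blast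
      show "?f ` ?C \<subseteq> cball 0 1"
      proof
        fix y assume "y \<in> ?f ` ?C"
        then obtain x where x: "x \<in> ?C" "y = ?f x" by blast
        have "norm y = c * dist x P" using x c(1) by (simp add: dist_norm)
        also have "\<dots> \<le> c * diameter ?C"
          using c(1) x PQ(1) C(2) by (intro mult_left_mono diameter_bounded_bound) (auto intro: compact_imp_bounded)
        finally show "y \<in> cball 0 1" using c(2) by simp
      qed
      show "\<exists>P\<in>?f ` ?C. \<exists>Q\<in>?f ` ?C. dist P Q = 1"
        using PQ c(2) by (intro bexI[of _ "?f P"] bexI[of _ "?f Q"] imageI) (auto simp only: dist_f)
      have "sym_energy s (?f ` ?C) \<le> sym_energy s ?C"
        using c(1) assms(1) by (intro sym_energy_scale_le) auto
      also have "\<dots> = nonlocal_energy s (1 / s) (F n)"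
        using F(2)[of n] by (intro nonlocal_energy_finite_imp[symmetric] assms(1) Fn) (auto intro: less_trans)
      also have "\<dots> \<le> ennreal (m + 1 / (real n + 1))" using F(2)[of n] by simp
      finally show "sym_energy s (?f ` ?C) \<le> ennreal (m + 1 / (real n + 1))" .
    qed
  qed
  then obtain K where K: "\<And>n. convex (K n)" "\<And>n. compact (K n)" "\<And>n. K n \<noteq> {}" "\<And>n. K n \<subseteq> cball 0 1"
    "\<And>n. \<exists>P\<in>K n. \<exists>Q\<in>K n. dist P Q = 1" "\<And>n. sym_energy s (K n) \<le> ennreal (m + 1 / (real n + 1))"
    by metis
  show ?thesis
  proof (rule blaschke_selection[OF K(1) compact_imp_closed[OF K(2)] K(3,4)])
    fix r E
    assume r: "strict_mono r" and E: "convex E" "compact E"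
      and upper: "\<And>q y y0. strict_mono q \<Longrightarrow> y \<longlonglongrightarrow> y0 \<Longrightarrow> y0 \<notin> E \<Longrightarrow> eventually (\<lambda>n. y n \<notin> K (r (q n))) sequentially"
      and lower: "\<And>\<delta>. 0 < \<delta> \<Longrightarrow> eventually (\<lambda>n. \<forall>x\<in>E. infdist x (K (r n)) < \<delta>) sequentially"
      and outer: "\<And>\<delta>. 0 < \<delta> \<Longrightarrow> eventually (\<lambda>n. \<forall>y\<in>K (r n). infdist y E < \<delta>) sequentially"
    \<comment> \<open>Were E empty, \<open>upper\<close> would apply to every limit point, but
      points chosen in the sets have a convergent subsequence in the unit ball.\<close>
    have "E \<noteq> {}"
    proof
      assume "E = {}"
      have "\<forall>n. \<exists>y. y \<in> K (r n)" using K(3) by blast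
      then obtain y where "\<And>n. y n \<in> K (r n)" by metis
      moreover from this have "\<forall>n. y n \<in> cball 0 1" using K(4) by blast
      then obtain y0 k where k: "strict_mono (k :: nat \<Rightarrow> nat)" "(y \<circ> k) \<longlonglongrightarrow> y0"
        using compact_cball unfolding compact_def by (metis (no_types, lifting))
      ultimately show False
        using upper[OF k] \<open>E = {}\<close> by (simp add: eventually_False)
    qed
    have energy_bound: "eventually (\<lambda>n. sym_energy s (K (r n)) \<le> ennreal (m + \<delta>)) sequentially"
      if "0 < \<delta>" for \<delta>
    proof -
      obtain N where N: "1 / (real N + 1) < \<delta>"
        using reals_Archimedean[OF \<open>0 < \<delta>\<close>] by (auto simp: inverse_eq_divide add.commute)
      have "sym_energy s (K (r n)) \<le> ennreal (m + \<delta>)" if "N \<le> n" for n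
      proof -
        have "N \<le> r n" using that seq_suble[OF r, of n] by simp
        then have "1 / (real (r n) + 1) \<le> 1 / (real N + 1)" by (simp add: frac_le)
        then have "ennreal (m + 1 / (real (r n) + 1)) \<le> ennreal (m + \<delta>)"
          using N by (intro ennreal_leI) simp
        then show ?thesis using K(6)[of "r n"] by (rule order_trans[rotated])
      qed
      then show ?thesis by (auto simp: eventually_sequentially)
    qed
    have int: "interior E \<noteq> {}"
    proof
      assume "interior E = {}"
      then obtain a b where ab: "a \<noteq> 0" "E \<subseteq> {x. a \<bullet> x = b}"
        using empty_interior_subset_hyperplane[OF E(1)] by metis
      define e \<beta> where "e = a /\<^sub>R norm a" and "\<beta> = b / norm a"
      have e: "norm e = 1" "\<And>x. x \<in> E \<Longrightarrow> e \<bullet> x = \<beta>"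
        using ab by (auto simp: e_def \<beta>_def divide_inverse mult.commute)
      define C where "C = (pi / 5 powr (2 + s)) powr (1 / s)"
      have "0 < C" by (simp add: C_def)
      \<comment> \<open>With this \<delta> the strip bound C / \<delta> equals m + 2, above the
        eventual energy bound m + 1.\<close>
      define \<delta> where "\<delta> = C / (m + 2)"
      have "0 < \<delta>" using \<open>0 < C\<close> m by (simp add: \<delta>_def)
      have "eventually (\<lambda>n. (\<forall>y\<in>K (r n). infdist y E < \<delta>) \<and> sym_energy s (K (r n)) \<le> ennreal (m + 1)) sequentially"
        using outer[OF \<open>0 < \<delta>\<close>] energy_bound[of 1] by (auto intro: eventually_conj)
      from eventually_happens'[OF sequentially_bot this]
      obtain n where n: "\<And>y. y \<in> K (r n) \<Longrightarrow> infdist y E < \<delta>" "sym_energy s (K (r n)) \<le> ennreal (m + 1)"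
        by blast
      have strip: "\<bar>e \<bullet> y - \<beta>\<bar> \<le> \<delta>" if "y \<in> K (r n)" for y
      proof -
        obtain x where x: "x \<in> E" "infdist y E = dist y x"
          using infdist_attains_inf[OF compact_imp_closed[OF E(2)] \<open>E \<noteq> {}\<close>] by metis
        have "\<bar>e \<bullet> (y - x)\<bar> \<le> dist y x"
          using Cauchy_Schwarz_ineq2[of e "y - x"] e(1) by (simp add: dist_norm)
        then show ?thesis using n(1)[OF that] x e(2)[OF x(1)] by (simp add: inner_diff_right)
      qed
      obtain P Q where "P \<in> K (r n)" "Q \<in> K (r n)" "dist P Q = 1" using K(5) by blast
      then have "ennreal (C / \<delta>) \<le> sym_energy s (K (r n))"
        unfolding C_def by (intro sym_energy_ge_strip[OF assms(1) \<open>0 < \<delta>\<close> e(1) K(1,2) strip])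
      also have "\<dots> \<le> ennreal (m + 1)" by (rule n(2))
      finally have "C / \<delta> \<le> m + 1" using m(1) by (subst (asm) ennreal_le_iff) auto
      moreover have "C / \<delta> = m + 2" using \<open>0 < C\<close> m(1) by (simp add: \<delta>_def)
      ultimately show False by simp
    qed
    have "\<exists>G. G \<in> borel_measurable borel \<and> (\<forall>x\<in>frontier E. epow (1 / s) (sym_curv s E x) \<le> G x) \<and>
        (\<integral>\<^sup>+x\<in>frontier E. G x \<partial>hausdorff1) \<le> ennreal m"
    proof (rule sym_energy_lower_semicontinuous[of s E "\<lambda>n. K (r n)" m, OF assms(1) E int K(1-3)])
      show "eventually (\<lambda>n. y n \<notin> K (r (q n))) sequentially"
        if "strict_mono q" "y \<longlonglongrightarrow> y0" "y0 \<notin> E" for q y y0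
        using that by (rule upper)
      show "eventually (\<lambda>n. \<forall>x\<in>E. infdist x (K (r n)) < \<delta>) sequentially" if "0 < \<delta>" for \<delta>
        using that by (rule lower)
      show "eventually (\<lambda>n. \<forall>y\<in>K (r n). infdist y E < \<delta>) sequentially" if "0 < \<delta>" for \<delta>
        using that by (rule outer)
      show "eventually (\<lambda>n. sym_energy s (K (r n)) \<le> ennreal (m + \<delta>)) sequentially" if "0 < \<delta>" for \<delta>
        using that by (rule energy_bound)
    qed (use m(1) in auto)
    then obtain G where G: "G \<in> borel_measurable borel"
      "\<And>x. x \<in> frontier E \<Longrightarrow> epow (1 / s) (sym_curv s E x) \<le> G x"
      "(\<integral>\<^sup>+x\<in>frontier E. G x \<partial>hausdorff1) \<le> ennreal m"
      by blast
    have "(\<integral>\<^sup>+x\<in>frontier E. G x \<partial>hausdorff1) < top"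
      using G(3) by (rule le_less_trans) simp
    then have "E \<in> C1_convex_bodies"
      using C1_convex_bodiesI[OF assms(1) E int G(2)] by blast
    moreover have "nonlocal_energy s (1 / s) E \<le> M"
      unfolding m(2) by (rule nonlocal_energy_le_of_majorant[OF assms(1) E int G ennreal_less_top])
    then have "\<forall>F\<in>C1_convex_bodies. nonlocal_energy s (1 / s) E \<le> nonlocal_energy s (1 / s) F"
      unfolding M_def by (auto simp: le_INF_iff)
    ultimately show ?thesis by blast
  qed
qed

theorem theorem1p2:
  fixes s :: real
  assumes "0 < s" and "s < 1"
  shows "\<exists>E\<in>C1_convex_bodies. \<forall>F\<in>C1_convex_bodies.
           nonlocal_energy s (1 / s) E \<le> nonlocal_energy s (1 / s) F"
proof (cases "\<exists>F\<in>C1_convex_bodies. nonlocal_energy s (1 / s) F < top")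
  case True
  then show ?thesis by (rule exists_minimizer[OF assms(1)])
next
  \<comment> \<open>All energies are infinite, so the disc is a minimizer.\<close>
  case False
  then have "nonlocal_energy s (1 / s) F = top" if "F \<in> C1_convex_bodies" for F
    using that by (simp add: top.not_eq_extremum[symmetric])
  then show ?thesis using disc_in_C1_convex_bodies by auto
qed

end
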